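(* Let $\alpha\in(0,1]$, let $P\in\mathcal{A}$ be a self-adjoint projection with $\tau(P)=\alpha$, and let $(Y_t)_{t\ge0}$ be a free unitary Brownian motion in $(\mathcal{A},\tau)$ such that $P$ and $(Y_t)_{t\ge0}$ are $\star$-free. Let $R^{(\alpha)}_{m,n}(t)=e^{t(m+n)/2}\tau[(PY_t)^m(PY_t^\star)^n]$ for $m,n\ge0$, $(m,n)\neq(0,0)$, $R^{(\alpha)}_{0,0}(t):=\alpha$, and $$\phi^{(\alpha)}(t,y,z)=\sum_{m,n\ge0}R^{(\alpha)}_{m,n}(t)\,y^mz^n,$$ which converges absolutely, for each fixed $t\ge0$, in some neighborhood of $(y,z)=(0,0)$. Let $\eta(t,z):=\sum_{n\ge1}Q_n(t)z^n$, where $Q_n(t)=e^{nt/2}\tau(Y_t^n)$. Then, near $(y,z)=(0,0)$, $$\partial_t\phi^{(\alpha)}+\alpha y\,\eta(\alpha t,y)\,\partial_y\phi^{(\alpha)}+\alpha z\,\eta(\alpha t,z)\,\partial_z\phi^{(\alpha)}=e^t\,yz\,\phi^{(\alpha)}(t,y,z)^2.$$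
   Context: $(\mathcal{A},\tau)$ is a non-commutative $\star$-probability space: $\mathcal{A}$ is a unital von Neumann algebra with a faithful tracial state $\tau$. A free unitary Brownian motion $(Y_t)_{t\ge0}$ is the unitary-valued solution of the free stochastic differential equation $dY_t=iY_t\,dX_t-\frac12Y_t\,dt$, $Y_0=\mathbf 1$, where $(X_t)_{t\ge0}$ is a free additive Brownian motion in $\mathcal{A}$. When $n=0$ (resp. $m=0$), the factor $(PY_t^\star)^n$ (resp. $(PY_t)^m$) is omitted. It is known that $Q_n(t)=\frac1n\sum_{r=0}^{n-1}\binom{n}{r+1}\frac{(-nt)^r}{r!}$ for $n\ge1$. *)

theory Defs
  imports "HOL-Analysis.Analysis"
begin

class complex_vector = real_vector +
  fixes scaleC :: "complex \<Rightarrow> 'a \<Rightarrow> 'a"  (infixr "*\<^sub>C" 75)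
  assumes scaleC_of_real: "complex_of_real r *\<^sub>C x = r *\<^sub>R x"
    and scaleC_scaleC: "a *\<^sub>C b *\<^sub>C x = (a * b) *\<^sub>C x"
    and scaleC_add_left: "(a + b) *\<^sub>C x = a *\<^sub>C x + b *\<^sub>C x"
    and scaleC_add_right: "a *\<^sub>C (x + y) = a *\<^sub>C x + a *\<^sub>C y"

text \<open>The inner product is linear in the first argument.\<close>

class complex_hilbert_space = complex_vector + real_normed_vector + complete_space +
  fixes cinner :: "'a \<Rightarrow> 'a \<Rightarrow> complex"
  assumes cinner_add_left: "cinner (x + y) z = cinner x z + cinner y z"
    and cinner_scaleC_left: "cinner (c *\<^sub>C x) y = c * cinner x y"
    and cinner_commute: "cinner x y = cnj (cinner y x)"
    and cinner_self: "cinner x x = complex_of_real ((norm x)\<^sup>2)"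
begin

lemma norm_scaleC: "norm (c *\<^sub>C x) = cmod c * norm x"
proof -
  have "complex_of_real ((norm (c *\<^sub>C x))\<^sup>2) = c * cnj (c * cinner x x)"
    by (metis cinner_self cinner_scaleC_left cinner_commute)
  also have "\<dots> = complex_of_real ((cmod c * norm x)\<^sup>2)"
    by (simp add: cinner_self power_mult_distrib) (metis complex_norm_square of_real_power)
  finally have "(norm (c *\<^sub>C x))\<^sup>2 = (cmod c * norm x)\<^sup>2"
    using of_real_eq_iff by blast
  then show ?thesis by simp
qed

end

typedef (overloaded) ('h::complex_hilbert_space) cop =
  "{T :: 'h \<Rightarrow>\<^sub>L 'h. \<forall>c x. blinfun_apply T (c *\<^sub>C x) = c *\<^sub>C blinfun_apply T x}"
  by (rule exI[of _ id_blinfun]) simp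

setup_lifting type_definition_cop

lift_definition cop_apply :: "'h::complex_hilbert_space cop \<Rightarrow> 'h \<Rightarrow> 'h" is blinfun_apply .

lemma bounded_linear_scaleC: "bounded_linear (\<lambda>x::'h::complex_hilbert_space. c *\<^sub>C x)"
proof (rule bounded_linear_intro[where K = "cmod c"])
  fix r and x :: 'h
  show "c *\<^sub>C r *\<^sub>R x = r *\<^sub>R c *\<^sub>C x"
    by (metis scaleC_of_real scaleC_scaleC mult.commute)
qed (simp_all add: scaleC_add_right norm_scaleC)

instantiation cop :: (complex_hilbert_space) real_vector
begin

lift_definition zero_cop :: "'a cop" is 0
  by (metis blinfun.zero_left mult_zero_left scaleC_of_real scaleC_scaleC scale_zero_left of_real_0
      scale_zero_right mult_zero_right)

lift_definition plus_cop :: "'a cop \<Rightarrow> 'a cop \<Rightarrow> 'a cop" is "(+)"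
  by (simp add: blinfun.add_left scaleC_add_right)

lift_definition scaleR_cop :: "real \<Rightarrow> 'a cop \<Rightarrow> 'a cop" is scaleR
  by (simp add: blinfun.scaleR_left scaleC_of_real[symmetric] scaleC_scaleC mult.commute)

lift_definition uminus_cop :: "'a cop \<Rightarrow> 'a cop" is uminus
  by (simp add: blinfun.minus_left)
    (metis add.inverse_unique add.right_inverse scaleC_add_right add_cancel_right_right)

definition minus_cop :: "'a cop \<Rightarrow> 'a cop \<Rightarrow> 'a cop"
  where "minus_cop S T = S + (- T)"

instance
proof
  fix S T U :: "'a cop" and r s :: real
  show "S + T + U = S + (T + U)" by transfer (rule add.assoc)
  show "S + T = T + S" by transfer (rule add.commute)
  show "0 + T = T" by transfer simp
  show "- T + T = 0" by transfer simp
  show "S - T = S + - T" by (rule minus_cop_def)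
  show "r *\<^sub>R (S + T) = r *\<^sub>R S + r *\<^sub>R T" by transfer (rule scaleR_add_right)
  show "(r + s) *\<^sub>R T = r *\<^sub>R T + s *\<^sub>R T" by transfer (rule scaleR_add_left)
  show "r *\<^sub>R s *\<^sub>R T = (r * s) *\<^sub>R T" by transfer simp
  show "1 *\<^sub>R T = T" by transfer simp
qed

end

instantiation cop :: (complex_hilbert_space) real_normed_vector
begin

lift_definition norm_cop :: "'a cop \<Rightarrow> real" is norm .

definition dist_cop :: "'a cop \<Rightarrow> 'a cop \<Rightarrow> real"
  where "dist_cop S T = norm (S - T)"

definition sgn_cop :: "'a cop \<Rightarrow> 'a cop"
  where "sgn_cop T = T /\<^sub>R norm T"

definition uniformity_cop :: "('a cop \<times> 'a cop) filter"
  where "uniformity_cop = (INF e\<in>{0 <..}. principal {(x, y). dist x y < e})"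

definition open_cop :: "'a cop set \<Rightarrow> bool"
  where "open_cop U = (\<forall>x\<in>U. eventually (\<lambda>(x', y). x' = x \<longrightarrow> y \<in> U) uniformity)"

instance
proof
  fix S T :: "'a cop" and r :: real and V :: "'a cop set"
  show "dist S T = norm (S - T)" by (rule dist_cop_def)
  show "sgn T = T /\<^sub>R norm T" by (rule sgn_cop_def)
  show "uniformity = (INF e\<in>{0 <..}. principal {(x, y :: 'a cop). dist x y < e})"
    by (rule uniformity_cop_def)
  show "open V = (\<forall>x\<in>V. eventually (\<lambda>(x', y). x' = x \<longrightarrow> y \<in> V) uniformity)"
    by (rule open_cop_def)
  show "(norm T = 0) = (T = 0)" by transfer simp
  show "norm (S + T) \<le> norm S + norm T" by transfer (rule norm_triangle_ineq)
  show "norm (r *\<^sub>R T) = \<bar>r\<bar> * norm T" by transfer simp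
qed

end

instantiation cop :: (complex_hilbert_space) complex_vector
begin

lift_definition scaleC_cop :: "complex \<Rightarrow> 'a cop \<Rightarrow> 'a cop"
  is "\<lambda>c T. Blinfun (\<lambda>x. c *\<^sub>C x) o\<^sub>L T"
  by (simp add: bounded_linear_Blinfun_apply[OF bounded_linear_scaleC] scaleC_scaleC mult.commute)

instance
proof
  fix a b :: complex and r :: real and S T :: "'a cop"
  note [simp] = bounded_linear_Blinfun_apply[OF bounded_linear_scaleC]
  show "complex_of_real r *\<^sub>C T = r *\<^sub>R T"
    by transfer (rule blinfun_eqI, simp add: scaleC_of_real blinfun.scaleR_left)
  show "a *\<^sub>C b *\<^sub>C T = (a * b) *\<^sub>C T"
    by transfer (rule blinfun_eqI, simp add: scaleC_scaleC)
  show "(a + b) *\<^sub>C T = a *\<^sub>C T + b *\<^sub>C T"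
    by transfer (rule blinfun_eqI, simp add: scaleC_add_left blinfun.add_left)
  show "a *\<^sub>C (S + T) = a *\<^sub>C S + a *\<^sub>C T"
    by transfer (rule blinfun_eqI, simp add: scaleC_add_right blinfun.add_left)
qed

end

instantiation cop :: (complex_hilbert_space) "{real_normed_algebra, monoid_mult}"
begin

lift_definition one_cop :: "'a cop" is id_blinfun by simp

lift_definition times_cop :: "'a cop \<Rightarrow> 'a cop \<Rightarrow> 'a cop" is "(o\<^sub>L)" by simp

instance
proof
  fix S T U :: "'a cop" and r :: real
  show "S * T * U = S * (T * U)" by transfer (rule blinfun_eqI, simp)
  show "(S + T) * U = S * U + T * U" by transfer (rule blinfun_eqI, simp add: blinfun.add_left)
  show "S * (T + U) = S * T + S * U"
    by transfer (rule blinfun_eqI, simp add: blinfun.add_left blinfun.add_right)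
  show "r *\<^sub>R S * T = r *\<^sub>R (S * T)"
    by transfer (rule blinfun_eqI, simp add: blinfun.scaleR_left)
  show "S * r *\<^sub>R T = r *\<^sub>R (S * T)"
    by transfer (rule blinfun_eqI, simp add: blinfun.scaleR_left blinfun.scaleR_right)
  show "1 * T = T" by transfer (rule blinfun_eqI, simp)
  show "T * 1 = T" by transfer (rule blinfun_eqI, simp)
  show "norm (S * T) \<le> norm S * norm T" by transfer (rule norm_blinfun_compose)
qed

end

text \<open>The Hilbert space adjoint; existence and uniqueness come from the Riesz representation theorem.\<close>

definition star :: "'h::complex_hilbert_space cop \<Rightarrow> 'h cop" where
  "star T = (THE S. \<forall>x y. cinner (cop_apply S x) y = cinner x (cop_apply T y))"

definition commutant :: "'h::complex_hilbert_space cop set \<Rightarrow> 'h cop set" where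
  "commutant S = {T. \<forall>A\<in>S. T * A = A * T}"

text \<open>
  Equality with the double commutant makes the algebra unital and weakly closed, and the
  double commutant of a self-adjoint set is the von Neumann algebra generated by it.
\<close>

definition von_neumann_algebra :: "'h::complex_hilbert_space cop set \<Rightarrow> bool" where
  "von_neumann_algebra M \<longleftrightarrow> star ` M \<subseteq> M \<and> commutant (commutant M) = M"

definition vN_generated :: "'h::complex_hilbert_space cop set \<Rightarrow> 'h cop set" where
  "vN_generated S = commutant (commutant (S \<union> star ` S))"

text \<open>The functional is a total function on all operators; only its values on the algebra matter.\<close>

definition faithful_tracial_state ::
    "'h::complex_hilbert_space cop set \<Rightarrow> ('h cop \<Rightarrow> complex) \<Rightarrow> bool" where
  "faithful_tracial_state M \<tau> \<longleftrightarrow>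
     (\<forall>A\<in>M. \<forall>B\<in>M. \<tau> (A + B) = \<tau> A + \<tau> B) \<and>
     (\<forall>c. \<forall>A\<in>M. \<tau> (c *\<^sub>C A) = c * \<tau> A) \<and>
     \<tau> 1 = 1 \<and>
     (\<forall>A\<in>M. \<tau> (star A * A) \<in> \<real>\<^sub>\<ge>\<^sub>0) \<and>
     (\<forall>A\<in>M. \<tau> (star A * A) = 0 \<longrightarrow> A = 0) \<and>
     (\<forall>A\<in>M. \<forall>B\<in>M. \<tau> (A * B) = \<tau> (B * A))"

definition nc_probability_space ::
    "'h::complex_hilbert_space cop set \<Rightarrow> ('h cop \<Rightarrow> complex) \<Rightarrow> bool" where
  "nc_probability_space M \<tau> \<longleftrightarrow> von_neumann_algebra M \<and> faithful_tracial_state M \<tau>"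

definition l2_norm :: "('h::complex_hilbert_space cop \<Rightarrow> complex) \<Rightarrow> 'h cop \<Rightarrow> real" where
  "l2_norm \<tau> A = sqrt (Re (\<tau> (star A * A)))"

inductive_set star_algebra :: "'h::complex_hilbert_space cop set \<Rightarrow> 'h cop set"
  for S :: "'h cop set" where
  incl: "A \<in> S \<Longrightarrow> A \<in> star_algebra S"
| one: "1 \<in> star_algebra S"
| star: "A \<in> star_algebra S \<Longrightarrow> star A \<in> star_algebra S"
| scale: "A \<in> star_algebra S \<Longrightarrow> c *\<^sub>C A \<in> star_algebra S"
| add: "A \<in> star_algebra S \<Longrightarrow> B \<in> star_algebra S \<Longrightarrow> A + B \<in> star_algebra S"
| mult: "A \<in> star_algebra S \<Longrightarrow> B \<in> star_algebra S \<Longrightarrow> A * B \<in> star_algebra S"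

text \<open>A word is a list of pairs of a subalgebra's index and an element of that subalgebra.\<close>

definition free_algebras ::
    "('h::complex_hilbert_space cop \<Rightarrow> complex) \<Rightarrow> ('i \<Rightarrow> 'h cop set) \<Rightarrow> bool" where
  "free_algebras \<tau> \<A> \<longleftrightarrow>
     (\<forall>w :: ('i \<times> 'h cop) list.
        w \<noteq> [] \<and> distinct_adj (map fst w) \<and> (\<forall>(i, A)\<in>set w. A \<in> \<A> i \<and> \<tau> A = 0)
        \<longrightarrow> \<tau> (prod_list (map snd w)) = 0)"

definition star_free ::
    "('h::complex_hilbert_space cop \<Rightarrow> complex) \<Rightarrow> 'h cop set \<Rightarrow> 'h cop set \<Rightarrow> bool" where
  "star_free \<tau> S T \<longleftrightarrow>
     free_algebras \<tau> (\<lambda>b::bool. if b then star_algebra S else star_algebra T)"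

text \<open>
  The distribution of a bounded self-adjoint operator is determined by its moments, so these are
  required to be those of the centred semicircle law of variance \<open>v\<close>. Meaningful for \<open>v > 0\<close> only.
\<close>

definition semicircular ::
    "('h::complex_hilbert_space cop \<Rightarrow> complex) \<Rightarrow> real \<Rightarrow> 'h cop \<Rightarrow> bool" where
  "semicircular \<tau> v A \<longleftrightarrow> star A = A \<and>
     (\<forall>n. \<tau> (A ^ n) = complex_of_real
        (integral {- 2 * sqrt v .. 2 * sqrt v} (\<lambda>x. x ^ n * (sqrt (4 * v - x\<^sup>2) / (2 * pi * v)))))"

definition natural_filtration ::
    "(real \<Rightarrow> 'h::complex_hilbert_space cop) \<Rightarrow> real \<Rightarrow> 'h cop set" where
  "natural_filtration X t = vN_generated (X ` {0..t})"

text \<open>All processes are indexed by \<open>t \<ge> 0\<close>; their values at negative times play no role.\<close>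

definition free_additive_brownian_motion ::
    "'h::complex_hilbert_space cop set \<Rightarrow> ('h cop \<Rightarrow> complex) \<Rightarrow> (real \<Rightarrow> 'h cop) \<Rightarrow> bool" where
  "free_additive_brownian_motion M \<tau> X \<longleftrightarrow>
     (\<forall>t\<ge>0. X t \<in> M \<and> star (X t) = X t) \<and> X 0 = 0 \<and>
     (\<forall>s t. 0 \<le> s \<and> s < t \<longrightarrow>
        semicircular \<tau> (t - s) (X t - X s) \<and>
        star_free \<tau> {X t - X s} (natural_filtration X s))"

text \<open>
  The step process \<open>\<Sum>\<^bsub>j<k\<^esub> a\<^sub>j 1\<^bsub>[u\<^sub>j, u\<^sub>j\<^sub>+\<^sub>1)\<^esub>\<close> and its stochastic integral. As in Ito's
  construction, \<open>J\<close> is the integral of \<open>A\<^sub>s dX\<^sub>s\<close> over \<open>[0, t]\<close> if it is the limit in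
  \<open>L\<^sup>2(\<tau>)\<close> of the integrals of adapted step processes which converge to \<open>A\<close> in
  \<open>L\<^sup>2([0, t]; L\<^sup>2(\<tau>))\<close>.
\<close>

definition step_process ::
    "nat \<Rightarrow> (nat \<Rightarrow> real) \<Rightarrow> (nat \<Rightarrow> 'h::complex_hilbert_space cop) \<Rightarrow> real \<Rightarrow> 'h cop" where
  "step_process k u a s = (\<Sum>j<k. if u j \<le> s \<and> s < u (Suc j) then a j else 0)"

definition step_integral ::
    "(real \<Rightarrow> 'h::complex_hilbert_space cop) \<Rightarrow> nat \<Rightarrow> (nat \<Rightarrow> real) \<Rightarrow> (nat \<Rightarrow> 'h cop) \<Rightarrow> 'h cop"
  where
  "step_integral X k u a = (\<Sum>j<k. a j * (X (u (Suc j)) - X (u j)))"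

definition adapted_step ::
    "(real \<Rightarrow> 'h::complex_hilbert_space cop) \<Rightarrow> real \<Rightarrow> nat \<Rightarrow> (nat \<Rightarrow> real) \<Rightarrow> (nat \<Rightarrow> 'h cop) \<Rightarrow> bool"
  where
  "adapted_step X t k u a \<longleftrightarrow> u 0 = 0 \<and> u k = t \<and>
     (\<forall>j<k. u j \<le> u (Suc j) \<and> a j \<in> natural_filtration X (u j))"

definition has_free_ito_integral ::
    "('h::complex_hilbert_space cop \<Rightarrow> complex) \<Rightarrow> (real \<Rightarrow> 'h cop) \<Rightarrow> real \<Rightarrow>
     (real \<Rightarrow> 'h cop) \<Rightarrow> 'h cop \<Rightarrow> bool" where
  "has_free_ito_integral \<tau> X t A J \<longleftrightarrow>
     (\<exists>k u a.
        (\<forall>n::nat. adapted_step X t (k n) (u n) (a n)) \<and>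
        (\<forall>n. (\<lambda>s. (l2_norm \<tau> (step_process (k n) (u n) (a n) s - A s))\<^sup>2) integrable_on {0..t}) \<and>
        (\<lambda>n. integral {0..t} (\<lambda>s. (l2_norm \<tau> (step_process (k n) (u n) (a n) s - A s))\<^sup>2))
          \<longlonglongrightarrow> 0 \<and>
        (\<lambda>n. l2_norm \<tau> (step_integral X (k n) (u n) (a n) - J)) \<longlonglongrightarrow> 0)"

text \<open>
  The equation \<open>dY = iY dX - (1/2) Y dt\<close>, \<open>Y\<^sub>0 = 1\<close>, in integrated form, for a unitary-valued
  process adapted to the filtration of \<open>X\<close>. The drift is integrated in operator norm.
\<close>

definition free_unitary_brownian_motion ::
    "'h::complex_hilbert_space cop set \<Rightarrow> ('h cop \<Rightarrow> complex) \<Rightarrow> (real \<Rightarrow> 'h cop) \<Rightarrow> bool" where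
  "free_unitary_brownian_motion M \<tau> Y \<longleftrightarrow>
     (\<exists>X. free_additive_brownian_motion M \<tau> X \<and>
        (\<forall>t\<ge>0. Y t \<in> natural_filtration X t \<and> star (Y t) * Y t = 1 \<and> Y t * star (Y t) = 1) \<and>
        Y 0 = 1 \<and>
        (\<forall>t\<ge>0. \<exists>J D. has_free_ito_integral \<tau> X t Y J \<and> (Y has_integral D) {0..t} \<and>
           Y t = 1 + \<i> *\<^sub>C J - (1/2) *\<^sub>C D))"

text \<open>At \<open>(0, 0)\<close> the general formula would give \<open>\<tau> 1 = 1\<close> rather than \<open>\<alpha> = \<tau> P\<close>.\<close>

definition R_mom ::
    "('h::complex_hilbert_space cop \<Rightarrow> complex) \<Rightarrow> real \<Rightarrow> 'h cop \<Rightarrow> (real \<Rightarrow> 'h cop) \<Rightarrow>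
     nat \<Rightarrow> nat \<Rightarrow> real \<Rightarrow> complex" where
  "R_mom \<tau> \<alpha> P Y m n t =
     (if m = 0 \<and> n = 0 then complex_of_real \<alpha>
      else complex_of_real (exp (t * real (m + n) / 2)) *
           \<tau> ((P * Y t) ^ m * (P * star (Y t)) ^ n))"

definition phi ::
    "('h::complex_hilbert_space cop \<Rightarrow> complex) \<Rightarrow> real \<Rightarrow> 'h cop \<Rightarrow> (real \<Rightarrow> 'h cop) \<Rightarrow>
     real \<Rightarrow> complex \<Rightarrow> complex \<Rightarrow> complex" where
  "phi \<tau> \<alpha> P Y t y z = (\<Sum>\<^sub>\<infinity>(m, n)\<in>UNIV. R_mom \<tau> \<alpha> P Y m n t * y ^ m * z ^ n)"

definition Q_mom ::
    "('h::complex_hilbert_space cop \<Rightarrow> complex) \<Rightarrow> (real \<Rightarrow> 'h cop) \<Rightarrow> nat \<Rightarrow> real \<Rightarrow> complex" where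
  "Q_mom \<tau> Y n t = complex_of_real (exp (real n * t / 2)) * \<tau> (Y t ^ n)"

definition eta ::
    "('h::complex_hilbert_space cop \<Rightarrow> complex) \<Rightarrow> (real \<Rightarrow> 'h cop) \<Rightarrow> real \<Rightarrow> complex \<Rightarrow> complex" where
  "eta \<tau> Y t z = (\<Sum>\<^sub>\<infinity>n\<in>{1..}. Q_mom \<tau> Y n t * z ^ n)"

end

theory Submission
  imports Defs
begin

text \<open>
  Ito's formula for \<open>(P Y\<^sub>t)\<^sup>m (P Y\<^sub>t\<^sup>*)\<^sup>n\<close> expresses the time derivative of its trace by sums, over pairs of
  factors \<open>Y\<close> or \<open>Y\<^sup>*\<close>, of products of two such traces. In terms of the generating function this is the
  differential equation, with \<open>\<Sum>\<^bsub>l\<ge>1\<^esub> R\<^bsub>l,0\<^esub>(t) y\<^sup>l\<close> in the place of \<open>\<alpha> \<eta>(\<alpha>t, y)\<close>; both are equal, since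
  \<open>R\<^bsub>l,0\<^esub>(t)\<close> and \<open>\<alpha> Q\<^sub>l(\<alpha>t)\<close> solve the same triangular system with the same initial value.

  Since \<open>P\<close> is free from \<open>Y\<close>, but not necessarily from the Brownian motion driving it, stochastic calculus is
  only applied to \<open>\<tau>(Y\<^sub>t\<^sup>k)\<close>. The formula for words in \<open>P\<close> and \<open>Y\<^sub>t\<close> follows algebraically: any such word is a
  combination of powers of \<open>Y\<^sub>t\<close> and of alternating words with centred letters, for which both the trace and
  the Ito drift have trace zero.
\<close>

section \<open>Operators on a complex Hilbert space\<close>

text \<open>Ito's formula is encoded as a property of formal differentials (value, gradient, drift):
  the trace of the value has the trace of the drift as its derivative. The property passes to sums
  and to equal data, but not visibly to products, so words are rewritten as sums. The rewriting must
  respect gradients and drifts too; hence relations such as \<open>star Y * Y = 1\<close> are lifted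
  to formal differentials and gradients are compared as tensors. Alternating centred words have a
  drift of trace zero because each correction term of the product rule carries, as a scalar factor,
  the trace of an element of the algebra of \<open>Y\<close> times such a word. On the analytic
  side, \<open>Y\<close> is known only through L2 limits. Over a time step h its increments have L2
  size sqrt h and their first-order expansion has an L2 error of order h. Three increments under one
  trace are controlled by the fourth moment of the driving increments and by the norm bound 2 for
  differences of unitaries. All errors are of order h sqrt h, which suffices for a
  derivative.\<close>

instance complex_hilbert_space \<subseteq> banach ..

lemma scaleC_one [simp]: "(1::complex) *\<^sub>C (x::'a::complex_vector) = x"
  by (metis scaleC_of_real of_real_1 scale_one)

lemma scaleC_zero_left [simp]: "(0::complex) *\<^sub>C (x::'a::complex_vector) = 0"
  by (metis scaleC_of_real of_real_0 scale_zero_left)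

lemma scaleC_zero_right [simp]: "c *\<^sub>C (0::'a::complex_vector) = 0"
  by (metis mult_zero_right scaleC_scaleC scaleC_zero_left)

lemma scaleC_minus_left [simp]: "(- c) *\<^sub>C (x::'a::complex_vector) = - (c *\<^sub>C x)"
  by (metis add.inverse_unique add.right_inverse scaleC_add_left scaleC_zero_left)

lemma scaleC_minus_right [simp]: "c *\<^sub>C (- x::'a::complex_vector) = - (c *\<^sub>C x)"
  by (metis add.inverse_unique add.right_inverse scaleC_add_right scaleC_zero_right)

lemma scaleC_diff_left: "(a - b) *\<^sub>C (x::'a::complex_vector) = a *\<^sub>C x - b *\<^sub>C x"
  using scaleC_add_left[of a "- b" x] by simp

lemma scaleC_diff_right: "a *\<^sub>C (x - y::'a::complex_vector) = a *\<^sub>C x - a *\<^sub>C y"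
  using scaleC_add_right[of a x "- y"] by simp

lemma scaleC_minus1: "(- 1) *\<^sub>C (x::'a::complex_vector) = - x"
  by simp

lemma cinner_add_right:
  "cinner (x::'a::complex_hilbert_space) (y + z) = cinner x y + cinner x z"
  by (metis cinner_add_left cinner_commute complex_cnj_add)

lemma cinner_scaleC_right:
  "cinner (x::'a::complex_hilbert_space) (c *\<^sub>C y) = cnj c * cinner x y"
  by (metis cinner_scaleC_left cinner_commute complex_cnj_mult)

lemma cinner_zero_left [simp]: "cinner 0 (y::'a::complex_hilbert_space) = 0"
  by (metis cinner_scaleC_left mult_zero_left scaleC_zero_left)

lemma cinner_zero_right [simp]: "cinner (y::'a::complex_hilbert_space) 0 = 0"
  by (metis cinner_commute cinner_zero_left complex_cnj_zero)

lemma cinner_minus_left: "cinner (- x) (y::'a::complex_hilbert_space) = - cinner x y"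
  by (metis cinner_scaleC_left mult_minus1 scaleC_minus1)

lemma cinner_minus_right: "cinner (y::'a::complex_hilbert_space) (- x) = - cinner y x"
  by (metis cinner_commute cinner_minus_left complex_cnj_minus)

lemma cinner_diff_left: "cinner (x - y) (z::'a::complex_hilbert_space) = cinner x z - cinner y z"
  using cinner_add_left[of x "- y" z] by (simp add: cinner_minus_left)

lemma cinner_scaleR_left: "cinner (r *\<^sub>R x) (y::'a::complex_hilbert_space) = of_real r * cinner x y"
  by (metis cinner_scaleC_left scaleC_of_real)

lemma cinner_scaleR_right: "cinner (y::'a::complex_hilbert_space) (r *\<^sub>R x) = of_real r * cinner y x"
  by (metis cinner_scaleC_right scaleC_of_real complex_cnj_complex_of_real)

lemma norm_add_sq:
  "(norm (x + y::'a::complex_hilbert_space))\<^sup>2 = (norm x)\<^sup>2 + 2 * Re (cinner x y) + (norm y)\<^sup>2"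
proof -
  have "complex_of_real ((norm (x + y))\<^sup>2) = cinner (x + y) (x + y)"
    by (simp add: cinner_self)
  also have "\<dots> = cinner x x + (cinner x y + cnj (cinner x y)) + cinner y y"
    by (simp add: cinner_add_left cinner_add_right cinner_commute[of y x])
  also have "\<dots> = complex_of_real ((norm x)\<^sup>2 + 2 * Re (cinner x y) + (norm y)\<^sup>2)"
    unfolding complex_add_cnj by (simp add: cinner_self)
  finally show ?thesis
    using of_real_eq_iff by blast
qed

text \<open>The expansion of \<open>\<parallel>b x - a y\<parallel>\<^sup>2\<close> with \<open>a = \<langle>x, y\<rangle>\<close> and \<open>b = \<parallel>y\<parallel>\<^sup>2\<close>.\<close>

lemma cmod_cinner_le: "cmod (cinner x y) \<le> norm x * norm (y::'a::complex_hilbert_space)"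
proof (cases "y = 0")
  case False
  define a b where "a = cinner x y" and "b = (norm y)\<^sup>2"
  have "b > 0" using False by (simp add: b_def)
  have "cinner (b *\<^sub>R x) ((- a) *\<^sub>C y) = - (of_real b * (a * cnj a))"
    unfolding cinner_scaleR_left cinner_scaleC_right by (simp add: a_def)
  also have "\<dots> = of_real (- (b * (cmod a)\<^sup>2))"
    using complex_norm_square[of a] by simp
  finally have cross: "Re (cinner (b *\<^sub>R x) ((- a) *\<^sub>C y)) = - (b * (cmod a)\<^sup>2)"
    by simp
  have "0 \<le> (norm (b *\<^sub>R x + (- a) *\<^sub>C y))\<^sup>2"
    by simp
  also have "\<dots> = b\<^sup>2 * (norm x)\<^sup>2 - 2 * b * (cmod a)\<^sup>2 + (cmod a)\<^sup>2 * b"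
    unfolding norm_add_sq cross norm_scaleC by (simp add: b_def power_mult_distrib)
  also have "\<dots> = b * (b * (norm x)\<^sup>2 - (cmod a)\<^sup>2)"
    by (simp add: algebra_simps power2_eq_square)
  finally have "(cmod a)\<^sup>2 \<le> (norm x * norm y)\<^sup>2"
    using \<open>b > 0\<close> by (simp add: zero_le_mult_iff b_def power_mult_distrib mult.commute)
  then show ?thesis
    unfolding a_def by (rule power2_le_imp_le) simp
qed simp

text \<open>The representing vector is the minimiser of \<open>norm x ^ 2 - 2 * Re (f x)\<close>.
  Completing the square bounds this functional below by \<open>- K ^ 2\<close>, the parallelogram
  law makes a minimising sequence Cauchy, and the vanishing first variation at the limit gives the
  real part of the claim.\<close>

lemma riesz_representation:
  fixes f :: "'a::complex_hilbert_space \<Rightarrow> complex"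
  assumes add: "\<And>x y. f (x + y) = f x + f y"
    and scale: "\<And>c x. f (c *\<^sub>C x) = c * f x"
    and bound: "\<And>x. cmod (f x) \<le> K * norm x"
  shows "\<exists>z. \<forall>x. f x = cinner x z"
proof -
  define \<Phi> where "\<Phi> x = (norm x)\<^sup>2 - 2 * Re (f x)" for x
  have lower: "- K\<^sup>2 \<le> \<Phi> x" for x
  proof -
    have "Re (f x) \<le> K * norm x"
      using bound[of x] complex_Re_le_cmod[of "f x"] by linarith
    moreover have "0 \<le> (norm x - K)\<^sup>2" by simp
    ultimately show ?thesis unfolding \<Phi>_def power2_diff by (simp add: mult.commute)
  qed
  define m where "m = Inf (range \<Phi>)"
  have bdd: "bdd_below (range \<Phi>)"
    using lower by (intro bdd_belowI2[where m = "- K\<^sup>2"]) auto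
  have m_le: "m \<le> \<Phi> x" for x
    unfolding m_def by (rule cInf_lower) (auto simp: bdd)
  have scaleR: "f (r *\<^sub>R x) = of_real r * f x" for r x
    by (metis scale scaleC_of_real)
  \<comment> \<open>The parallelogram identity; the linear parts of \<open>\<Phi>\<close>
    cancel.\<close>
  have half: "\<Phi> x + \<Phi> y - 2 * \<Phi> ((1/2) *\<^sub>R (x + y)) = (norm (x - y))\<^sup>2 / 2" for x y
  proof -
    have "(norm (x - y))\<^sup>2 = (norm x)\<^sup>2 - 2 * Re (cinner x y) + (norm y)\<^sup>2"
      using norm_add_sq[of x "- y"] by (simp add: cinner_minus_right)
    then show ?thesis
      unfolding \<Phi>_def scaleR add norm_scaleR power_mult_distrib norm_add_sq
      by (simp add: field_simps power2_eq_square)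
  qed
  have close: "(norm (x - y))\<^sup>2 \<le> 2 * (\<Phi> x - m) + 2 * (\<Phi> y - m)" for x y
  proof -
    have "(norm (x - y))\<^sup>2 = 2 * (\<Phi> x + \<Phi> y - 2 * \<Phi> ((1/2) *\<^sub>R (x + y)))"
      using half[of x y] by simp
    then show ?thesis using m_le[of "(1/2) *\<^sub>R (x + y)"] by (simp add: algebra_simps)
  qed
  have "\<exists>x. \<Phi> x < m + inverse (real (Suc n))" for n
  proof -
    have "Inf (range \<Phi>) < m + inverse (real (Suc n))" unfolding m_def by simp
    then show ?thesis using cInf_lessD[of "range \<Phi>"] by auto
  qed
  then obtain X where X: "\<Phi> (X n) < m + inverse (real (Suc n))" for n by metis
  have "Cauchy X"
  proof (rule metric_CauchyI)
    fix e :: real assume "e > 0"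
    then obtain N where N: "inverse (real (Suc N)) < e\<^sup>2 / 4"
      using reals_Archimedean[of "e\<^sup>2 / 4"] by auto
    have small: "\<Phi> (X n) - m < e\<^sup>2 / 4" if "n \<ge> N" for n
    proof -
      have "inverse (real (Suc n)) \<le> inverse (real (Suc N))"
        using that by (intro le_imp_inverse_le) auto
      then show ?thesis using X[of n] N by linarith
    qed
    have "dist (X p) (X q) < e" if "p \<ge> N" "q \<ge> N" for p q
    proof -
      have "(norm (X p - X q))\<^sup>2 < e\<^sup>2"
      proof (rule le_less_trans[OF close])
        show "2 * (\<Phi> (X p) - m) + 2 * (\<Phi> (X q) - m) < e\<^sup>2"
          using small[OF that(1)] small[OF that(2)] by argo
      qed
      then show ?thesis
        using \<open>e > 0\<close> unfolding dist_norm by (meson less_le_not_le power2_less_imp_less)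
    qed
    then show "\<exists>N. \<forall>p\<ge>N. \<forall>q\<ge>N. dist (X p) (X q) < e" by blast
  qed
  then obtain z where z: "X \<longlonglongrightarrow> z"
    using Cauchy_convergent_iff convergent_def by blast
  have blin: "bounded_linear f"
    by (rule bounded_linear_intro[where K = K]) (use add scaleR bound in \<open>auto simp: scaleR_conv_of_real mult.commute\<close>)
  have "(\<lambda>n. \<Phi> (X n)) \<longlonglongrightarrow> \<Phi> z"
    unfolding \<Phi>_def by (intro tendsto_intros bounded_linear.tendsto[OF blin] z)
  moreover have "(\<lambda>n. m + inverse (real (Suc n))) \<longlonglongrightarrow> m + 0"
    by (intro tendsto_intros LIMSEQ_inverse_real_of_nat)
  ultimately have "\<Phi> z \<le> m + 0"
    by (rule LIMSEQ_le) (use X less_imp_le in blast)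
  then have zmin: "\<Phi> z \<le> \<Phi> x" for x
    using m_le[of x] by simp
  have re: "Re (f y) = Re (cinner y z)" for y
  proof (rule ccontr)
    assume "Re (f y) \<noteq> Re (cinner y z)"
    define d where "d = Re (cinner y z) - Re (f y)"
    define n where "n = (norm y)\<^sup>2 + 1"
    have "n > 0" and "d \<noteq> 0"
      using \<open>Re (f y) \<noteq> Re (cinner y z)\<close> by (auto simp: n_def d_def add_nonneg_pos)
    have Re_comm: "Re (cinner z y) = Re (cinner y z)"
      by (metis cinner_commute complex_cnj cnj.simps(1))
    \<comment> \<open>The minimum point of the quadratic bound
      \<open>2 * \<epsilon> * d + \<epsilon> ^ 2 * n\<close>; the summand 1 in \<open>n\<close>
      covers \<open>y = 0\<close>.\<close>
    define \<epsilon> where "\<epsilon> = - d / n"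
    have "\<Phi> (z + \<epsilon> *\<^sub>R y) = \<Phi> z + 2 * \<epsilon> * d + \<epsilon>\<^sup>2 * (norm y)\<^sup>2"
      unfolding \<Phi>_def norm_add_sq scaleR add cinner_scaleR_right norm_scaleR power_mult_distrib d_def
      by (simp add: algebra_simps Re_comm)
    then have "0 \<le> 2 * \<epsilon> * d + \<epsilon>\<^sup>2 * (norm y)\<^sup>2"
      using zmin[of "z + \<epsilon> *\<^sub>R y"] by simp
    also have "\<epsilon>\<^sup>2 * (norm y)\<^sup>2 \<le> \<epsilon>\<^sup>2 * n"
      by (intro mult_left_mono) (auto simp: n_def)
    also have "2 * \<epsilon> * d + \<epsilon>\<^sup>2 * n = - d\<^sup>2 / n"
      using \<open>n > 0\<close> by (simp add: \<epsilon>_def field_simps power2_eq_square)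
    finally show False using \<open>n > 0\<close> \<open>d \<noteq> 0\<close> by (simp add: divide_less_0_iff field_simps)
  qed
  have "f x = cinner x z" for x
  proof (rule complex_eqI)
    show "Re (f x) = Re (cinner x z)" by (rule re)
    show "Im (f x) = Im (cinner x z)"
      using re[of "(- \<i>) *\<^sub>C x"] unfolding scale cinner_scaleC_left by simp
  qed
  then show ?thesis by blast
qed

section \<open>Complex-linear operators and their adjoints\<close>

lemma cop_eqI: "(\<And>x. cop_apply S x = cop_apply T x) \<Longrightarrow> S = T"
  by (transfer, rule blinfun_eqI) auto

lemma cop_apply_add [simp]: "cop_apply (S + T) x = cop_apply S x + cop_apply T x"
  by transfer (simp add: blinfun.add_left)

lemma cop_apply_mult [simp]: "cop_apply (S * T) x = cop_apply S (cop_apply T x)"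
  by transfer simp

lemma cop_apply_one [simp]: "cop_apply 1 x = x"
  by transfer simp

lemma cop_apply_zero [simp]: "cop_apply 0 x = 0"
  by transfer simp

lemma cop_apply_scaleC [simp]: "cop_apply (c *\<^sub>C T) x = c *\<^sub>C cop_apply T x"
  by transfer (simp add: bounded_linear_Blinfun_apply[OF bounded_linear_scaleC])

lemma cop_apply_right_add: "cop_apply T (x + y) = cop_apply T x + cop_apply T y"
  by transfer (simp add: blinfun.add_right)

lemma cop_apply_right_scaleC: "cop_apply T (c *\<^sub>C x) = c *\<^sub>C cop_apply T x"
  by transfer simp

lemma norm_cop_apply: "norm (cop_apply T x) \<le> norm T * norm x"
  by transfer (rule norm_blinfun)

lemma cinner_eqI:
  assumes "\<And>y. cinner u y = cinner (v::'a::complex_hilbert_space) y"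
  shows "u = v"
proof -
  have "cinner (u - v) (u - v) = 0" by (simp add: cinner_diff_left assms)
  then show ?thesis by (simp add: cinner_self)
qed

text \<open>Riesz applies to \<open>y \<mapsto> cinner (cop_apply T y) x\<close>, which is linear
  because \<open>cinner\<close> is linear in its first argument. The representing vectors depend
  linearly and boundedly on \<open>x\<close>, hence define an operator.\<close>

lemma adjoint_exists: "\<exists>S. \<forall>x y. cinner (cop_apply S x) y = cinner x (cop_apply T y)"
proof -
  have "\<exists>z. \<forall>y. cinner (cop_apply T y) x = cinner y z" for x
  proof (rule riesz_representation)
    show "cmod (cinner (cop_apply T y) x) \<le> (norm T * norm x) * norm y" for y
      using mult_right_mono[OF norm_cop_apply[of T y], of "norm x"] cmod_cinner_le[of "cop_apply T y" x]
      by (simp add: algebra_simps)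
  qed (simp_all add: cop_apply_right_add cop_apply_right_scaleC cinner_add_left cinner_scaleC_left)
  then obtain g where g: "cinner (cop_apply T y) x = cinner y (g x)" for x y by metis
  have g': "cinner (g x) y = cinner x (cop_apply T y)" for x y
    by (metis g cinner_commute)
  have gadd: "g (x + y) = g x + g y" for x y
    by (rule cinner_eqI) (simp add: g' cinner_add_left)
  have gscale: "g (c *\<^sub>C x) = c *\<^sub>C g x" for c x
    by (rule cinner_eqI) (simp add: g' cinner_scaleC_left)
  have gbound: "norm (g x) \<le> norm x * norm T" for x
  proof (cases "g x = 0")
    case False
    have "complex_of_real ((norm (g x))\<^sup>2) = cinner x (cop_apply T (g x))"
      by (simp add: g'[symmetric] cinner_self)
    then have "(norm (g x))\<^sup>2 = cmod (cinner x (cop_apply T (g x)))"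
      by (metis abs_of_nonneg norm_of_real zero_le_power2)
    also have "\<dots> \<le> norm x * (norm T * norm (g x))"
      using cmod_cinner_le[of x "cop_apply T (g x)"]
        mult_left_mono[OF norm_cop_apply[of T "g x"], of "norm x"] by simp
    finally show ?thesis using False by (simp add: power2_eq_square)
  qed simp
  have bl: "bounded_linear g"
  proof (rule bounded_linear_intro[where K = "norm T"])
    show "g (r *\<^sub>R x) = r *\<^sub>R g x" for r x
      using gscale[of "of_real r" x] by (simp add: scaleC_of_real)
  qed (simp_all add: gadd gbound)
  have "cop_apply (Abs_cop (Blinfun g)) x = g x" for x
    unfolding cop_apply.rep_eq
    by (subst Abs_cop_inverse) (simp_all add: bounded_linear_Blinfun_apply[OF bl] gscale)
  then show ?thesis using g' by metis
qed

text \<open>\<open>star\<close> is a definite description; every algebraic rule for it below is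
  obtained by exhibiting an operator and checking the adjoint relation.\<close>

lemma adjoint_unique:
  assumes "\<And>x y. cinner (cop_apply S x) y = cinner x (cop_apply T y)"
  shows "star T = S"
  unfolding star_def
proof (rule the_equality)
  show "\<forall>x y. cinner (cop_apply S x) y = cinner x (cop_apply T y)" using assms by blast
  fix S' assume "\<forall>x y. cinner (cop_apply S' x) y = cinner x (cop_apply T y)"
  then show "S' = S" using assms by (intro cop_eqI cinner_eqI) simp
qed

lemma cinner_star: "cinner (cop_apply (star T) x) y = cinner x (cop_apply T y)"
  using adjoint_exists[of T] adjoint_unique[of _ T] by metis

lemma cinner_star_right: "cinner x (cop_apply (star T) y) = cinner (cop_apply T x) y"
  by (metis cinner_star cinner_commute)

lemma star_star [simp]: "star (star T) = T"
  by (rule adjoint_unique) (simp add: cinner_star_right)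

lemma star_mult: "star (S * T) = star T * star S"
  by (rule adjoint_unique) (simp add: cinner_star)

lemma star_add: "star (S + T) = star S + star T"
  by (rule adjoint_unique) (simp add: cinner_star cinner_add_left cinner_add_right)

lemma star_one [simp]: "star 1 = 1"
  by (rule adjoint_unique) simp

lemma star_zero [simp]: "star 0 = 0"
  by (rule adjoint_unique) simp

lemma star_scaleC: "star (c *\<^sub>C T) = cnj c *\<^sub>C star T"
  by (rule adjoint_unique) (simp add: cinner_star cinner_scaleC_left cinner_scaleC_right)

lemma star_minus: "star (- T) = - star T"
  using star_scaleC[of "- 1" T] by simp

lemma star_diff: "star (S - T) = star S - star T"
  using star_add[of S "- T"] by (simp add: star_minus)

lemma star_scaleR: "star (r *\<^sub>R T) = r *\<^sub>R star T"
  using star_scaleC[of "of_real r" T] by (simp add: scaleC_of_real)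

lemma star_power: "star (T ^ n) = star T ^ n"
  by (induction n) (simp_all add: star_mult power_commutes)

lemma norm_star_le: "norm (star T) \<le> norm T"
proof -
  have "norm (cop_apply (star T) x) \<le> norm T * norm x" for x
  proof (cases "cop_apply (star T) x = 0")
    case False
    have "complex_of_real ((norm (cop_apply (star T) x))\<^sup>2) = cinner x (cop_apply T (cop_apply (star T) x))"
      by (metis cinner_self cinner_star)
    then have "(norm (cop_apply (star T) x))\<^sup>2 = cmod (cinner x (cop_apply T (cop_apply (star T) x)))"
      by (metis abs_of_nonneg norm_of_real zero_le_power2)
    also have "\<dots> \<le> norm x * (norm T * norm (cop_apply (star T) x))"
      using cmod_cinner_le[of x "cop_apply T (cop_apply (star T) x)"]
        mult_left_mono[OF norm_cop_apply[of T "cop_apply (star T) x"], of "norm x"] by simp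
    finally show ?thesis using False by (simp add: power2_eq_square mult.commute)
  qed simp
  then show ?thesis
    unfolding cop_apply.rep_eq norm_cop.rep_eq by (intro norm_blinfun_bound) auto
qed

lemma scaleC_mult_left [simp]: "(c *\<^sub>C S) * T = c *\<^sub>C (S * (T::'h::complex_hilbert_space cop))"
  by (rule cop_eqI) simp

lemma scaleC_mult_right [simp]: "S * (c *\<^sub>C T) = c *\<^sub>C (S * (T::'h::complex_hilbert_space cop))"
  by (rule cop_eqI) (simp add: cop_apply_right_scaleC)

text \<open>Complex linearity survives norm limits of real-linear operators. Completeness is what
  the fixed-point argument in \<open>sqrt_one_minus\<close> rests on.\<close>

instance cop :: (complex_hilbert_space) banach
proof
  fix X :: "nat \<Rightarrow> 'a cop"
  assume "Cauchy X"
  have dist_Rep: "dist S T = dist (Rep_cop S) (Rep_cop T)" for S T :: "'a cop"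
    unfolding dist_norm minus_cop_def norm_cop.rep_eq plus_cop.rep_eq uminus_cop.rep_eq by simp
  have "Cauchy (\<lambda>n. Rep_cop (X n))"
    using \<open>Cauchy X\<close> unfolding Cauchy_def dist_Rep .
  then obtain L where L: "(\<lambda>n. Rep_cop (X n)) \<longlonglongrightarrow> L"
    using Cauchy_convergent_iff convergent_def by blast
  have "blinfun_apply L (c *\<^sub>C x) = c *\<^sub>C blinfun_apply L x" for c x
  proof (rule LIMSEQ_unique)
    show "(\<lambda>n. blinfun_apply (Rep_cop (X n)) (c *\<^sub>C x)) \<longlonglongrightarrow> blinfun_apply L (c *\<^sub>C x)"
      by (intro tendsto_intros L)
    have "(\<lambda>n. c *\<^sub>C blinfun_apply (Rep_cop (X n)) x) \<longlonglongrightarrow> c *\<^sub>C blinfun_apply L x"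
      by (intro bounded_linear.tendsto[OF bounded_linear_scaleC] tendsto_intros L)
    moreover have "blinfun_apply (Rep_cop (X n)) (c *\<^sub>C x) = c *\<^sub>C blinfun_apply (Rep_cop (X n)) x" for n
      using Rep_cop[of "X n"] by simp
    ultimately show "(\<lambda>n. blinfun_apply (Rep_cop (X n)) (c *\<^sub>C x)) \<longlonglongrightarrow> c *\<^sub>C blinfun_apply L x"
      by simp
  qed
  then have "Rep_cop (Abs_cop L) = L"
    by (intro Abs_cop_inverse) simp
  then have "X \<longlonglongrightarrow> Abs_cop L"
    using L unfolding tendsto_iff dist_Rep by simp
  then show "convergent X" unfolding convergent_def by blast
qed

section \<open>Commutants\<close>

lemma
  shows commutant_one: "1 \<in> commutant S"
    and commutant_add: "A \<in> commutant S \<Longrightarrow> B \<in> commutant S \<Longrightarrow> A + B \<in> commutant S"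
    and commutant_mult: "A \<in> commutant S \<Longrightarrow> B \<in> commutant S \<Longrightarrow> A * B \<in> commutant S"
    and commutant_scaleC: "A \<in> commutant S \<Longrightarrow> c *\<^sub>C A \<in> commutant S"
  unfolding commutant_def by (auto simp: distrib_left distrib_right) (metis mult.assoc)+

lemma commutant_star:
  assumes "star ` S \<subseteq> S" "A \<in> commutant S"
  shows "star A \<in> commutant S"
  unfolding commutant_def
proof (safe)
  fix B assume "B \<in> S"
  then have "A * star B = star B * A"
    using assms unfolding commutant_def by blast
  then have "star (A * star B) = star (star B * A)" by simp
  then show "star A * B = B * star A" by (simp add: star_mult)
qed

lemma commutant_antimono: "S \<subseteq> T \<Longrightarrow> commutant T \<subseteq> commutant S"
  unfolding commutant_def by auto

lemma commutant_commutant_superset: "S \<subseteq> commutant (commutant S)"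
  unfolding commutant_def by auto

lemma closed_commutant: "closed (commutant S)"
proof -
  have "commutant S = (\<Inter>A\<in>S. {T. T * A = A * T})" unfolding commutant_def by auto
  moreover have "closed {T. T * A = A * T}" for A :: "'a cop"
    by (intro closed_Collect_eq continuous_intros)
  ultimately show ?thesis by auto
qed

section \<open>Tracial states\<close>

lemma bounded_linear_star: "bounded_linear star"
proof (rule bounded_linear_intro[where K = 1])
qed (simp_all add: star_add star_scaleR norm_star_le)

text \<open>An isometry; the bound is only an inequality because the Hilbert space may be
  zero.\<close>

lemma norm_le_one_unitary:
  assumes "star U * U = 1"
  shows "norm U \<le> 1"
proof -
  have "norm (cop_apply U x) \<le> 1 * norm x" for x
  proof -
    have "complex_of_real ((norm (cop_apply U x))\<^sup>2) = cinner (cop_apply (star U * U) x) x"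
      by (simp add: cinner_star cinner_self)
    also have "\<dots> = of_real ((norm x)\<^sup>2)"
      by (simp add: assms cinner_self)
    finally have "(norm (cop_apply U x))\<^sup>2 = (norm x)\<^sup>2"
      using of_real_eq_iff by blast
    then show ?thesis by simp
  qed
  then show ?thesis
    unfolding cop_apply.rep_eq norm_cop.rep_eq by (intro norm_blinfun_bound) auto
qed

lemma norm_le_one_projection:
  assumes "star P = P" "P * P = P"
  shows "norm P \<le> 1"
proof -
  have "norm (cop_apply P x) \<le> 1 * norm x" for x
  proof (cases "cop_apply P x = 0")
    case False
    have "complex_of_real ((norm (cop_apply P x))\<^sup>2) = cinner (cop_apply (star P * P) x) x"
      by (simp add: cinner_star cinner_self)
    also have "\<dots> = cinner (cop_apply P x) x"
      by (simp add: assms)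
    finally have "(norm (cop_apply P x))\<^sup>2 = cmod (cinner (cop_apply P x) x)"
      by (metis abs_of_nonneg norm_of_real zero_le_power2)
    also have "\<dots> \<le> norm (cop_apply P x) * norm x"
      by (rule cmod_cinner_le)
    finally show ?thesis using False by (simp add: power2_eq_square)
  qed simp
  then show ?thesis
    unfolding cop_apply.rep_eq norm_cop.rep_eq by (intro norm_blinfun_bound) auto
qed

section \<open>The algebra, its trace and the L2 seminorm\<close>

locale nc_space =
  fixes M :: "'h::complex_hilbert_space cop set" and \<tau> :: "'h cop \<Rightarrow> complex"
  assumes nc: "nc_probability_space M \<tau>"
begin

lemma M_bicommutant: "commutant (commutant M) = M"
  using nc unfolding nc_probability_space_def von_neumann_algebra_def by blast

lemma M_star [simp, intro]: "A \<in> M \<Longrightarrow> star A \<in> M"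
  using nc unfolding nc_probability_space_def von_neumann_algebra_def by blast

lemma M_one [simp, intro]: "1 \<in> M"
  and M_add [simp, intro]: "A \<in> M \<Longrightarrow> B \<in> M \<Longrightarrow> A + B \<in> M"
  and M_mult [simp, intro]: "A \<in> M \<Longrightarrow> B \<in> M \<Longrightarrow> A * B \<in> M"
  and M_scaleC [simp, intro]: "A \<in> M \<Longrightarrow> c *\<^sub>C A \<in> M"
  using commutant_one[of "commutant M"] commutant_add[of A "commutant M" B]
    commutant_mult[of A "commutant M" B] commutant_scaleC[of A "commutant M" c]
  unfolding M_bicommutant by blast+

lemma M_zero [simp, intro]: "0 \<in> M"
  using M_scaleC[OF M_one, of 0] by simp

lemma M_minus [simp, intro]: "A \<in> M \<Longrightarrow> - A \<in> M"
  using M_scaleC[of A "- 1"] by simp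

lemma M_diff [simp, intro]: "A \<in> M \<Longrightarrow> B \<in> M \<Longrightarrow> A - B \<in> M"
  using M_add[of A "- B"] by simp

lemma M_scaleR [simp, intro]: "A \<in> M \<Longrightarrow> r *\<^sub>R A \<in> M"
  using M_scaleC[of A "of_real r"] by (simp add: scaleC_of_real)

lemma M_power [simp, intro]: "A \<in> M \<Longrightarrow> A ^ n \<in> M"
  by (induction n) auto

lemma M_sum [intro]: "(\<And>i. i \<in> I \<Longrightarrow> f i \<in> M) \<Longrightarrow> sum f I \<in> M"
  by (induction I rule: infinite_finite_induct) auto

lemma M_sum_list [intro]: "(\<And>x. x \<in> set xs \<Longrightarrow> x \<in> M) \<Longrightarrow> sum_list xs \<in> M"
  by (induction xs) auto

lemma M_closed: "closed M"
  using closed_commutant[of "commutant M"] unfolding M_bicommutant .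

lemma tau_state: "faithful_tracial_state M \<tau>"
  using nc unfolding nc_probability_space_def by (rule conjunct2)

lemma tau_add [simp]: "A \<in> M \<Longrightarrow> B \<in> M \<Longrightarrow> \<tau> (A + B) = \<tau> A + \<tau> B"
  using tau_state unfolding faithful_tracial_state_def by simp

lemma tau_scaleC [simp]: "A \<in> M \<Longrightarrow> \<tau> (c *\<^sub>C A) = c * \<tau> A"
  using tau_state unfolding faithful_tracial_state_def by simp

lemma tau_one [simp]: "\<tau> 1 = 1"
  using tau_state unfolding faithful_tracial_state_def by simp

lemma tau_nonneg: "A \<in> M \<Longrightarrow> \<tau> (star A * A) \<in> \<real>\<^sub>\<ge>\<^sub>0"
  using tau_state unfolding faithful_tracial_state_def by meson

lemma tau_commute: "A \<in> M \<Longrightarrow> B \<in> M \<Longrightarrow> \<tau> (A * B) = \<tau> (B * A)"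
  using tau_state unfolding faithful_tracial_state_def by meson

lemma tau_zero [simp]: "\<tau> 0 = 0"
  using tau_scaleC[OF M_one, of 0] by simp

lemma tau_minus [simp]: "A \<in> M \<Longrightarrow> \<tau> (- A) = - \<tau> A"
  using tau_scaleC[of A "- 1"] by simp

lemma tau_diff [simp]: "A \<in> M \<Longrightarrow> B \<in> M \<Longrightarrow> \<tau> (A - B) = \<tau> A - \<tau> B"
  using tau_add[of A "- B"] by simp

lemma tau_scaleR [simp]: "A \<in> M \<Longrightarrow> \<tau> (r *\<^sub>R A) = of_real r * \<tau> A"
  using tau_scaleC[of A "of_real r"] by (simp add: scaleC_of_real)

lemma tau_sum: "(\<And>i. i \<in> I \<Longrightarrow> f i \<in> M) \<Longrightarrow> \<tau> (sum f I) = (\<Sum>i\<in>I. \<tau> (f i))"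
proof (induction I rule: infinite_finite_induct)
  case (insert x F)
  then have "\<tau> (sum f F) = (\<Sum>i\<in>F. \<tau> (f i))" "f x \<in> M" "sum f F \<in> M"
    by (auto intro!: M_sum)
  then show ?case using insert.hyps by simp
qed (simp_all only: sum.infinite sum.empty tau_zero not_False_eq_True)

lemma tau_sum_list: "(\<And>x. x \<in> set xs \<Longrightarrow> f x \<in> M) \<Longrightarrow> \<tau> (\<Sum>x\<leftarrow>xs. f x) = (\<Sum>x\<leftarrow>xs. \<tau> (f x))"
proof (induction xs)
  case (Cons x xs)
  then have "f x \<in> M" "sum_list (map f xs) \<in> M" by (auto intro!: M_sum_list)
  then show ?case using Cons by simp
qed simp

text \<open>A state is given as positive, and hermiticity is recovered by polarisation:
  \<open>\<tau> (star B * B)\<close> is real for \<open>B = A + 1\<close>, which settles the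
  imaginary parts, and for \<open>B = A + \<i> *\<^sub>C 1\<close>, which settles the real
  parts.\<close>

lemma tau_star: assumes "A \<in> M" shows "\<tau> (star A) = cnj (\<tau> A)"
proof -
  have im0: "Im (\<tau> (star B * B)) = 0" if "B \<in> M" for B
    using tau_nonneg[OF that] by (auto simp: nonneg_Reals_def)
  have "star (A + 1) * (A + 1) = star A * A + (A + star A) + 1"
    by (simp add: star_add algebra_simps)
  then have 1: "Im (\<tau> A) + Im (\<tau> (star A)) = 0"
    using im0[of "A + 1"] im0[of A] assms by simp
  have "star (A + \<i> *\<^sub>C 1) * (A + \<i> *\<^sub>C 1) = star A * A + (\<i> *\<^sub>C star A - \<i> *\<^sub>C A) + 1"
    by (simp add: star_add star_scaleC algebra_simps scaleC_scaleC scaleC_add_right scaleC_diff_right)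
  then have 2: "Re (\<tau> (star A)) - Re (\<tau> A) = 0"
    using im0[of "A + \<i> *\<^sub>C 1"] im0[of A] assms by simp
  show ?thesis using 1 2 by (simp add: complex_eq_iff)
qed

abbreviation l2 :: "'h cop \<Rightarrow> real" where "l2 \<equiv> l2_norm \<tau>"

lemma l2_nonneg [simp]: "A \<in> M \<Longrightarrow> 0 \<le> l2 A"
  using tau_nonneg[of A] unfolding l2_norm_def by (auto simp: nonneg_Reals_def)

lemma l2_sq: assumes "A \<in> M" shows "(l2 A)\<^sup>2 = Re (\<tau> (star A * A))"
  using tau_nonneg[OF assms] unfolding l2_norm_def by (auto simp: nonneg_Reals_def)

lemma tau_star_mult_self: assumes "A \<in> M" shows "\<tau> (star A * A) = of_real ((l2 A)\<^sup>2)"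
  using tau_nonneg[OF assms] unfolding l2_sq[OF assms] by (auto simp: nonneg_Reals_def)

lemma l2_add_sq:
  assumes "A \<in> M" "B \<in> M"
  shows "(l2 (A + B))\<^sup>2 = (l2 A)\<^sup>2 + 2 * Re (\<tau> (star A * B)) + (l2 B)\<^sup>2"
proof -
  have "\<tau> (star B * A) = cnj (\<tau> (star A * B))"
    using tau_star[of "star A * B"] assms by (simp add: star_mult)
  moreover have "star (A + B) * (A + B) = star A * A + (star A * B + star B * A) + star B * B"
    by (simp add: star_add algebra_simps)
  ultimately show ?thesis using assms by (simp add: l2_sq)
qed

lemma l2_scaleC: assumes "A \<in> M" shows "l2 (c *\<^sub>C A) = cmod c * l2 A"
proof (rule power2_eq_imp_eq)
  have "star (c *\<^sub>C A) * (c *\<^sub>C A) = (cnj c * c) *\<^sub>C (star A * A)"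
    by (simp add: star_scaleC scaleC_scaleC mult.commute)
  also have "cnj c * c = of_real ((cmod c)\<^sup>2)"
    using complex_norm_square[of c] by (simp add: mult.commute)
  finally show "(l2 (c *\<^sub>C A))\<^sup>2 = (cmod c * l2 A)\<^sup>2"
    using assms by (simp add: l2_sq power_mult_distrib flip: of_real_power)
qed (use assms in auto)

lemma l2_zero [simp]: "l2 0 = 0"
  by (simp add: l2_norm_def)

lemma l2_minus [simp]: "A \<in> M \<Longrightarrow> l2 (- A) = l2 A"
  using l2_scaleC[of A "- 1"] by simp

lemma l2_one [simp]: "l2 1 = 1"
  by (simp add: l2_norm_def)

lemma l2_star: assumes "A \<in> M" shows "l2 (star A) = l2 A"
  by (rule power2_eq_imp_eq) (use assms tau_commute[of A "star A"] in \<open>auto simp: l2_sq\<close>)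

text \<open>Cauchy-Schwarz. Positivity at \<open>A - s a B\<close>, with \<open>a\<close> the trace
  of \<open>star B * A\<close> and \<open>s\<close> real, is the inequality \<open>key\<close>; it
  remains to choose \<open>s\<close>, the best choice being \<open>1 / (l2 B) ^ 2\<close>.\<close>

lemma cmod_tau_star_mult: 
  assumes A: "A \<in> M" and B: "B \<in> M" shows "cmod (\<tau> (star A * B)) \<le> l2 A * l2 B"
proof (rule power2_le_imp_le)
  define a where "a = \<tau> (star B * A)"
  have a: "cmod a = cmod (\<tau> (star A * B))"
    using tau_star[of "star A * B"] assms by (simp add: star_mult a_def)
  have key: "(cmod a)\<^sup>2 * s * (2 - s * (l2 B)\<^sup>2) \<le> (l2 A)\<^sup>2" for s :: real
  proof -
    have "\<tau> (star A * (- (of_real s * a)) *\<^sub>C B) = - (of_real s * (a * \<tau> (star A * B)))"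
      using assms by simp
    also have "\<tau> (star A * B) = cnj a"
      using tau_star[of "star A * B"] assms by (simp add: star_mult a_def)
    also have "a * cnj a = of_real ((cmod a)\<^sup>2)"
      using complex_norm_square[of a] by simp
    finally have "Re (\<tau> (star A * (- (of_real s * a)) *\<^sub>C B)) = - (s * (cmod a)\<^sup>2)" by simp
    moreover have "0 \<le> (l2 (A + (- (of_real s * a)) *\<^sub>C B))\<^sup>2" by simp
    ultimately have "0 \<le> (l2 A)\<^sup>2 - 2 * (s * (cmod a)\<^sup>2) + (s * cmod a * l2 B)\<^sup>2"
      using l2_add_sq[of A "(- (of_real s * a)) *\<^sub>C B"] l2_scaleC[of B "- (of_real s * a)"] assms
      by (simp add: norm_mult power_mult_distrib del: scaleC_minus_left)
    then show ?thesis by (simp add: algebra_simps power2_eq_square)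
  qed
  show "(cmod (\<tau> (star A * B)))\<^sup>2 \<le> (l2 A * l2 B)\<^sup>2"
  proof (cases "l2 B = 0")
    case True
    \<comment> \<open>For \<open>l2 B = 0\<close> the inequality \<open>key\<close> is linear in
      \<open>s\<close>, and the \<open>s\<close> chosen here would make its left side
      \<open>(l2 A) ^ 2 + 1\<close>.\<close>
    have "a = 0"
    proof (rule ccontr)
      assume "a \<noteq> 0"
      then have "(l2 A)\<^sup>2 + 1 \<le> (l2 A)\<^sup>2"
        using key[of "((l2 A)\<^sup>2 + 1) / (2 * (cmod a)\<^sup>2)"] True by (simp add: field_simps)
      then show False by simp
    qed
    then show ?thesis using a by simp
  next
    case False
    then have "(cmod a)\<^sup>2 / (l2 B)\<^sup>2 \<le> (l2 A)\<^sup>2"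
      using key[of "1 / (l2 B)\<^sup>2"] by (simp add: field_simps)
    then have "(cmod a)\<^sup>2 \<le> (l2 A)\<^sup>2 * (l2 B)\<^sup>2"
      using False by (simp add: divide_le_eq)
    then show ?thesis using a by (simp add: power_mult_distrib)
  qed
qed (use assms in simp)

lemma cmod_tau_mult_le: "A \<in> M \<Longrightarrow> B \<in> M \<Longrightarrow> cmod (\<tau> (A * B)) \<le> l2 A * l2 B"
  using cmod_tau_star_mult[of "star A" B] by (simp add: l2_star)

lemma cmod_tau_le: "A \<in> M \<Longrightarrow> cmod (\<tau> A) \<le> l2 A"
  using cmod_tau_mult_le[of A 1] by simp

lemma l2_triangle: assumes "A \<in> M" "B \<in> M" shows "l2 (A + B) \<le> l2 A + l2 B"
proof (rule power2_le_imp_le)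
  have "Re (\<tau> (star A * B)) \<le> l2 A * l2 B"
    using complex_Re_le_cmod cmod_tau_star_mult[OF assms] by (rule order_trans)
  then show "(l2 (A + B))\<^sup>2 \<le> (l2 A + l2 B)\<^sup>2"
    unfolding l2_add_sq[OF assms] by (simp add: power2_sum)
qed (use assms in simp)

lemma l2_triangle_diff: "A \<in> M \<Longrightarrow> B \<in> M \<Longrightarrow> l2 (A - B) \<le> l2 A + l2 B"
  using l2_triangle[of A "- B"] by simp

lemma l2_minus_commute: "A \<in> M \<Longrightarrow> B \<in> M \<Longrightarrow> l2 (A - B) = l2 (B - A)"
  using l2_minus[of "A - B"] by simp

lemma l2_diff_triangle: 
  assumes "A \<in> M" "B \<in> M" "C \<in> M" shows "l2 (A - C) \<le> l2 (A - B) + l2 (B - C)"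
  using l2_triangle[of "A - B" "B - C"] assms by simp

lemma l2_add_sq_le: 
  assumes "A \<in> M" "B \<in> M" shows "(l2 (A + B))\<^sup>2 \<le> 2 * (l2 A)\<^sup>2 + 2 * (l2 B)\<^sup>2"
proof -
  have "(l2 (A + B))\<^sup>2 \<le> (l2 A + l2 B)\<^sup>2"
    using l2_triangle[OF assms] assms by (intro power_mono) auto
  also have "\<dots> \<le> 2 * (l2 A)\<^sup>2 + 2 * (l2 B)\<^sup>2"
    using zero_le_power2[of "l2 A - l2 B"] by (simp add: power2_diff power2_sum)
  finally show ?thesis .
qed

text \<open>A fixed point \<open>Z\<close> of \<open>Z \<mapsto> (A + Z\<^sup>2)/2\<close> satisfies \<open>(1 - Z)\<^sup>2 = 1 - A\<close>.\<close>

lemma sqrt_one_minus: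
  assumes "A \<in> M" "star A = A" "norm A < 1"
  shows "\<exists>C\<in>M. star C = C \<and> C * C = 1 - A"
proof -
  \<comment> \<open>The smaller root of \<open>r ^ 2 - 2 * r + norm A = 0\<close>: the map then
    sends the ball of radius \<open>r\<close> into itself, and \<open>r < 1\<close> is also its
    contraction constant there.\<close>
  define r where "r = 1 - sqrt (1 - norm A)"
  have r: "0 \<le> r" "r < 1" and Ar: "norm A + r * r = 2 * r"
    using assms(3) unfolding r_def by (auto simp: algebra_simps)
  define S where "S = {Z \<in> M. star Z = Z \<and> norm Z \<le> r}"
  define f where "f Z = (1/2) *\<^sub>R (A + Z * Z)" for Z
  have "closed S"
  proof -
    have "continuous_on UNIV star"
      using bounded_linear.continuous_on[OF bounded_linear_star continuous_on_id] by simp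
    then have "closed (M \<inter> ({Z. star Z = Z} \<inter> {Z. norm Z \<le> r}))"
      by (intro closed_Int M_closed closed_Collect_eq closed_Collect_le continuous_intros)
    then show ?thesis unfolding S_def by (simp add: Int_def)
  qed
  then have "complete S" by (simp add: complete_eq_closed)
  moreover have "0 \<in> S" using r by (simp add: S_def)
  moreover have "f Z \<in> S" if "Z \<in> S" for Z
  proof -
    have "star (f Z) = f Z"
      using that assms by (simp add: f_def S_def star_scaleR star_add star_mult)
    moreover have "norm (f Z) \<le> r"
    proof -
      have "norm (A + Z * Z) \<le> norm A + norm Z * norm Z"
        using norm_triangle_ineq[of A "Z * Z"] norm_mult_ineq[of Z Z] by linarith
      also have "\<dots> \<le> norm A + r * r"
        using that r by (intro add_left_mono mult_mono) (auto simp: S_def)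
      finally show ?thesis by (simp add: f_def Ar)
    qed
    ultimately show ?thesis using that assms by (simp add: S_def f_def)
  qed
  moreover have "dist (f Z) (f W) \<le> r * dist Z W" if "Z \<in> S" "W \<in> S" for Z W
  proof -
    have diff: "f Z - f W = (1/2) *\<^sub>R (Z * (Z - W) + (Z - W) * W)"
      by (simp add: f_def algebra_simps flip: scaleR_diff_right)
    have "norm (Z * (Z - W) + (Z - W) * W) \<le> norm (Z * (Z - W)) + norm ((Z - W) * W)"
      by (rule norm_triangle_ineq)
    also have "\<dots> \<le> norm Z * norm (Z - W) + norm (Z - W) * norm W"
      by (intro add_mono norm_mult_ineq)
    also have "\<dots> \<le> r * norm (Z - W) + norm (Z - W) * r"
      using that r by (intro add_mono mult_mono) (auto simp: S_def)
    finally have "norm (Z * (Z - W) + (Z - W) * W) \<le> 2 * (r * norm (Z - W))"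
      by (simp add: mult.commute)
    then show ?thesis
      by (simp add: dist_norm diff)
  qed
  ultimately have "\<exists>!Z\<in>S. f Z = Z"
    using r by (intro Banach_fix[of S r f]) auto
  then obtain Z where Z: "Z \<in> S" "f Z = Z" by blast
  then have "2 *\<^sub>R Z = 2 *\<^sub>R f Z" by simp
  then have "A + Z * Z = Z + Z" by (simp add: f_def scaleR_2)
  then have "(1 - Z) * (1 - Z) = 1 - A"
    by (simp add: algebra_simps)
  then show ?thesis using Z(1) by (intro bexI[of _ "1 - Z"]) (auto simp: S_def star_diff)
qed

text \<open>For \<open>c > norm A\<close> the operator \<open>1 - star A * A / c ^ 2\<close> is a
  square \<open>C * C\<close> of a self-adjoint element of \<open>M\<close>, so tracing it between
  \<open>star B\<close> and \<open>B\<close> gives \<open>(l2 (C * B)) ^ 2\<close>, which is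
  nonnegative. The strict inequality is what \<open>sqrt_one_minus\<close> asks for; finally
  \<open>c\<close> tends to \<open>norm A\<close>.\<close>

lemma l2_mult_le: assumes A: "A \<in> M" and B: "B \<in> M" shows "l2 (A * B) \<le> norm A * l2 B"
proof (rule field_le_epsilon)
  have le: "l2 (A * B) \<le> c * l2 B" if "norm A < c" for c
  proof (rule power2_le_imp_le)
    have c: "c > 0" using norm_ge_zero[of A] that by (rule le_less_trans)
    define A' where "A' = (1 / c\<^sup>2) *\<^sub>R (star A * A)"
    have "norm (star A * A) \<le> norm A * norm A"
      using norm_mult_ineq[of "star A" A] mult_right_mono[OF norm_star_le[of A], of "norm A"] by simp
    also have "\<dots> < c * c" using that by (intro mult_strict_mono) (use c in auto)
    finally have "norm A' < 1"
      using c by (simp add: A'_def power2_eq_square)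
    moreover have "star A' = A'"
      by (simp add: A'_def star_scaleR star_mult)
    moreover have "A' \<in> M" using A by (simp add: A'_def)
    ultimately obtain C where C: "C \<in> M" "star C = C" "C * C = 1 - A'"
      using sqrt_one_minus by blast
    have "star (C * B) * (C * B) = star B * (C * C) * B"
      by (simp add: star_mult C(2) mult.assoc)
    also have "\<dots> = star B * B - (1 / c\<^sup>2) *\<^sub>R (star (A * B) * (A * B))"
      by (simp add: C A'_def algebra_simps star_mult)
    finally have "(l2 (C * B))\<^sup>2 = (l2 B)\<^sup>2 - (1 / c\<^sup>2) * (l2 (A * B))\<^sup>2"
      using A B C by (simp add: l2_sq)
    then have "(1 / c\<^sup>2) * (l2 (A * B))\<^sup>2 \<le> (l2 B)\<^sup>2"
      using zero_le_power2[of "l2 (C * B)"] by linarith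
    then show "(l2 (A * B))\<^sup>2 \<le> (c * l2 B)\<^sup>2"
      using c by (simp add: field_simps)
    show "0 \<le> c * l2 B" using c B by simp
  qed
  fix e :: real assume "e > 0"
  \<comment> \<open>The excess over \<open>norm A\<close> costs at most \<open>e\<close> after
    multiplication by \<open>l2 B\<close>; the summand 1 avoids division by zero.\<close>
  have "l2 (A * B) \<le> (norm A + e / (l2 B + 1)) * l2 B"
    using \<open>e > 0\<close> B by (intro le) (simp add: add_nonneg_pos)
  also have "\<dots> \<le> norm A * l2 B + e"
    using \<open>e > 0\<close> l2_nonneg[OF B] by (simp add: algebra_simps divide_le_eq)
  finally show "l2 (A * B) \<le> norm A * l2 B + e" .
qed

lemma l2_mult_le_right: assumes "A \<in> M" "B \<in> M" shows "l2 (A * B) \<le> l2 A * norm B"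
proof -
  have "l2 (A * B) = l2 (star B * star A)"
    using assms l2_star[of "A * B"] by (simp add: star_mult)
  also have "\<dots> \<le> norm (star B) * l2 (star A)"
    using assms by (intro l2_mult_le) auto
  also have "\<dots> \<le> norm B * l2 A"
    using assms norm_star_le[of B] by (auto simp: l2_star intro: mult_right_mono)
  finally show ?thesis by (simp add: mult.commute)
qed

lemma l2_le_norm: "A \<in> M \<Longrightarrow> l2 A \<le> norm A"
  using l2_mult_le[of A 1] by simp

lemma cmod_tau_le_norm: "A \<in> M \<Longrightarrow> cmod (\<tau> A) \<le> norm A"
  using cmod_tau_le l2_le_norm order_trans by blast

lemma l2_contraction_left: "A \<in> M \<Longrightarrow> B \<in> M \<Longrightarrow> norm A \<le> 1 \<Longrightarrow> l2 (A * B) \<le> l2 B"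
  using l2_mult_le[of A B] mult_right_mono[of "norm A" 1 "l2 B"] by simp

lemma l2_contraction_right: "A \<in> M \<Longrightarrow> B \<in> M \<Longrightarrow> norm B \<le> 1 \<Longrightarrow> l2 (A * B) \<le> l2 A"
  using l2_mult_le_right[of A B] mult_left_mono[of "norm B" 1 "l2 A"] by simp

end

lemma norm_mult_le_one: "norm A \<le> 1 \<Longrightarrow> norm B \<le> 1 \<Longrightarrow> norm (A * B) \<le> 1"
  for A :: "'a::real_normed_algebra"
  using norm_mult_ineq[of A B] mult_mono[of "norm A" 1 "norm B" 1] by simp

lemma norm_one_le_cop: "norm (1 :: 'h::complex_hilbert_space cop) \<le> 1"
  by (rule norm_le_one_unitary) simp

lemma norm_power_le_one: "norm A \<le> 1 \<Longrightarrow> norm (A ^ n) \<le> 1" for A :: "'h::complex_hilbert_space cop"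
  by (induction n) (simp_all add: norm_one_le_cop norm_mult_le_one)

section \<open>Freeness and free Brownian motion\<close>

lemma star_algebra_minus: "A \<in> star_algebra S \<Longrightarrow> - A \<in> star_algebra S"
  using star_algebra.scale[of A S "- 1"] by simp

lemma star_algebra_diff: "A \<in> star_algebra S \<Longrightarrow> B \<in> star_algebra S \<Longrightarrow> A - B \<in> star_algebra S"
  using star_algebra.add[of A S "- B"] star_algebra_minus[of B S] by simp

lemma star_algebra_zero: "0 \<in> star_algebra S"
  using star_algebra.scale[OF star_algebra.one, of 0] by simp

context nc_space
begin

lemma star_algebra_subset_M: "S \<subseteq> M \<Longrightarrow> A \<in> star_algebra S \<Longrightarrow> A \<in> M"
  by (rotate_tac, induction rule: star_algebra.induct) auto

definition center :: "'h cop \<Rightarrow> 'h cop" where "center A = A - \<tau> A *\<^sub>C 1"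

lemma center_in_M [simp]: "A \<in> M \<Longrightarrow> center A \<in> M"
  by (simp add: center_def)

lemma tau_center [simp]: "A \<in> M \<Longrightarrow> \<tau> (center A) = 0"
  by (simp add: center_def)

lemma center_in_star_algebra: "A \<in> star_algebra S \<Longrightarrow> center A \<in> star_algebra S"
  unfolding center_def by (intro star_algebra_diff star_algebra.scale star_algebra.one)

lemma star_free_word:
  assumes "star_free \<tau> S T" "w \<noteq> []" "distinct_adj (map fst w)"
    and "\<And>b A. (b, A) \<in> set w \<Longrightarrow> A \<in> star_algebra (if b then S else T) \<and> \<tau> A = 0"
  shows "\<tau> (prod_list (map snd w)) = 0"
proof -
  have "\<forall>(b, A)\<in>set w. A \<in> (if b then star_algebra S else star_algebra T) \<and> \<tau> A = 0"
    using assms(4) by fastforce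
  then show ?thesis
    using assms(1-3) unfolding star_free_def free_algebras_def by blast
qed

lemma tau_free_mult:
  assumes free: "star_free \<tau> S T" and sub: "S \<subseteq> M" "T \<subseteq> M"
    and A: "A \<in> star_algebra S" and B: "B \<in> star_algebra T"
  shows "\<tau> (A * B) = \<tau> A * \<tau> B"
proof -
  note [simp] = star_algebra_subset_M[OF sub(1) A] star_algebra_subset_M[OF sub(2) B]
  have "\<tau> (center A * center B) = 0"
    using star_free_word[OF free, of "[(True, center A), (False, center B)]"]
      center_in_star_algebra[OF A] center_in_star_algebra[OF B] by fastforce
  then show ?thesis
    by (simp add: center_def algebra_simps)
qed

text \<open>The word \<open>center A\<close>, \<open>x\<close>, \<open>center B\<close>,
  \<open>x\<close> is alternating and centred, so its trace vanishes; undoing first the centring of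
  \<open>B\<close> and then that of \<open>A\<close> leaves factors that
  \<open>tau_free_mult\<close> splits. With \<open>x\<close> a Brownian increment this is the source
  of the Ito correction.\<close>

lemma tau_free_mult4:
  assumes free: "star_free \<tau> S T" and sub: "S \<subseteq> M" "T \<subseteq> M"
    and x: "x \<in> star_algebra S" "\<tau> x = 0"
    and A: "A \<in> star_algebra T" and B: "B \<in> star_algebra T"
  shows "\<tau> (A * x * B * x) = \<tau> A * \<tau> B * \<tau> (x * x)"
proof -
  note M [simp] = star_algebra_subset_M[OF sub(1) x(1)] star_algebra_subset_M[OF sub(2) A]
    star_algebra_subset_M[OF sub(2) B]
  have xx: "x * x \<in> star_algebra S" using x by (intro star_algebra.mult)
  have "\<tau> (center A * x * center B * x) = 0"
    using star_free_word[OF free, of "[(False, center A), (True, x), (False, center B), (True, x)]"]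
      center_in_star_algebra[OF A] center_in_star_algebra[OF B] x by (fastforce simp: mult.assoc)
  then have 1: "\<tau> (center A * x * B * x) = \<tau> B * \<tau> (center A * (x * x))"
    by (simp add: center_def[of B] algebra_simps)
  also have "\<tau> (center A * (x * x)) = \<tau> ((x * x) * center A)"
    by (rule tau_commute) auto
  also have "\<dots> = 0"
    using tau_free_mult[OF free sub xx center_in_star_algebra[OF A]] by simp
  finally have 2: "\<tau> (A * x * B * x) = \<tau> A * \<tau> (x * B * x)"
    by (simp add: center_def algebra_simps)
  have "\<tau> (x * B * x) = \<tau> (x * x * B)"
    using tau_commute[of "x * B" x] by (simp add: mult.assoc)
  then show ?thesis
    using 2 tau_free_mult[OF free sub xx B] by (simp add: mult.assoc mult.commute)
qed

end

section \<open>Low moments of the semicircle law\<close>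

context
  fixes v :: real
  assumes v: "v > 0"
begin

private definition "g x = sqrt (4 * v - x\<^sup>2)"

private lemma g_sq: "\<bar>x\<bar> \<le> 2 * sqrt v \<Longrightarrow> (g x)\<^sup>2 = 4 * v - x\<^sup>2"
proof -
  assume "\<bar>x\<bar> \<le> 2 * sqrt v"
  then have "x\<^sup>2 \<le> (2 * sqrt v)\<^sup>2" by (rule abs_le_square_iff[THEN iffD1, OF order_trans]) auto
  then show ?thesis using v by (simp add: g_def power_mult_distrib)
qed

private lemma g_pos: "\<bar>x\<bar> < 2 * sqrt v \<Longrightarrow> 0 < g x"
proof -
  assume "\<bar>x\<bar> < 2 * sqrt v"
  then have "x\<^sup>2 < (2 * sqrt v)\<^sup>2" by (intro power2_strict_mono[of "\<bar>x\<bar>", simplified]) auto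
  then show ?thesis using v by (simp add: g_def power_mult_distrib)
qed

private lemma g_end: "g (2 * sqrt v) = 0" "g (- (2 * sqrt v)) = 0"
  using v by (simp_all add: g_def power_mult_distrib)

private lemma g_deriv:
  assumes "\<bar>x\<bar> < 2 * sqrt v"
  shows "(g has_real_derivative - x / g x) (at x)"
proof -
  have "4 * v - x\<^sup>2 > 0" using g_pos[OF assms] by (simp add: g_def)
  then show ?thesis unfolding g_def
    by (auto intro!: derivative_eq_intros simp: field_simps)
qed

private lemma g_cont: "continuous_on S g"
  unfolding g_def by (intro continuous_intros)

text \<open>\<open>- (g x ^ 3 / 3)\<close> is an antiderivative vanishing at both end points. As
  \<open>g\<close> is not differentiable there, the form of the fundamental theorem with derivatives
  in the interior is used.\<close>

lemma semicircle_first_moment: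
  "((\<lambda>x. x * sqrt (4 * v - x\<^sup>2)) has_integral 0) {- 2 * sqrt v..2 * sqrt v}"
proof -
  have "((\<lambda>x. x * g x) has_integral (- (g (2 * sqrt v) ^ 3 / 3) - (- (g (- 2 * sqrt v) ^ 3 / 3))))
    {- 2 * sqrt v..2 * sqrt v}"
  proof (rule fundamental_theorem_of_calculus_interior)
    show "continuous_on {- 2 * sqrt v..2 * sqrt v} (\<lambda>x. - (g x ^ 3 / 3))"
      by (intro continuous_intros g_cont) auto
    fix x assume "x \<in> {- 2 * sqrt v<..<2 * sqrt v}"
    then have x: "\<bar>x\<bar> < 2 * sqrt v" by auto
    have "((\<lambda>x. - (g x ^ 3 / 3)) has_real_derivative x * g x) (at x)"
      using g_pos[OF x] by (auto intro!: derivative_eq_intros g_deriv[OF x] simp: power2_eq_square)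
    then show "((\<lambda>x. - (g x ^ 3 / 3)) has_vector_derivative x * g x) (at x)"
      by (simp add: has_real_derivative_iff_has_vector_derivative)
  qed (use v in auto)
  then show ?thesis using g_end by (simp add: g_def)
qed

text \<open>\<open>x (4v - x\<^sup>2)\<^sup>3\<^sup>/\<^sup>2\<close> has derivative \<open>4 (v - x\<^sup>2) (4v - x\<^sup>2)\<^sup>1\<^sup>/\<^sup>2\<close> and vanishes at both end points.\<close>

lemma semicircle_second_moment:
  "((\<lambda>x. (v - x\<^sup>2) * sqrt (4 * v - x\<^sup>2)) has_integral 0) {- 2 * sqrt v..2 * sqrt v}"
proof -
  have "((\<lambda>x. (v - x\<^sup>2) * g x) has_integral
      ((2 * sqrt v) * (g (2 * sqrt v)) ^ 3 / 4 - (- 2 * sqrt v) * (g (- 2 * sqrt v)) ^ 3 / 4))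
    {- 2 * sqrt v..2 * sqrt v}"
  proof (rule fundamental_theorem_of_calculus_interior[where f = "\<lambda>x. x * (g x) ^ 3 / 4"])
    show "continuous_on {- 2 * sqrt v..2 * sqrt v} (\<lambda>x. x * (g x) ^ 3 / 4)"
      by (intro continuous_intros g_cont) auto
    fix x assume "x \<in> {- 2 * sqrt v<..<2 * sqrt v}"
    then have x: "\<bar>x\<bar> < 2 * sqrt v" by auto
    have "((\<lambda>x. x * (g x) ^ 3 / 4) has_real_derivative ((g x)\<^sup>2 - 3 * x\<^sup>2) * g x / 4) (at x)"
      using g_pos[OF x]
      by (auto intro!: derivative_eq_intros g_deriv[OF x] simp: power2_eq_square power3_eq_cube field_simps)
    moreover have "((g x)\<^sup>2 - 3 * x\<^sup>2) * g x / 4 = (v - x\<^sup>2) * g x"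
      using x by (simp add: g_sq field_simps)
    ultimately show "((\<lambda>x. x * (g x) ^ 3 / 4) has_vector_derivative (v - x\<^sup>2) * g x) (at x)"
      by (simp add: has_real_derivative_iff_has_vector_derivative)
  qed (use v in auto)
  then show ?thesis using g_end by (simp add: g_def)
qed

end

context nc_space
begin

text \<open>That the density has mass one is read off from \<open>\<tau> 1 = 1\<close>, the case of
  exponent 0. The bound for the fourth moment comes from \<open>x ^ 2 \<le> 4 * v\<close> on the
  support; only its order \<open>v ^ 2\<close> matters later.\<close>

lemma semicircular_moments:
  assumes v: "v > 0" and sc: "semicircular \<tau> v x"
  shows "\<tau> x = 0" and "\<tau> (x * x) = of_real v" and "Re (\<tau> (x ^ 4)) \<le> 4 * v\<^sup>2"
proof -
  define c where "c = 1 / (2 * pi * v)"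
  define r where "r = 2 * sqrt v"
  have c: "c > 0" and r2: "r\<^sup>2 = 4 * v" using v by (simp_all add: c_def r_def power_mult_distrib)
  define \<rho> where "\<rho> x = c * sqrt (4 * v - x\<^sup>2)" for x
  define m where "m n = integral {-r..r} (\<lambda>x. x ^ n * \<rho> x)" for n :: nat
  have tau: "\<tau> (x ^ n) = of_real (m n)" for n
    using sc unfolding semicircular_def m_def \<rho>_def c_def r_def by (simp add: field_simps)
  have int: "(\<lambda>x. x ^ n * \<rho> x) integrable_on {-r..r}" for n
    unfolding \<rho>_def by (intro integrable_continuous_real continuous_intros)
  have m0: "m 0 = 1" using tau[of 0] by simp
  have "((\<lambda>x. c * (x * sqrt (4 * v - x\<^sup>2))) has_integral c * 0) {-r..r}"
    using has_integral_mult_right[OF semicircle_first_moment[OF v], of c] by (simp add: r_def)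
  then have "m 1 = 0"
    by (auto simp: m_def \<rho>_def mult.left_commute dest!: integral_unique)
  then show "\<tau> x = 0" using tau[of 1] by simp
  have "((\<lambda>x. c * ((v - x\<^sup>2) * sqrt (4 * v - x\<^sup>2))) has_integral c * 0) {-r..r}"
    using has_integral_mult_right[OF semicircle_second_moment[OF v], of c] by (simp add: r_def)
  then have "integral {-r..r} (\<lambda>x. v * (x ^ 0 * \<rho> x) - x ^ 2 * \<rho> x) = 0"
    by (auto simp: \<rho>_def algebra_simps dest!: integral_unique)
  moreover have "integral {-r..r} (\<lambda>x. v * (x ^ 0 * \<rho> x) - x ^ 2 * \<rho> x) = v * m 0 - m 2"
    unfolding m_def by (subst integral_diff) (auto intro!: integrable_on_mult_right int[of 0, simplified] int)
  ultimately have m2: "m 2 = v" using m0 by simp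
  then show "\<tau> (x * x) = of_real v" using tau[of 2] by (simp add: power2_eq_square)
  have "m 4 \<le> integral {-r..r} (\<lambda>x. 4 * v * (x ^ 2 * \<rho> x))"
    unfolding m_def
  proof (rule integral_le)
    fix x assume "x \<in> {-r..r}"
    then have x2: "x\<^sup>2 \<le> 4 * v"
      unfolding r2[symmetric] by (intro abs_le_square_iff[THEN iffD1]) auto
    then have "0 \<le> \<rho> x" using c by (simp add: \<rho>_def)
    have "x ^ 4 = x\<^sup>2 * x\<^sup>2" by (simp flip: power_add)
    also have "\<dots> \<le> 4 * v * x\<^sup>2" using x2 by (intro mult_right_mono) auto
    finally have "x ^ 4 * \<rho> x \<le> 4 * v * x\<^sup>2 * \<rho> x"
      using \<open>0 \<le> \<rho> x\<close> by (rule mult_right_mono)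
    then show "x ^ 4 * \<rho> x \<le> 4 * v * (x ^ 2 * \<rho> x)"
      by (simp add: mult.assoc)
  qed (auto intro!: integrable_on_mult_right int)
  also have "\<dots> = 4 * v * m 2" by (simp add: m_def)
  finally show "Re (\<tau> (x ^ 4)) \<le> 4 * v\<^sup>2"
    using tau[of 4] m2 by (simp add: power2_eq_square)
qed

end

section \<open>Filtration and covariances of the additive Brownian motion\<close>

locale free_bm = nc_space M \<tau> for M :: "'h::complex_hilbert_space cop set" and \<tau> +
  fixes X :: "real \<Rightarrow> 'h cop"
  assumes bm: "free_additive_brownian_motion M \<tau> X"
begin

abbreviation F :: "real \<Rightarrow> 'h cop set" where "F \<equiv> natural_filtration X"

abbreviation inc :: "real \<Rightarrow> real \<Rightarrow> 'h cop" where "inc s t \<equiv> X t - X s"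

lemma X_in_M [simp]: "0 \<le> t \<Longrightarrow> X t \<in> M"
  and X_selfadjoint [simp]: "0 \<le> t \<Longrightarrow> star (X t) = X t"
  using bm unfolding free_additive_brownian_motion_def by blast+

lemma F_eq: "0 \<le> t \<Longrightarrow> F t = commutant (commutant (X ` {0..t}))"
proof -
  have "star ` X ` {0..t} \<subseteq> X ` {0..t}" using X_selfadjoint by force
  then show ?thesis
    unfolding natural_filtration_def vN_generated_def by (simp add: Un_absorb2)
qed

lemma F_subset_M: "0 \<le> t \<Longrightarrow> F t \<subseteq> M"
  unfolding F_eq using X_in_M
  by (subst M_bicommutant[symmetric], intro commutant_antimono) auto

lemma F_in_M [simp]: "A \<in> F t \<Longrightarrow> 0 \<le> t \<Longrightarrow> A \<in> M"
  using F_subset_M by blast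

lemma F_mono: "A \<in> F s \<Longrightarrow> 0 \<le> s \<Longrightarrow> s \<le> t \<Longrightarrow> A \<in> F t"
proof -
  assume "A \<in> F s" "0 \<le> s" "s \<le> t"
  moreover from this have "commutant (commutant (X ` {0..s})) \<subseteq> commutant (commutant (X ` {0..t}))"
    by (intro commutant_antimono) auto
  ultimately show ?thesis by (auto simp: F_eq)
qed

lemma F_one: "1 \<in> F t"
  and F_add: "A \<in> F t \<Longrightarrow> B \<in> F t \<Longrightarrow> A + B \<in> F t"
  and F_mult: "A \<in> F t \<Longrightarrow> B \<in> F t \<Longrightarrow> A * B \<in> F t"
  and F_scaleC: "A \<in> F t \<Longrightarrow> c *\<^sub>C A \<in> F t"
  unfolding natural_filtration_def vN_generated_def
  by (rule commutant_one commutant_add commutant_mult commutant_scaleC; assumption)+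

lemma F_minus: "A \<in> F t \<Longrightarrow> - A \<in> F t"
  using F_scaleC[of A t "- 1"] by simp

lemma F_diff: "A \<in> F t \<Longrightarrow> B \<in> F t \<Longrightarrow> A - B \<in> F t"
  using F_add[of A t "- B"] F_minus by simp

lemma F_star: "A \<in> F t \<Longrightarrow> star A \<in> F t"
  unfolding natural_filtration_def vN_generated_def
  by (rule commutant_star) (auto intro!: commutant_star)

lemma F_power: "A \<in> F t \<Longrightarrow> A ^ n \<in> F t"
  by (induction n) (auto intro: F_one F_mult)

lemma F_zero: "0 \<in> F t"
  using F_scaleC[OF F_one, of 0] by simp

lemma X_in_F: "0 \<le> s \<Longrightarrow> s \<le> t \<Longrightarrow> X s \<in> F t"
  using commutant_commutant_superset[of "X ` {0..t}"] by (auto simp: F_eq)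

lemma inc_in_F: "0 \<le> s \<Longrightarrow> s \<le> t \<Longrightarrow> inc s t \<in> F t"
  by (intro F_diff X_in_F) auto

lemma inc_moments:
  assumes "0 \<le> s" "s < t"
  shows "\<tau> (inc s t) = 0" "\<tau> (inc s t * inc s t) = of_real (t - s)"
    "Re (\<tau> (inc s t ^ 4)) \<le> 4 * (t - s)\<^sup>2"
  using semicircular_moments[of "t - s" "inc s t"] bm assms
  unfolding free_additive_brownian_motion_def by auto

lemma inc_free: "0 \<le> s \<Longrightarrow> s < t \<Longrightarrow> star_free \<tau> {inc s t} (F s)"
  using bm unfolding free_additive_brownian_motion_def by blast

lemma tau_mult_inc:
  assumes "0 \<le> s" "s \<le> t" "c \<in> F s" shows "\<tau> (c * inc s t) = 0"
proof (cases "s = t")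
  case False
  then have st: "s < t" using assms by simp
  have "\<tau> (inc s t * c) = \<tau> (inc s t) * \<tau> c"
    using assms by (intro tau_free_mult[OF inc_free[OF assms(1) st]] F_subset_M star_algebra.incl) auto
  then show ?thesis
    using tau_commute[of c "inc s t"] assms inc_moments(1)[OF assms(1) st] by simp
qed simp

text \<open>The rule \<open>dX B dX = \<tau> B dt\<close> in integrated form; the case
  \<open>s = t\<close> is included so that empty intervals need no separate treatment.\<close>

lemma tau_mult_inc_mult_inc:
  assumes "0 \<le> s" "s \<le> t" "A \<in> F s" "B \<in> F s"
  shows "\<tau> (A * inc s t * B * inc s t) = \<tau> A * \<tau> B * of_real (t - s)"
proof (cases "s = t")
  case False
  then have st: "s < t" using assms by simp
  show ?thesis
    unfolding inc_moments(2)[OF assms(1) st, symmetric]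
    using assms inc_moments(1)[OF assms(1) st]
    by (intro tau_free_mult4[OF inc_free[OF assms(1) st]] F_subset_M star_algebra.incl) auto
qed simp

text \<open>Both intervals are cut at the ends of their overlap. A piece lying after everything else
  contributes nothing by \<open>tau_mult_inc\<close>, and the overlap contributes its length times
  \<open>\<tau> c\<close>.\<close>

lemma inc_covariance_aux:
  assumes "0 \<le> u" "u \<le> v" "u \<le> u'" "u' \<le> v'" "c \<in> F u'"
  shows "\<tau> (inc u v * c * inc u' v') = of_real (max 0 (min v v' - u')) * \<tau> c"
proof (cases "v \<le> u'")
  case True
  have "inc u v * c \<in> F u'"
    using assms True by (intro F_mult F_mono[OF inc_in_F, of u v u']) auto
  then show ?thesis using True assms tau_mult_inc[of u' v' "inc u v * c"] by simp
next
  case False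
  note in_M [simp] = F_in_M[OF assms(5)]
  have "inc u u' * c \<in> F u'"
    using assms by (intro F_mult inc_in_F) auto
  then have 1: "\<tau> (inc u u' * c * inc u' v') = 0"
    using assms by (intro tau_mult_inc) auto
  have "inc u v * c * inc u' v' = inc u u' * c * inc u' v' + inc u' v * c * inc u' v'"
    by (simp add: algebra_simps)
  then have 2: "\<tau> (inc u v * c * inc u' v') = \<tau> (inc u' v * c * inc u' v')"
    using 1 False assms by simp
  have 3: "\<tau> (inc u' w * c * inc u' w) = of_real (w - u') * \<tau> c" if "u' \<le> w" for w
    using tau_mult_inc_mult_inc[of u' w 1 c] assms that F_one by (simp add: mult.commute)
  show ?thesis
  proof (cases "v \<le> v'")
    case True
    have "inc u' v * c \<in> F v"
      using False assms by (intro F_mult inc_in_F F_mono[OF assms(5)]) auto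
    then have "\<tau> (inc u' v * c * inc v v') = 0"
      using assms True by (intro tau_mult_inc) auto
    moreover have "inc u' v * c * inc u' v' = inc u' v * c * inc u' v + inc u' v * c * inc v v'"
      by (simp add: algebra_simps)
    ultimately show ?thesis using 2 3[of v] False True assms by simp
  next
    case v': False
    \<comment> \<open>Now the left increment sticks out to the future; the trace property moves that
      piece to the end of the word.\<close>
    have "c * inc u' v' \<in> F v'"
      using v' assms by (intro F_mult inc_in_F F_mono[OF assms(5)]) auto
    then have "\<tau> ((c * inc u' v') * inc v' v) = 0"
      using assms v' by (intro tau_mult_inc) auto
    then have "\<tau> (inc v' v * (c * inc u' v')) = 0"
      using tau_commute[of "inc v' v" "c * inc u' v'"] assms by simp
    moreover have "inc u' v * c * inc u' v' = inc u' v' * c * inc u' v' + inc v' v * (c * inc u' v')"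
      by (simp add: algebra_simps)
    ultimately show ?thesis using 2 3[of v'] v' assms by simp
  qed
qed

text \<open>When the left interval starts later, taking adjoints reverses the word and reduces it to
  the other case.\<close>

lemma inc_covariance:
  assumes "0 \<le> u" "u \<le> v" "0 \<le> u'" "u' \<le> v'" "c \<in> F (max u u')"
  shows "\<tau> (inc u v * c * inc u' v') = of_real (max 0 (min v v' - max u u')) * \<tau> c"
proof (cases "u \<le> u'")
  case True
  then show ?thesis using inc_covariance_aux[of u v u' v' c] assms by simp
next
  case False
  then have c: "c \<in> F u" using assms by simp
  then have [simp]: "c \<in> M" using assms by simp
  have "\<tau> (inc u v * c * inc u' v') = cnj (\<tau> (inc u' v' * star c * inc u v))"
    using assms by (subst tau_star[symmetric]) (auto simp: star_mult star_diff mult.assoc)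
  also have "\<dots> = of_real (max 0 (min v' v - u)) * \<tau> c"
    using False assms c tau_star[of c]
    by (subst inc_covariance_aux) (auto intro: F_star)
  finally show ?thesis using False by (simp add: min.commute)
qed

end

section \<open>The free Ito integral\<close>

lemma has_integral_sum_list:
  fixes f :: "'i \<Rightarrow> real \<Rightarrow> real"
  assumes "\<And>x. x \<in> set xs \<Longrightarrow> (f x has_integral I x) S"
  shows "((\<lambda>r. \<Sum>x\<leftarrow>xs. f x r) has_integral (\<Sum>x\<leftarrow>xs. I x)) S"
  using assms by (induction xs) (auto intro: has_integral_add)

lemma Re_sum_list: "Re (\<Sum>x\<leftarrow>xs. f x) = (\<Sum>x\<leftarrow>xs. Re (f x))"
  by (induction xs) auto

lemma has_integral_step:
  assumes "0 \<le> a" "b \<le> T" "a \<le> b \<or> T \<ge> 0"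
  shows "((\<lambda>r. if a \<le> r \<and> r < b then c else 0) has_integral max 0 (b - a) * c) {0..T::real}"
proof (cases "a \<le> b")
  case True
  have "((\<lambda>r. c) has_integral max 0 (b - a) * c) {a..b}"
    using has_integral_const_real[of c a b] True by simp
  then have "((\<lambda>r. if r \<in> {a..b} then c else 0) has_integral max 0 (b - a) * c) {0..T}"
    using assms True by (subst has_integral_restrict) auto
  then show ?thesis
    by (rule has_integral_spike[of "{b}", rotated 2]) auto
next
  case False
  then have "(\<lambda>r. if a \<le> r \<and> r < b then c else 0) = (\<lambda>r. 0::real)" by auto
  then show ?thesis using False by simp
qed

context nc_space
begin

lemma l2_sum_list_sq:
  assumes "\<And>x. x \<in> set xs \<Longrightarrow> f x \<in> M"
  shows "(l2 (\<Sum>x\<leftarrow>xs. f x))\<^sup>2 = (\<Sum>x\<leftarrow>xs. \<Sum>y\<leftarrow>xs. Re (\<tau> (star (f x) * f y)))"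
proof -
  have star_sum: "star (\<Sum>x\<leftarrow>ys. f x) = (\<Sum>x\<leftarrow>ys. star (f x))" for ys
    by (induction ys) (simp_all add: star_add)
  have "\<tau> (star (\<Sum>x\<leftarrow>xs. f x) * (\<Sum>y\<leftarrow>xs. f y)) = (\<Sum>x\<leftarrow>xs. \<Sum>y\<leftarrow>xs. \<tau> (star (f x) * f y))"
  proof -
    have "star (\<Sum>x\<leftarrow>xs. f x) * (\<Sum>y\<leftarrow>xs. f y) = (\<Sum>x\<leftarrow>xs. \<Sum>y\<leftarrow>xs. star (f x) * f y)"
      unfolding star_sum
      by (simp only: sum_list_mult_const[symmetric]) (simp only: sum_list_const_mult[symmetric])
    also have "\<tau> \<dots> = (\<Sum>x\<leftarrow>xs. \<Sum>y\<leftarrow>xs. \<tau> (star (f x) * f y))"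
      using assms by (subst tau_sum_list) (auto intro!: M_sum_list arg_cong[of _ _ sum_list] tau_sum_list)
    finally show ?thesis .
  qed
  moreover have "(\<Sum>x\<leftarrow>xs. f x) \<in> M" using assms by (auto intro!: M_sum_list)
  ultimately show ?thesis by (simp add: l2_sq Re_sum_list)
qed

end

context free_bm
begin

text \<open>
  A list of triples \<open>(u, v, a)\<close> stands for the step process \<open>\<Sum> a 1\<^bsub>[u, v)\<^esub>\<close>. The intervals may
  overlap, so that sums of step processes are concatenations of lists.
\<close>

definition integ :: "(real \<times> real \<times> 'h cop) list \<Rightarrow> 'h cop" where
  "integ L = (\<Sum>(u, v, a)\<leftarrow>L. a * inc u v)"

definition proc :: "(real \<times> real \<times> 'h cop) list \<Rightarrow> real \<Rightarrow> 'h cop" where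
  "proc L r = (\<Sum>(u, v, a)\<leftarrow>L. if u \<le> r \<and> r < v then a else 0)"

definition adapted :: "(real \<times> real \<times> 'h cop) list \<Rightarrow> bool" where
  "adapted L \<longleftrightarrow> (\<forall>(u, v, a)\<in>set L. 0 \<le> u \<and> u \<le> v \<and> a \<in> F u)"

lemma adaptedD: "adapted L \<Longrightarrow> (u, v, a) \<in> set L \<Longrightarrow> 0 \<le> u \<and> u \<le> v \<and> a \<in> F u \<and> a \<in> M"
  unfolding adapted_def by force

lemma integ_append: "integ (L @ K) = integ L + integ K"
  by (simp add: integ_def)

lemma proc_append: "proc (L @ K) r = proc L r + proc K r"
  by (simp add: proc_def)

lemma adapted_append: "adapted (L @ K) \<longleftrightarrow> adapted L \<and> adapted K"
  by (simp add: adapted_def ball_Un)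

lemma integ_in_M: "adapted L \<Longrightarrow> integ L \<in> M"
  unfolding integ_def by (intro M_sum_list) (auto dest!: adaptedD)

lemma proc_in_M: "adapted L \<Longrightarrow> proc L r \<in> M"
  unfolding proc_def by (intro M_sum_list) (auto dest!: adaptedD)

lemma proc_zero_after:
  assumes "\<And>u v a. (u, v, a) \<in> set L \<Longrightarrow> v \<le> r"
  shows "proc L r = 0"
proof -
  have "proc L r = (\<Sum>p\<leftarrow>L. 0)"
    unfolding proc_def using assms by (intro arg_cong[of _ _ sum_list] map_cong refl) fastforce
  then show ?thesis by simp
qed

lemma proc_zero_before:
  assumes "\<And>u v a. (u, v, a) \<in> set L \<Longrightarrow> r < u"
  shows "proc L r = 0"
proof -
  have "proc L r = (\<Sum>p\<leftarrow>L. 0)"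
    unfolding proc_def using assms by (intro arg_cong[of _ _ sum_list] map_cong refl) fastforce
  then show ?thesis by simp
qed

lemma ito_isometry:
  assumes L: "adapted L" and T: "0 \<le> T" "\<And>u v a. (u, v, a) \<in> set L \<Longrightarrow> v \<le> T"
  shows "((\<lambda>r. (l2 (proc L r))\<^sup>2) has_integral (l2 (integ L))\<^sup>2) {0..T}"
proof -
  define f where "f r p = (case p of (u, v, a) \<Rightarrow> if u \<le> r \<and> r < v then a else (0 :: 'h cop))" for r :: real and p
  define g where "g p = (case p of (u, v, a) \<Rightarrow> a * inc u v)" for p
  define I where "I p q = (case p of (u, v, a) \<Rightarrow> case q of (u', v', b) \<Rightarrow>
      max 0 (min v v' - max u u') * Re (\<tau> (star a * b)))" for p q :: "real \<times> real \<times> 'h cop"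
  have fM: "f r p \<in> M" and gM: "g p \<in> M" if "p \<in> set L" for r p
  proof -
    obtain u v a where p: "p = (u, v, a)" by (cases p)
    show "f r p \<in> M" "g p \<in> M"
      using adaptedD[OF L that[unfolded p]] by (auto simp: f_def g_def p)
  qed
  have cov: "Re (\<tau> (star (g p) * g q)) = I p q" if "p \<in> set L" "q \<in> set L" for p q
  proof -
    obtain u v a where p: "p = (u, v, a)" by (cases p)
    obtain u' v' b where q: "q = (u', v', b)" by (cases q)
    note pq = p q
    note P = adaptedD[OF L that(1)[unfolded pq]] and Q = adaptedD[OF L that(2)[unfolded pq]]
    have "star a * b \<in> F (max u u')"
      using P Q by (intro F_mult F_mono[OF F_star[of a u]] F_mono[of b u' "max u u'"]) auto
    then have "\<tau> (inc u v * (star a * b) * inc u' v')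
      = of_real (max 0 (min v v' - max u u')) * \<tau> (star a * b)"
      using P Q by (intro inc_covariance) auto
    moreover have "star (g p) * g q = inc u v * (star a * b) * inc u' v'"
      using P Q by (simp add: g_def pq star_mult star_diff mult.assoc)
    ultimately show ?thesis by (simp add: I_def pq)
  qed
  have int: "((\<lambda>r. Re (\<tau> (star (f r p) * f r q))) has_integral I p q) {0..T}"
    if "p \<in> set L" "q \<in> set L" for p q
  proof -
    obtain u v a where p: "p = (u, v, a)" by (cases p)
    obtain u' v' b where q: "q = (u', v', b)" by (cases q)
    note pq = p q
    note P = adaptedD[OF L that(1)[unfolded pq]] and Q = adaptedD[OF L that(2)[unfolded pq]]
    have "Re (\<tau> (star (f r p) * f r q))
      = (if max u u' \<le> r \<and> r < min v v' then Re (\<tau> (star a * b)) else 0)" for r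
      by (simp add: f_def pq)
    moreover have "v \<le> T" using T(2) that(1) pq by blast
    then have "((\<lambda>r. if max u u' \<le> r \<and> r < min v v' then Re (\<tau> (star a * b)) else 0) has_integral
        max 0 (min v v' - max u u') * Re (\<tau> (star a * b))) {0..T}"
      using P Q T(1) by (intro has_integral_step) auto
    ultimately show ?thesis
      by (simp only: I_def pq prod.case)
  qed
  have "((\<lambda>r. \<Sum>p\<leftarrow>L. \<Sum>q\<leftarrow>L. Re (\<tau> (star (f r p) * f r q))) has_integral (\<Sum>p\<leftarrow>L. \<Sum>q\<leftarrow>L. I p q)) {0..T}"
    by (intro has_integral_sum_list int)
  moreover have "(\<Sum>p\<leftarrow>L. \<Sum>q\<leftarrow>L. I p q) = (l2 (integ L))\<^sup>2"
  proof -
    have "integ L = (\<Sum>p\<leftarrow>L. g p)" by (simp add: integ_def g_def)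
    then show ?thesis
      using cov by (simp add: l2_sum_list_sq gM cong: map_cong)
  qed
  moreover have "(\<Sum>p\<leftarrow>L. \<Sum>q\<leftarrow>L. Re (\<tau> (star (f r p) * f r q))) = (l2 (proc L r))\<^sup>2" for r
  proof -
    have "proc L r = (\<Sum>p\<leftarrow>L. f r p)" by (simp add: proc_def f_def)
    then show ?thesis by (simp add: l2_sum_list_sq fM)
  qed
  ultimately show ?thesis by simp
qed

text \<open>The two cuts are not symmetric, for the sake of adaptedness. Moving a left end point up
  to \<open>s\<close>, as in \<open>after\<close>, is harmless since the filtration increases, and
  entries before \<open>s\<close> become empty intervals. Moving one down to \<open>s\<close> would
  not be, so \<open>before\<close> discards the entries that start at \<open>s\<close> or
  later.\<close>

definition before :: "real \<Rightarrow> (real \<times> real \<times> 'h cop) list \<Rightarrow> (real \<times> real \<times> 'h cop) list" where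
  "before s L = map (\<lambda>(u, v, a). (u, min v s, a)) (filter (\<lambda>(u, v, a). u < s) L)"

definition after :: "real \<Rightarrow> (real \<times> real \<times> 'h cop) list \<Rightarrow> (real \<times> real \<times> 'h cop) list" where
  "after s L = map (\<lambda>(u, v, a). (max u s, max v s, a)) L"

definition negate :: "(real \<times> real \<times> 'h cop) list \<Rightarrow> (real \<times> real \<times> 'h cop) list" where
  "negate L = map (\<lambda>(u, v, a). (u, v, - a)) L"

lemma integ_negate: "integ (negate L) = - integ L"
  by (induction L) (auto simp: integ_def negate_def)

lemma proc_negate: "proc (negate L) r = - proc L r"
  by (induction L) (auto simp: proc_def negate_def)

lemma adapted_negate: "adapted L \<Longrightarrow> adapted (negate L)"
  by (auto simp: adapted_def negate_def F_minus)

lemma integ_before_after: "adapted L \<Longrightarrow> integ L = integ (before s L) + integ (after s L)"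
proof (induction L)
  case (Cons p L)
  obtain u v a where p: "p = (u, v, a)" by (cases p)
  have "u \<le> v" using Cons.prems by (auto simp: adapted_def p)
  moreover have "adapted L" using Cons.prems by (auto simp: adapted_def)
  moreover have "a * inc u v = (if u < s then a * inc u (min v s) else 0) + a * inc (max u s) (max v s)"
    using \<open>u \<le> v\<close> by (cases "v = s") (auto simp: min_def max_def algebra_simps)
  ultimately show ?case
    using Cons.IH by (auto simp: p integ_def before_def after_def)
qed (simp add: integ_def before_def after_def)

lemma proc_before: "r < s \<Longrightarrow> proc (before s L) r = proc L r"
  by (induction L) (auto simp: proc_def before_def)

lemma proc_after: "s \<le> r \<Longrightarrow> proc (after s L) r = proc L r"
  by (induction L) (auto simp: proc_def after_def)

lemma adapted_before: "adapted L \<Longrightarrow> adapted (before s L)"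
  unfolding adapted_def before_def by force

lemma adapted_after: "0 \<le> s \<Longrightarrow> adapted L \<Longrightarrow> adapted (after s L)"
  unfolding adapted_def after_def by (auto intro: F_mono)

section \<open>The Ito integral over an interval\<close>

definition pieces :: "nat \<Rightarrow> (nat \<Rightarrow> real) \<Rightarrow> (nat \<Rightarrow> 'h cop) \<Rightarrow> (real \<times> real \<times> 'h cop) list" where
  "pieces k u a = map (\<lambda>j. (u j, u (Suc j), a j)) [0..<k]"

lemma integ_pieces: "integ (pieces k u a) = step_integral X k u a"
  unfolding integ_def pieces_def step_integral_def
  by (simp add: comp_def interv_sum_list_conv_sum_set_nat atLeast0LessThan)

lemma proc_pieces: "proc (pieces k u a) = step_process k u a"
  unfolding proc_def pieces_def step_process_def
  by (simp add: comp_def interv_sum_list_conv_sum_set_nat atLeast0LessThan fun_eq_iff)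

lemma adapted_pieces:
  assumes "adapted_step X t k u a"
  shows "adapted (pieces k u a)" and "(x, y, b) \<in> set (pieces k u a) \<Longrightarrow> y \<le> t"
proof -
  have step: "u j \<le> u (Suc j)" "a j \<in> F (u j)" if "j < k" for j
    using assms that unfolding adapted_step_def by auto
  have mono: "u i \<le> u j" if "i \<le> j" "j \<le> k" for i j
    using that by (induction j rule: dec_induct) (auto intro: order_trans[OF _ step(1)])
  have "0 \<le> u j" "u (Suc j) \<le> t" if "j < k" for j
    using mono[of 0 j] mono[of "Suc j" k] that assms unfolding adapted_step_def by auto
  then show "adapted (pieces k u a)" "(x, y, b) \<in> set (pieces k u a) \<Longrightarrow> y \<le> t"
    using step unfolding adapted_def pieces_def by auto
qed

text \<open>
  The approximations of \<open>J\<close> and \<open>J'\<close> may be unrelated; by the isometry they agree asymptotically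
  on \<open>[0, s]\<close>.
\<close>

lemma ito_increment_approx:
  assumes st: "0 \<le> s" "s < t"
    and J: "has_free_ito_integral \<tau> X t A J" "J \<in> M"
    and J': "has_free_ito_integral \<tau> X s A J'" "J' \<in> M"
    and A: "\<And>r. 0 \<le> r \<Longrightarrow> A r \<in> M"
  obtains L d where "\<And>n::nat. adapted (L n)"
    "\<And>n u v a. (u, v, a) \<in> set (L n) \<Longrightarrow> s \<le> u \<and> v \<le> t"
    "(\<lambda>n. l2 (integ (L n) - (J - J'))) \<longlonglongrightarrow> 0"
    "\<And>n. (d n has_integral integral {0..t} (d n)) {0..t}"
    "\<And>n r. 0 \<le> d n r"
    "\<And>n r. s \<le> r \<Longrightarrow> d n r = (l2 (proc (L n) r - A r))\<^sup>2"
    "(\<lambda>n. integral {0..t} (d n)) \<longlonglongrightarrow> 0"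
proof -
  from J(1) obtain k u a where ad: "\<And>n::nat. adapted_step X t (k n) (u n) (a n)"
    and int: "\<And>n. (\<lambda>r. (l2 (step_process (k n) (u n) (a n) r - A r))\<^sup>2) integrable_on {0..t}"
    and lim: "(\<lambda>n. integral {0..t} (\<lambda>r. (l2 (step_process (k n) (u n) (a n) r - A r))\<^sup>2)) \<longlonglongrightarrow> 0"
    and limJ: "(\<lambda>n. l2 (step_integral X (k n) (u n) (a n) - J)) \<longlonglongrightarrow> 0"
    unfolding has_free_ito_integral_def by blast
  from J'(1) obtain k' u' a' where ad': "\<And>n::nat. adapted_step X s (k' n) (u' n) (a' n)"
    and int': "\<And>n. (\<lambda>r. (l2 (step_process (k' n) (u' n) (a' n) r - A r))\<^sup>2) integrable_on {0..s}"
    and lim': "(\<lambda>n. integral {0..s} (\<lambda>r. (l2 (step_process (k' n) (u' n) (a' n) r - A r))\<^sup>2)) \<longlonglongrightarrow> 0"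
    and limJ': "(\<lambda>n. l2 (step_integral X (k' n) (u' n) (a' n) - J')) \<longlonglongrightarrow> 0"
    unfolding has_free_ito_integral_def by blast
  define L where "L n = pieces (k n) (u n) (a n)" for n
  define K where "K n = pieces (k' n) (u' n) (a' n)" for n
  define d where "d n r = (l2 (step_process (k n) (u n) (a n) r - A r))\<^sup>2" for n r
  define d' where "d' n r = (l2 (step_process (k' n) (u' n) (a' n) r - A r))\<^sup>2" for n r
  have L: "adapted (L n)" "\<And>x y b. (x, y, b) \<in> set (L n) \<Longrightarrow> y \<le> t" for n
    using adapted_pieces[OF ad] unfolding L_def by blast+
  have K: "adapted (K n)" "\<And>x y b. (x, y, b) \<in> set (K n) \<Longrightarrow> y \<le> s" for n
    using adapted_pieces[OF ad'] unfolding K_def by blast+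
  have dL: "d n r = (l2 (proc (L n) r - A r))\<^sup>2" and dK: "d' n r = (l2 (proc (K n) r - A r))\<^sup>2" for n r
    by (simp_all add: d_def d'_def L_def K_def proc_pieces)
  have d_int: "d n integrable_on {0..t}" and d'_int: "d' n integrable_on {0..s}" for n
    using int[of n] int'[of n] by (simp_all add: d_def[abs_def] d'_def[abs_def])
  have d_int_s: "d n integrable_on {0..s}" for n
    using d_int[of n] by (rule integrable_on_subinterval) (use st in auto)
  have d_nonneg: "0 \<le> d n r" for n r by (simp add: d_def)
  \<comment> \<open>The isometry on \<open>[0, s]\<close> applied to the difference of the two
    approximations; the factors 2 come from \<open>l2_add_sq_le\<close>.\<close>
  have low: "l2 (integ (before s (L n)) - integ (K n)) \<le> sqrt (2 * integral {0..t} (d n) + 2 * integral {0..s} (d' n))" for n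
  proof (rule real_le_rsqrt)
    define N where "N = before s (L n) @ negate (K n)"
    have N: "adapted N" unfolding N_def adapted_append
      by (intro conjI adapted_before adapted_negate L K)
    have Ns: "y \<le> s" if "(x, y, b) \<in> set N" for x y b
      using that K(2) by (auto simp: N_def before_def negate_def)
    have "((\<lambda>r. (l2 (proc N r))\<^sup>2) has_integral (l2 (integ N))\<^sup>2) {0..s}"
      using st Ns by (intro ito_isometry[OF N]) auto
    moreover have "((\<lambda>r. 2 * d n r + 2 * d' n r) has_integral (2 * integral {0..s} (d n) + 2 * integral {0..s} (d' n))) {0..s}"
      by (intro has_integral_add has_integral_mult_right integrable_integral d_int_s d'_int)
    moreover have "(l2 (proc N r))\<^sup>2 \<le> 2 * d n r + 2 * d' n r" if "r \<in> {0..s}" for r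
    proof (cases "r < s")
      case True
      have [simp]: "A r \<in> M" "proc (L n) r \<in> M" "proc (K n) r \<in> M"
        using that A proc_in_M L(1) K(1) by auto
      have "proc N r = (proc (L n) r - A r) + (A r - proc (K n) r)"
        using True by (simp add: N_def proc_append proc_negate proc_before)
      then have "(l2 (proc N r))\<^sup>2 \<le> 2 * (l2 (proc (L n) r - A r))\<^sup>2 + 2 * (l2 (A r - proc (K n) r))\<^sup>2"
        by (simp only: l2_add_sq_le M_diff \<open>A r \<in> M\<close> \<open>proc (L n) r \<in> M\<close> \<open>proc (K n) r \<in> M\<close>)
      then show ?thesis by (simp add: dL dK l2_minus_commute[of "A r"])
    next
      \<comment> \<open>Here \<open>r = s\<close>, where all the intervals, being half-open, have
        ended.\<close>
      case False
      then have "proc N r = 0" using that Ns by (intro proc_zero_after) auto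
      then show ?thesis by (simp add: d_def d'_def)
    qed
    ultimately have "(l2 (integ N))\<^sup>2 \<le> 2 * integral {0..s} (d n) + 2 * integral {0..s} (d' n)"
      by (rule has_integral_le)
    also have "integral {0..s} (d n) \<le> integral {0..t} (d n)"
      using st d_nonneg by (intro integral_subset_le d_int d_int_s) auto
    finally show "(l2 (integ (before s (L n)) - integ (K n)))\<^sup>2 \<le> 2 * integral {0..t} (d n) + 2 * integral {0..s} (d' n)"
      by (simp add: N_def integ_append integ_negate)
  qed
  show ?thesis
  proof (rule that)
    show "adapted (after s (L n))" for n
      using st L by (intro adapted_after)
    show "s \<le> x \<and> y \<le> t" if "(x, y, b) \<in> set (after s (L n))" for n x y b
      using that L(2) st by (auto simp: after_def)
    show "(d n has_integral integral {0..t} (d n)) {0..t}" for n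
      using d_int by blast
    show "d n r = (l2 (proc (after s (L n)) r - A r))\<^sup>2" if "s \<le> r" for n r
      using that by (simp add: dL proc_after)
    show "(\<lambda>n. integral {0..t} (d n)) \<longlonglongrightarrow> 0"
      using lim by (simp add: d_def[abs_def])
    show "(\<lambda>n. l2 (integ (after s (L n)) - (J - J'))) \<longlonglongrightarrow> 0"
    proof (rule tendsto_sandwich[OF _ _ tendsto_const])
      have [simp]: "integ (L n) \<in> M" "integ (K n) \<in> M" "integ (before s (L n)) \<in> M" "integ (after s (L n)) \<in> M" for n
        using L K st by (auto intro!: integ_in_M adapted_before adapted_after)
      show "\<forall>\<^sub>F n in sequentially. 0 \<le> l2 (integ (after s (L n)) - (J - J'))"
        using J J' by simp
      have "l2 (integ (after s (L n)) - (J - J')) \<le> l2 (integ (L n) - J) + l2 (integ (K n) - J')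
         + sqrt (2 * integral {0..t} (d n) + 2 * integral {0..s} (d' n))" for n
      proof -
        have "integ (after s (L n)) - (J - J') = (integ (L n) - J) - (integ (K n) - J')
            - (integ (before s (L n)) - integ (K n))"
          using integ_before_after[OF L(1)[of n], of s] by (simp add: algebra_simps)
        then have "l2 (integ (after s (L n)) - (J - J')) \<le> l2 ((integ (L n) - J) - (integ (K n) - J'))
            + l2 (integ (before s (L n)) - integ (K n))"
          using J J' by (simp only: l2_triangle_diff M_diff \<open>\<And>n. integ (L n) \<in> M\<close> \<open>\<And>n. integ (K n) \<in> M\<close>
              \<open>\<And>n. integ (before s (L n)) \<in> M\<close>)
        also have "l2 ((integ (L n) - J) - (integ (K n) - J')) \<le> l2 (integ (L n) - J) + l2 (integ (K n) - J')"
          using J J' by (intro l2_triangle_diff) auto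
        finally show ?thesis using low[of n] by linarith
      qed
      then show "\<forall>\<^sub>F n in sequentially. l2 (integ (after s (L n)) - (J - J')) \<le> l2 (integ (L n) - J)
         + l2 (integ (K n) - J') + sqrt (2 * integral {0..t} (d n) + 2 * integral {0..s} (d' n))"
        by simp
      have "(\<lambda>n. l2 (integ (L n) - J) + l2 (integ (K n) - J') + sqrt (2 * integral {0..t} (d n) + 2 * integral {0..s} (d' n)))
         \<longlonglongrightarrow> 0 + 0 + sqrt (2 * 0 + 2 * 0)"
        using limJ limJ' lim lim'
        unfolding L_def K_def integ_pieces d_def[abs_def] d'_def[abs_def] by (intro tendsto_intros)
      then show "(\<lambda>n. l2 (integ (L n) - J) + l2 (integ (K n) - J') + sqrt (2 * integral {0..t} (d n) + 2 * integral {0..s} (d' n)))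
         \<longlonglongrightarrow> 0" by simp
    qed
  qed (rule d_nonneg)
qed

text \<open>The martingale property. All approximating intervals start at \<open>s\<close> or later,
  so \<open>B * a\<close> is adapted and each step integrates to trace zero; the trace is continuous
  for the L2 seminorm.\<close>

lemma ito_increment_mean:
  assumes "0 \<le> s" "s < t"
    and "has_free_ito_integral \<tau> X t A J" "J \<in> M"
    and "has_free_ito_integral \<tau> X s A J'" "J' \<in> M"
    and "\<And>r. 0 \<le> r \<Longrightarrow> A r \<in> M" and B: "B \<in> F s"
  shows "\<tau> (B * (J - J')) = 0"
proof -
  obtain L d where L: "\<And>n::nat. adapted (L n)"
    "\<And>n u v a. (u, v, a) \<in> set (L n) \<Longrightarrow> s \<le> u \<and> v \<le> t"
    and lim: "(\<lambda>n. l2 (integ (L n) - (J - J'))) \<longlonglongrightarrow> 0"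
    using ito_increment_approx[OF assms(1-7)] by metis
  have BM [simp]: "B \<in> M" using B assms by simp
  have LM [simp]: "integ (L n) \<in> M" for n using L by (intro integ_in_M)
  have "\<tau> (B * integ (L n)) = 0" for n
  proof -
    have zero: "\<tau> (B * (a * inc u v)) = 0" "B * (a * inc u v) \<in> M" if "(u, v, a) \<in> set (L n)" for u v a
    proof -
      note P = L(2)[OF that] adaptedD[OF L(1) that]
      then have "B * a \<in> F u" using assms by (intro F_mult F_mono[OF B]) auto
      then show "\<tau> (B * (a * inc u v)) = 0" using tau_mult_inc[of u v "B * a"] P by (simp add: mult.assoc)
      show "B * (a * inc u v) \<in> M" using P by auto
    qed
    have "B * integ (L n) = (\<Sum>(u, v, a)\<leftarrow>L n. B * (a * inc u v))"
      by (simp add: integ_def sum_list_const_mult[symmetric] case_prod_unfold)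
    also have "\<tau> \<dots> = (\<Sum>(u, v, a)\<leftarrow>L n. \<tau> (B * (a * inc u v)))"
      using zero(2) by (simp add: case_prod_unfold) (subst tau_sum_list, auto)
    also have "\<dots> = (\<Sum>p\<leftarrow>L n. 0)"
      using zero(1) by (intro arg_cong[of _ _ sum_list] map_cong) auto
    finally show ?thesis by simp
  qed
  then have "cmod (\<tau> (B * (J - J'))) \<le> norm B * l2 (integ (L n) - (J - J'))" for n
    using cmod_tau_le[of "B * (integ (L n) - (J - J'))"] l2_mult_le[of B "integ (L n) - (J - J')"] assms(4,6)
    by (simp add: right_diff_distrib norm_minus_commute)
  moreover have "(\<lambda>n. norm B * l2 (integ (L n) - (J - J'))) \<longlonglongrightarrow> norm B * 0"
    by (intro tendsto_intros lim)
  ultimately have "cmod (\<tau> (B * (J - J'))) \<le> 0"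
    by (intro LIMSEQ_le_const[of _ "norm B * 0", simplified]) auto
  then show ?thesis by simp
qed

text \<open>The isometry applied to an approximating step process minus the constant
  \<open>B\<close> on \<open>[s, t)\<close>. The factor 2 comes from splitting the integrand at
  \<open>A r\<close>; the approximation error disappears in the limit.\<close>

lemma ito_increment_l2:
  assumes "0 \<le> s" "s < t"
    and "has_free_ito_integral \<tau> X t A J" "J \<in> M"
    and "has_free_ito_integral \<tau> X s A J'" "J' \<in> M"
    and A: "\<And>r. 0 \<le> r \<Longrightarrow> A r \<in> M" and B: "B \<in> F s"
    and int: "((\<lambda>r. (l2 (A r - B))\<^sup>2) has_integral I) {s..t}"
  shows "(l2 (J - J' - B * inc s t))\<^sup>2 \<le> 2 * I"
proof -
  obtain L d where L: "\<And>n::nat. adapted (L n)"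
    "\<And>n u v a. (u, v, a) \<in> set (L n) \<Longrightarrow> s \<le> u \<and> v \<le> t"
    and lim: "(\<lambda>n. l2 (integ (L n) - (J - J'))) \<longlonglongrightarrow> 0"
    and d: "\<And>n. (d n has_integral integral {0..t} (d n)) {0..t}" "\<And>n r. 0 \<le> d n r"
    "\<And>n r. s \<le> r \<Longrightarrow> d n r = (l2 (proc (L n) r - A r))\<^sup>2"
    and dlim: "(\<lambda>n. integral {0..t} (d n)) \<longlonglongrightarrow> 0"
    using ito_increment_approx[OF assms(1-6) A] by blast
  have BM [simp]: "B \<in> M" using B assms by simp
  have LM [simp]: "integ (L n) \<in> M" for n using L by (intro integ_in_M)
  have I: "0 \<le> I" using int by (rule has_integral_nonneg) simp
  have bound: "l2 (integ (L n) - B * inc s t) \<le> sqrt (2 * integral {0..t} (d n) + 2 * I)" for n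
  proof (rule real_le_rsqrt)
    define N where "N = L n @ [(s, t, - B)]"
    have N: "adapted N" using L B assms by (auto simp: N_def adapted_def F_minus)
    have Ns: "s \<le> x \<and> y \<le> t" if "(x, y, b) \<in> set N" for x y b
      using that L(2) by (auto simp: N_def)
    have "((\<lambda>r. (l2 (proc N r))\<^sup>2) has_integral (l2 (integ N))\<^sup>2) {0..t}"
      using assms Ns by (intro ito_isometry[OF N]) auto
    moreover have "((\<lambda>r. 2 * d n r + 2 * (if r \<in> {s..t} then (l2 (A r - B))\<^sup>2 else 0))
        has_integral (2 * integral {0..t} (d n) + 2 * I)) {0..t}"
      using int assms
      by (intro has_integral_add has_integral_mult_right d) (subst has_integral_restrict, auto)
    moreover have "(l2 (proc N r))\<^sup>2 \<le> 2 * d n r + 2 * (if r \<in> {s..t} then (l2 (A r - B))\<^sup>2 else 0)"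
      if r: "r \<in> {0..t}" for r
    proof -
      have M1: "A r \<in> M" "proc (L n) r \<in> M"
        using r A proc_in_M L(1) by auto
      consider "r < s" | "s \<le> r" "r < t" | "r = t" using r by fastforce
      then show ?thesis
      proof cases
        case 1
        then have "proc N r = 0" using Ns by (intro proc_zero_before) force
        then show ?thesis using d(2)[of n r] by simp
      next
        case 2
        have "proc N r = (proc (L n) r - A r) + (A r - B)"
          using 2 by (simp add: N_def proc_append) (simp add: proc_def)
        then have "(l2 (proc N r))\<^sup>2 \<le> 2 * (l2 (proc (L n) r - A r))\<^sup>2 + 2 * (l2 (A r - B))\<^sup>2"
          by (simp only: l2_add_sq_le M_diff M1 BM)
        then show ?thesis using 2 by (simp add: d(3))
      next
        case 3
        then have "proc N r = 0" using Ns by (intro proc_zero_after) force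
        then show ?thesis using d(2)[of n r] by simp
      qed
    qed
    ultimately have "(l2 (integ N))\<^sup>2 \<le> 2 * integral {0..t} (d n) + 2 * I"
      by (rule has_integral_le)
    then show "(l2 (integ (L n) - B * inc s t))\<^sup>2 \<le> 2 * integral {0..t} (d n) + 2 * I"
      by (simp add: N_def integ_append) (simp add: integ_def)
  qed
  have "l2 (J - J' - B * inc s t) \<le> l2 (integ (L n) - (J - J')) + sqrt (2 * integral {0..t} (d n) + 2 * I)" for n
  proof -
    have BX: "B * inc s t \<in> M" using assms by simp
    have "l2 (J - J' - B * inc s t) \<le> l2 (J - J' - integ (L n)) + l2 (integ (L n) - B * inc s t)"
      by (intro l2_diff_triangle M_diff assms LM BX)
    also have "l2 (J - J' - integ (L n)) = l2 (integ (L n) - (J - J'))"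
      by (intro l2_minus_commute M_diff assms LM)
    finally show ?thesis using bound[of n] by linarith
  qed
  moreover have "(\<lambda>n. l2 (integ (L n) - (J - J')) + sqrt (2 * integral {0..t} (d n) + 2 * I))
     \<longlonglongrightarrow> 0 + sqrt (2 * 0 + 2 * I)"
    by (intro tendsto_intros lim dlim)
  ultimately have "l2 (J - J' - B * inc s t) \<le> 0 + sqrt (2 * 0 + 2 * I)"
    by (intro LIMSEQ_le_const) auto
  moreover have "J - J' - B * inc s t \<in> M" using assms by auto
  ultimately have "(l2 (J - J' - B * inc s t))\<^sup>2 \<le> (sqrt (2 * I))\<^sup>2"
    by (intro power_mono) auto
  then show ?thesis using I by simp
qed

end

section \<open>Increments of the free unitary Brownian motion\<close>

context nc_space
begin

section \<open>Operator-valued integrals under the trace\<close>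

lemma riemann_sum_in_M:
  fixes f :: "real \<Rightarrow> 'h cop"
  assumes "p tagged_division_of {a..b}" "\<And>x. x \<in> {a..b} \<Longrightarrow> f x \<in> M"
  shows "(\<Sum>(x, k)\<in>p. measure lborel k *\<^sub>R f x) \<in> M"
proof (rule M_sum, clarify)
  fix x k assume "(x, k) \<in> p"
  then have "x \<in> {a..b}" using tagged_division_ofD(2,3)[OF assms(1)] by blast
  then show "measure lborel k *\<^sub>R f x \<in> M" using assms(2) by simp
qed

text \<open>\<open>M\<close> is norm closed and contains the Riemann sums.\<close>

lemma has_integral_in_M:
  fixes f :: "real \<Rightarrow> 'h cop"
  assumes int: "(f has_integral D) {a..b}" and f: "\<And>x. x \<in> {a..b} \<Longrightarrow> f x \<in> M"
  shows "D \<in> M"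
proof (rule ccontr)
  assume "D \<notin> M"
  then obtain e where e: "e > 0" "ball D e \<subseteq> - M"
    using openE[of "- M" D] M_closed by (auto simp: closed_def)
  obtain \<gamma> where \<gamma>: "gauge \<gamma>"
    "\<And>p. p tagged_division_of {a..b} \<Longrightarrow> \<gamma> fine p \<Longrightarrow> norm ((\<Sum>(x, k)\<in>p. measure lborel k *\<^sub>R f x) - D) < e"
    using int[unfolded has_integral_real, rule_format, OF e(1)] by metis
  obtain p where "p tagged_division_of {a..b}" "\<gamma> fine p"
    using fine_division_exists_real[OF \<gamma>(1)] by blast
  then have "(\<Sum>(x, k)\<in>p. measure lborel k *\<^sub>R f x) \<in> M \<inter> ball D e"
    using \<gamma>(2) riemann_sum_in_M[of p a b f] f by (simp add: dist_norm norm_minus_commute)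
  then show False using e(2) by blast
qed

text \<open>\<open>\<tau>\<close> is linear and bounded on \<open>M\<close> only, so it is not a
  bounded linear map on the whole operator type that could be pulled through the integral; the
  argument is carried out on Riemann sums instead.\<close>

lemma tau_has_integral:
  fixes f :: "real \<Rightarrow> 'h cop"
  assumes int: "(f has_integral D) {a..b}" and f: "\<And>x. x \<in> {a..b} \<Longrightarrow> f x \<in> M" and B: "B \<in> M"
  shows "((\<lambda>r. \<tau> (B * f r)) has_integral \<tau> (B * D)) {a..b}"
  unfolding has_integral_real
proof (intro allI impI)
  fix e :: real assume "e > 0"
  have D: "D \<in> M" using has_integral_in_M[OF int f] .
  define e' where "e' = e / (norm B + 1)"
  have "e' > 0" using \<open>e > 0\<close> by (simp add: e'_def add_nonneg_pos)
  then obtain \<gamma> where \<gamma>: "gauge \<gamma>"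
    "\<And>p. p tagged_division_of {a..b} \<Longrightarrow> \<gamma> fine p \<Longrightarrow> norm ((\<Sum>(x, k)\<in>p. measure lborel k *\<^sub>R f x) - D) < e'"
    using int[unfolded has_integral_real, rule_format, OF \<open>e' > 0\<close>] by metis
  have "norm ((\<Sum>(x, k)\<in>p. measure lborel k *\<^sub>R \<tau> (B * f x)) - \<tau> (B * D)) < e"
    if p: "p tagged_division_of {a..b}" "\<gamma> fine p" for p
  proof -
    define S where "S = (\<Sum>(x, k)\<in>p. measure lborel k *\<^sub>R f x)"
    have S: "S \<in> M" unfolding S_def by (rule riemann_sum_in_M[OF p(1) f])
    have fx: "f x \<in> M" if "(x, k) \<in> p" for x k
      using tagged_division_ofD(2,3)[OF p(1) that] f by blast
    have "\<tau> (B * S) = \<tau> (\<Sum>(x, k)\<in>p. measure lborel k *\<^sub>R (B * f x))"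
      by (simp add: S_def sum_distrib_left case_prod_unfold)
    also have "\<dots> = (\<Sum>z\<in>p. \<tau> (case z of (x, k) \<Rightarrow> measure lborel k *\<^sub>R (B * f x)))"
      using fx B by (intro tau_sum) auto
    also have "\<dots> = (\<Sum>(x, k)\<in>p. measure lborel k *\<^sub>R \<tau> (B * f x))"
      using fx B by (intro sum.cong) (auto simp: scaleR_conv_of_real)
    finally have "norm ((\<Sum>(x, k)\<in>p. measure lborel k *\<^sub>R \<tau> (B * f x)) - \<tau> (B * D)) = cmod (\<tau> (B * (S - D)))"
      using B S D by (simp add: right_diff_distrib)
    also have "\<dots> \<le> norm (B * (S - D))"
      using B S D by (intro cmod_tau_le_norm) auto
    also have "\<dots> \<le> norm B * norm (S - D)" by (rule norm_mult_ineq)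
    also have "\<dots> \<le> norm B * e'"
      using \<gamma>(2)[OF p] by (intro mult_left_mono) (auto simp: S_def)
    also have "\<dots> < (norm B + 1) * e'"
      using \<open>e' > 0\<close> by simp
    also have "\<dots> = e"
      using norm_ge_zero[of B] by (simp add: e'_def add_nonneg_eq_0_iff)
    finally show ?thesis .
  qed
  then show "\<exists>\<gamma>. gauge \<gamma> \<and> (\<forall>p. p tagged_division_of {a..b} \<and> \<gamma> fine p \<longrightarrow>
      norm ((\<Sum>(x, k)\<in>p. measure lborel k *\<^sub>R \<tau> (B * f x)) - \<tau> (B * D)) < e)"
    using \<gamma>(1) by blast
qed

end

section \<open>Local expansion of the unitary Brownian motion\<close>

locale free_ubm = free_bm M \<tau> X
  for M :: "'h::complex_hilbert_space cop set" and \<tau> and X +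
  fixes Y :: "real \<Rightarrow> 'h cop"
  assumes Y_adapted: "\<And>t. 0 \<le> t \<Longrightarrow> Y t \<in> natural_filtration X t"
    and Y_unitary1 [simp]: "\<And>t. 0 \<le> t \<Longrightarrow> star (Y t) * Y t = 1"
    and Y_unitary2 [simp]: "\<And>t. 0 \<le> t \<Longrightarrow> Y t * star (Y t) = 1"
    and Y_zero [simp]: "Y 0 = 1"
    and Y_sde: "\<And>t. 0 \<le> t \<Longrightarrow> \<exists>J D. has_free_ito_integral \<tau> X t Y J \<and> (Y has_integral D) {0..t} \<and>
           Y t = 1 + \<i> *\<^sub>C J - (1/2) *\<^sub>C D"
begin

lemma Y_in_M [simp]: "0 \<le> t \<Longrightarrow> Y t \<in> M"
  using Y_adapted F_in_M by blast

lemma norm_Y: "0 \<le> t \<Longrightarrow> norm (Y t) \<le> 1"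
  by (rule norm_le_one_unitary) simp

lemma l2_Y [simp]: "0 \<le> t \<Longrightarrow> l2 (Y t) = 1"
  by (simp add: l2_norm_def)

text \<open>The equation is given for every time separately, with its own integrals;
  \<open>Z\<close> and \<open>E\<close> are the differences of those at \<open>t\<close> and
  \<open>s\<close>. The drift is kept in weak form, tested against \<open>B\<close>, as only traces
  of it are used.\<close>

lemma increment:
  assumes st: "0 \<le> s" "s < t"
  obtains Z E where "Y t - Y s = \<i> *\<^sub>C Z - (1/2) *\<^sub>C E" "Z \<in> M" "E \<in> M"
    "\<And>B. B \<in> F s \<Longrightarrow> \<tau> (B * Z) = 0"
    "\<And>B I. B \<in> F s \<Longrightarrow> ((\<lambda>r. (l2 (Y r - B))\<^sup>2) has_integral I) {s..t} \<Longrightarrow> (l2 (Z - B * inc s t))\<^sup>2 \<le> 2 * I"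
    "\<And>B. B \<in> M \<Longrightarrow> ((\<lambda>r. \<tau> (B * Y r)) has_integral \<tau> (B * E)) {s..t}"
proof -
  have t: "0 \<le> t" using st by simp
  obtain J D where J: "has_free_ito_integral \<tau> X t Y J" and D: "(Y has_integral D) {0..t}"
    and Yt: "Y t = 1 + \<i> *\<^sub>C J - (1/2) *\<^sub>C D"
    using Y_sde[OF t] by blast
  obtain J' D' where J': "has_free_ito_integral \<tau> X s Y J'" and D': "(Y has_integral D') {0..s}"
    and Ys: "Y s = 1 + \<i> *\<^sub>C J' - (1/2) *\<^sub>C D'"
    using Y_sde[OF st(1)] by blast
  have DM: "D \<in> M" "D' \<in> M"
    using has_integral_in_M[OF D] has_integral_in_M[OF D'] by auto
  \<comment> \<open>An L2 limit is not by definition an element of \<open>M\<close>; solving the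
    equation for it shows that it is one.\<close>
  have "J = (- \<i>) *\<^sub>C (Y t - 1 + (1/2) *\<^sub>C D)" "J' = (- \<i>) *\<^sub>C (Y s - 1 + (1/2) *\<^sub>C D')"
    unfolding Yt Ys by (simp_all add: scaleC_scaleC)
  then have JM: "J \<in> M" "J' \<in> M"
    using DM st by (metis M_scaleC M_add M_diff M_one Y_in_M t)+
  show ?thesis
  proof (rule that[of "J - J'" "D - D'"])
    show "Y t - Y s = \<i> *\<^sub>C (J - J') - (1/2) *\<^sub>C (D - D')"
      unfolding Yt Ys by (simp add: scaleC_diff_right)
    show "\<tau> (B * (J - J')) = 0" if "B \<in> F s" for B
      using ito_increment_mean[OF st J JM(1) J' JM(2) Y_in_M that] .
    show "(l2 (J - J' - B * inc s t))\<^sup>2 \<le> 2 * I"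
      if "B \<in> F s" "((\<lambda>r. (l2 (Y r - B))\<^sup>2) has_integral I) {s..t}" for B I
      using ito_increment_l2[OF st J JM(1) J' JM(2) Y_in_M that] .
    show "((\<lambda>r. \<tau> (B * Y r)) has_integral \<tau> (B * (D - D'))) {s..t}" if B: "B \<in> M" for B
    proof -
      let ?f = "\<lambda>r. \<tau> (B * Y r)"
      have 1: "(?f has_integral \<tau> (B * D)) {0..t}" "(?f has_integral \<tau> (B * D')) {0..s}"
        using D D' B by (auto intro!: tau_has_integral)
      then have int: "?f integrable_on {0..t}" by blast
      then have "?f integrable_on {s..t}"
        by (rule integrable_on_subinterval) (use st in auto)
      moreover have "integral {0..s} ?f + integral {s..t} ?f = integral {0..t} ?f"
        using st int by (intro Henstock_Kurzweil_Integration.integral_combine) auto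
      then have "integral {s..t} ?f = \<tau> (B * (D - D'))"
        using 1 B DM by (simp add: integral_unique right_diff_distrib algebra_simps)
      ultimately show ?thesis by (simp add: has_integral_iff)
    qed
  qed (use DM JM in auto)
qed

text \<open>Testing with \<open>star E\<close> gives
  \<open>(l2 E) ^ 2 \<le> l2 E * (t - s)\<close>.\<close>

lemma l2_drift_le:
  assumes st: "0 \<le> s" "s < t" and E: "E \<in> M"
    and int: "\<And>B. B \<in> M \<Longrightarrow> ((\<lambda>r. \<tau> (B * Y r)) has_integral \<tau> (B * E)) {s..t}"
  shows "l2 E \<le> t - s"
proof -
  have "cmod (\<tau> (star E * E)) \<le> l2 E * measure lborel {s..t}"
  proof (rule has_integral_bound_real[OF _ finite.emptyI int])
    show "cmod (\<tau> (star E * Y r)) \<le> l2 E" if "r \<in> {s..t} - {}" for r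
      using cmod_tau_star_mult[of E "Y r"] E that st by simp
  qed (use E in auto)
  then have "(l2 E)\<^sup>2 \<le> l2 E * (t - s)"
    using st E by (simp add: tau_star_mult_self norm_power)
  then show ?thesis
    using l2_nonneg[OF E] st by (cases "l2 E = 0") (auto simp: power2_eq_square)
qed

text \<open>The crude estimate, from comparison with the integrand \<open>B = 0\<close>. It is fed
  back into the equation to obtain \<open>l2_increment_approx\<close>.\<close>

lemma l2_increment_le:
  assumes st: "0 \<le> s" "s \<le> t" "t \<le> s + 1"
  shows "l2 (Y t - Y s) \<le> 2 * sqrt (t - s)"
proof (cases "s = t")
  case False
  then have st': "s < t" using st by simp
  obtain Z E where ZE: "Y t - Y s = \<i> *\<^sub>C Z - (1/2) *\<^sub>C E" "Z \<in> M" "E \<in> M"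
    and "\<And>B. B \<in> F s \<Longrightarrow> \<tau> (B * Z) = 0"
    and Z: "\<And>B I. B \<in> F s \<Longrightarrow> ((\<lambda>r. (l2 (Y r - B))\<^sup>2) has_integral I) {s..t} \<Longrightarrow> (l2 (Z - B * inc s t))\<^sup>2 \<le> 2 * I"
    and E: "\<And>B. B \<in> M \<Longrightarrow> ((\<lambda>r. \<tau> (B * Y r)) has_integral \<tau> (B * E)) {s..t}"
    by (rule increment[OF st(1) st']) (rule that; assumption)
  have "((\<lambda>r. (l2 (Y r - 0))\<^sup>2) has_integral (t - s)) {s..t}"
    by (rule has_integral_eq[of _ "\<lambda>r. 1"]) (use has_integral_const_real[of "1::real" s t] st in auto)
  from Z[OF F_zero this] have "(l2 Z)\<^sup>2 \<le> 2 * (t - s)" by simp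
  \<comment> \<open>\<open>3/2\<close> exceeds the square root of 2 and leaves \<open>1/2\<close>
    for the drift, so that the total is 2.\<close>
  moreover have "(3/2 * sqrt (t - s))\<^sup>2 = 9/4 * (t - s)"
    unfolding power_mult_distrib using st by (simp add: power2_eq_square)
  ultimately have "(l2 Z)\<^sup>2 \<le> (3/2 * sqrt (t - s))\<^sup>2" using st by simp
  then have Z1: "l2 Z \<le> 3/2 * sqrt (t - s)" by (rule power2_le_imp_le) (use st in simp)
  have "(t - s)\<^sup>2 \<le> t - s"
    using mult_left_mono[of "t - s" 1 "t - s"] st by (simp add: power2_eq_square)
  then have "t - s \<le> sqrt (t - s)" by (rule real_le_rsqrt)
  then have "l2 E \<le> sqrt (t - s)" using l2_drift_le[OF st(1) st' ZE(3) E] by simp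
  moreover have "l2 (Y t - Y s) \<le> l2 Z + 1/2 * l2 E"
    using l2_triangle_diff[of "\<i> *\<^sub>C Z" "(1/2) *\<^sub>C E"] l2_scaleC[OF ZE(2), of \<i>] l2_scaleC[OF ZE(3), of "1/2"] ZE
    by simp
  ultimately show ?thesis using Z1 by linarith
qed (use st in simp)

text \<open>With h for the step, the crude estimate makes the integral of
  \<open>(l2 (Y r - Y s)) ^ 2\<close> at most \<open>4 * h ^ 2\<close>. Comparison with the constant
  integrand \<open>Y s\<close> then gives an error of at most \<open>3 * h\<close> for the
  stochastic part, to which the drift adds \<open>h / 2\<close>. In the second claim the stochastic
  part has trace zero against \<open>B\<close>, and only the variation of the drift remains.\<close>

lemma
  assumes st: "0 \<le> s" "s < t" "t \<le> s + 1"
  shows l2_increment_approx: "l2 (Y t - Y s - \<i> *\<^sub>C (Y s * inc s t)) \<le> 4 * (t - s)"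
    and tau_increment: "B \<in> F s \<Longrightarrow> norm B \<le> 1 \<Longrightarrow>
      cmod (\<tau> (B * (Y t - Y s)) + of_real ((t - s) / 2) * \<tau> (B * Y s)) \<le> (t - s) * sqrt (t - s)"
proof -
  define h where "h = t - s"
  have h: "h > 0" "h \<le> 1" using st by (simp_all add: h_def)
  have Wt: "Y s \<in> M" "Y t \<in> M" "inc s t \<in> M" using st by auto
  obtain Z E where ZE: "Y t - Y s = \<i> *\<^sub>C Z - (1/2) *\<^sub>C E" "Z \<in> M" "E \<in> M"
    and Z0: "\<And>B. B \<in> F s \<Longrightarrow> \<tau> (B * Z) = 0"
    and Z: "\<And>B I. B \<in> F s \<Longrightarrow> ((\<lambda>r. (l2 (Y r - B))\<^sup>2) has_integral I) {s..t} \<Longrightarrow> (l2 (Z - B * inc s t))\<^sup>2 \<le> 2 * I"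
    and E: "\<And>B. B \<in> M \<Longrightarrow> ((\<lambda>r. \<tau> (B * Y r)) has_integral \<tau> (B * E)) {s..t}"
    by (rule increment[OF st(1,2)]) (rule that; assumption)
  have close: "l2 (Y r - Y s) \<le> 2 * sqrt h" if "r \<in> {s..t}" for r
  proof -
    have "l2 (Y r - Y s) \<le> 2 * sqrt (r - s)" using that st by (intro l2_increment_le) auto
    also have "\<dots> \<le> 2 * sqrt h" using that by (simp add: h_def)
    finally show ?thesis .
  qed
  \<comment> \<open>For unitaries the squared distance is
    \<open>2 - 2 * Re (\<tau> (star (Y s) * Y r))\<close>. So it is integrable and its integral is
    expressed through the drift tested with \<open>star (Y s)\<close>.\<close>
  define I where "I = 2 * h - 2 * Re (\<tau> (star (Y s) * E))"
  have "((\<lambda>r. 2 - 2 * Re (\<tau> (star (Y s) * Y r))) has_integral I) {s..t}"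
    using has_integral_diff[OF has_integral_const_real[of "2::real" s t]
        has_integral_mult_right[OF has_integral_linear[OF E[of "star (Y s)"] bounded_linear_Re], of 2]] st
    by (simp add: I_def h_def comp_def algebra_simps)
  moreover have "2 - 2 * Re (\<tau> (star (Y s) * Y r)) = (l2 (Y r - Y s))\<^sup>2" if "r \<in> {s..t}" for r
  proof -
    have "(l2 (- Y s + Y r))\<^sup>2 = 2 - 2 * Re (\<tau> (star (Y s) * Y r))"
      using that st by (subst l2_add_sq) (auto simp: star_minus)
    then show ?thesis by simp
  qed
  ultimately have int: "((\<lambda>r. (l2 (Y r - Y s))\<^sup>2) has_integral I) {s..t}"
    by (rule has_integral_eq[rotated])
  have "I \<le> 4 * h * h"
  proof (rule has_integral_le[OF int])
    show "((\<lambda>r. 4 * h) has_integral 4 * h * h) {s..t}"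
      using has_integral_const_real[of "4 * h" s t] st by (simp add: h_def mult.commute)
    show "(l2 (Y r - Y s))\<^sup>2 \<le> 4 * h" if "r \<in> {s..t}" for r
    proof -
      have "(l2 (Y r - Y s))\<^sup>2 \<le> (2 * sqrt h)\<^sup>2"
        using close[OF that] that st by (intro power_mono) auto
      then show ?thesis using h by (simp add: power_mult_distrib)
    qed
  qed
  then have "(l2 (Z - Y s * inc s t))\<^sup>2 \<le> 8 * (h * h)"
    using Z[OF Y_adapted[OF st(1)] int] by simp
  also have "\<dots> \<le> (3 * h)\<^sup>2" by (simp add: power2_eq_square)
  finally have Zh: "l2 (Z - Y s * inc s t) \<le> 3 * h"
    by (rule power2_le_imp_le) (use h in simp)
  have Eh: "l2 E \<le> h" using l2_drift_le[OF st(1,2) ZE(3) E] by (simp add: h_def)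
  have ZM: "Z - Y s * inc s t \<in> M" using ZE Wt by auto
  have "Y t - Y s - \<i> *\<^sub>C (Y s * inc s t) = \<i> *\<^sub>C (Z - Y s * inc s t) - (1/2) *\<^sub>C E"
    unfolding ZE(1) scaleC_diff_right by (simp only: algebra_simps)
  then have "l2 (Y t - Y s - \<i> *\<^sub>C (Y s * inc s t)) \<le> l2 (Z - Y s * inc s t) + 1/2 * l2 E"
    using l2_triangle_diff[OF M_scaleC[OF ZM, of \<i>] M_scaleC[OF ZE(3), of "1/2"]]
      l2_scaleC[OF ZM, of \<i>] l2_scaleC[OF ZE(3), of "1/2"] by simp
  then show "l2 (Y t - Y s - \<i> *\<^sub>C (Y s * inc s t)) \<le> 4 * (t - s)"
    using Zh Eh h unfolding h_def[symmetric] by linarith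
  assume B: "B \<in> F s" "norm B \<le> 1"
  have BM: "B \<in> M" using B st by simp
  have "\<tau> (B * (Y t - Y s)) = - (1/2) * \<tau> (B * E)"
    unfolding ZE(1) using Z0[OF B(1)] ZE BM by (simp add: right_diff_distrib)
  moreover have bound: "cmod (\<tau> (B * E) - of_real h * \<tau> (B * Y s)) \<le> 2 * sqrt h * measure lborel {s..t}"
  proof (rule has_integral_bound_real[OF _ finite.emptyI])
    show "((\<lambda>r. \<tau> (B * Y r) - \<tau> (B * Y s)) has_integral (\<tau> (B * E) - of_real h * \<tau> (B * Y s))) {s..t}"
      using has_integral_diff[OF E[OF BM] has_integral_const_real[of "\<tau> (B * Y s)" s t]] st
      by (simp add: h_def scaleR_conv_of_real)
    show "cmod (\<tau> (B * Y r) - \<tau> (B * Y s)) \<le> 2 * sqrt h" if "r \<in> {s..t} - {}" for r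
    proof -
      from that have r: "r \<in> {s..t}" by simp
      then have rM: "Y r - Y s \<in> M" using st by simp
      have "cmod (\<tau> (B * (Y r - Y s))) \<le> l2 (Y r - Y s)"
        using cmod_tau_le[OF M_mult[OF BM rM]] l2_contraction_left[OF BM rM B(2)] by simp
      then show ?thesis using close[OF r] BM Wt r st by (simp add: right_diff_distrib)
    qed
  qed (use h in simp)
  moreover have "\<tau> (B * (Y t - Y s)) + of_real (h / 2) * \<tau> (B * Y s)
      = - (1/2) * (\<tau> (B * E) - of_real h * \<tau> (B * Y s))"
    unfolding calculation(1) by (simp add: field_simps)
  ultimately have "cmod (\<tau> (B * (Y t - Y s)) + of_real (h / 2) * \<tau> (B * Y s))
      = 1/2 * cmod (\<tau> (B * E) - of_real h * \<tau> (B * Y s))"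
    by (simp only: norm_mult) simp
  also have "\<dots> \<le> 1/2 * (2 * sqrt h * h)"
    using bound st by (intro mult_left_mono) (auto simp: h_def)
  finally show "cmod (\<tau> (B * (Y t - Y s)) + of_real ((t - s) / 2) * \<tau> (B * Y s)) \<le> (t - s) * sqrt (t - s)"
    by (simp add: h_def mult.commute)
qed

lemma l2_inc: assumes "0 \<le> s" "s < t" shows "l2 (inc s t) = sqrt (t - s)"
proof (rule power2_eq_imp_eq)
  show "(l2 (inc s t))\<^sup>2 = (sqrt (t - s))\<^sup>2"
    using assms inc_moments(2)[OF assms] by (simp add: l2_sq star_diff)
qed (use assms in auto)

text \<open>By cyclicity the square of the left side is the trace of
  \<open>(star K * x ^ 2) * (K * x ^ 2)\<close>, so a contraction \<open>K\<close> between the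
  increments does no harm and the fourth moment bounds everything.\<close>

lemma l2_inc_mult_inc:
  assumes st: "0 \<le> s" "s < t" and K: "K \<in> M" "norm K \<le> 1"
  shows "l2 (inc s t * K * inc s t) \<le> 2 * (t - s)"
proof -
  define x where "x = inc s t"
  have x: "x \<in> M" "star x = x" using st by (simp_all add: x_def star_diff)
  have sK: "norm (star K) \<le> 1" using K norm_star_le[of K] by simp
  have xx: "l2 (x * x) \<le> 2 * (t - s)"
  proof (rule power2_le_imp_le)
    have "(l2 (x * x))\<^sup>2 = Re (\<tau> (x ^ 4))"
      using x by (simp add: l2_sq star_mult power4_eq_xxxx mult.assoc)
    then show "(l2 (x * x))\<^sup>2 \<le> (2 * (t - s))\<^sup>2"
      using inc_moments(3)[OF st] by (simp only: x_def power_mult_distrib) simp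
  qed (use st in simp)
  have "\<tau> (star (x * K * x) * (x * K * x)) = \<tau> (x * (star K * (x * x) * K * x))"
    using x by (simp add: star_mult mult.assoc)
  also have "\<dots> = \<tau> ((star K * (x * x)) * (K * (x * x)))"
    using x K by (subst tau_commute) (auto simp: mult.assoc)
  finally have "(l2 (x * K * x))\<^sup>2 = Re (\<tau> ((star K * (x * x)) * (K * (x * x))))"
    using x K by (simp add: l2_sq)
  also have "\<dots> \<le> l2 (star K * (x * x)) * l2 (K * (x * x))"
    using x K by (intro order_trans[OF complex_Re_le_cmod] cmod_tau_mult_le) auto
  also have "\<dots> \<le> l2 (x * x) * l2 (x * x)"
    using x K sK by (intro mult_mono l2_contraction_left) auto
  finally have "(l2 (x * K * x))\<^sup>2 \<le> (l2 (x * x))\<^sup>2" by (simp only: power2_eq_square)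
  then have "l2 (x * K * x) \<le> l2 (x * x)" by (rule power2_le_imp_le) (use x in simp)
  then show ?thesis using xx by (simp add: x_def)
qed

end

section \<open>The moments of the free unitary Brownian motion\<close>

lemma power_diff_telescope:
  fixes V W :: "'h::complex_hilbert_space cop"
  shows "V ^ k - W ^ k = (\<Sum>a<k. W ^ a * (V - W) * V ^ (k - 1 - a))"
proof (induction k)
  case (Suc k)
  have "(\<Sum>a<Suc k. W ^ a * (V - W) * V ^ (Suc k - 1 - a))
      = (\<Sum>a<k. W ^ a * (V - W) * V ^ (k - 1 - a)) * V + W ^ k * (V - W)"
  proof -
    have "W ^ a * (V - W) * V ^ (Suc k - 1 - a) = W ^ a * (V - W) * V ^ (k - 1 - a) * V" if "a < k" for a
    proof -
      have "Suc k - 1 - a = Suc (k - 1 - a)" using that by simp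
      then show ?thesis by (simp only: power_Suc2 mult.assoc)
    qed
    then show ?thesis by (simp add: sum_distrib_right)
  qed
  also have "\<dots> = (V ^ k - W ^ k) * V + W ^ k * (V - W)"
    by (simp only: Suc.IH)
  also have "\<dots> = V ^ Suc k - W ^ Suc k"
    by (simp add: algebra_simps power_Suc2 del: power_Suc)
  finally show ?case by simp
qed simp

text \<open>A given \<open>c\<close> occurs once for each \<open>a < k - 1 - c\<close>.\<close>

lemma sum_triangle_count:
  fixes f :: "nat \<Rightarrow> complex"
  shows "(\<Sum>a<k. \<Sum>c<k - 1 - a. f c) = (\<Sum>c<k. of_nat (k - 1 - c) * f c)"
proof (induction k)
  case (Suc k)
  have "(\<Sum>a<Suc k. \<Sum>c<Suc k - 1 - a. f c) = (\<Sum>c<k. f c) + (\<Sum>a<k. \<Sum>c<k - 1 - a. f c)"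
    by (subst sum.lessThan_Suc_shift) simp
  also have "\<dots> = (\<Sum>c<k. f c + of_nat (k - 1 - c) * f c)"
    unfolding Suc.IH by (simp add: sum.distrib)
  also have "\<dots> = (\<Sum>c<k. of_nat (Suc k - 1 - c) * f c)"
  proof (rule sum.cong)
    fix c assume "c \<in> {..<k}"
    then have "Suc k - 1 - c = Suc (k - 1 - c)" by auto
    then show "f c + of_nat (k - 1 - c) * f c = of_nat (Suc k - 1 - c) * f c"
      by (simp add: algebra_simps)
  qed simp
  finally show ?case by simp
qed simp

text \<open>Increments are compared with the slope at their left end point, since that is where the
  other factors are adapted. For a backward difference the slope at \<open>x < t\<close> is
  exchanged for the one at \<open>t\<close> by continuity of \<open>D\<close>.\<close>

lemma has_vector_derivative_from_increments:
  fixes f D :: "real \<Rightarrow> complex"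
  assumes incr: "\<And>s t. 0 \<le> s \<Longrightarrow> s < t \<Longrightarrow> t \<le> s + 1 \<Longrightarrow>
      cmod (f t - f s - of_real (t - s) * D s) \<le> C * ((t - s) * sqrt (t - s))"
    and cont: "continuous_on {0..} D" and C: "C \<ge> 0" and t: "0 \<le> t"
  shows "(f has_vector_derivative D t) (at t within {0..})"
  unfolding has_vector_derivative_def has_derivative_within_alt
proof (intro conjI allI impI)
  fix e :: real assume e: "e > 0"
  obtain d where d: "d > 0" "\<And>x. 0 \<le> x \<Longrightarrow> \<bar>x - t\<bar> < d \<Longrightarrow> cmod (D x - D t) < e / 2"
    using cont t e unfolding continuous_on_iff dist_norm real_norm_def
    by (metis atLeast_iff half_gt_zero)
  \<comment> \<open>The last bound makes \<open>C * sqrt h \<le> e / 2\<close>; \<open>C + 1\<close>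
    keeps the denominator positive.\<close>
  define \<delta> where "\<delta> = min (min 1 d) ((e / (2 * (C + 1)))\<^sup>2)"
  have \<delta>: "\<delta> > 0" using d(1) e C by (simp add: \<delta>_def)
  have "norm (f x - f t - (x - t) *\<^sub>R D t) \<le> e * norm (x - t)" if x: "x \<in> {0..}" "norm (x - t) < \<delta>" for x
  proof -
    define h where "h = \<bar>x - t\<bar>"
    have h: "0 \<le> h" "h \<le> 1" "h < d" "h < (e / (2 * (C + 1)))\<^sup>2"
      using x by (auto simp: h_def \<delta>_def)
    have "sqrt h \<le> sqrt ((e / (2 * (C + 1)))\<^sup>2)"
      using h(4) by (intro real_sqrt_le_mono) simp
    also have "\<dots> = e / (2 * (C + 1))"
      using e C by simp
    finally have "C * sqrt h \<le> C * (e / (2 * (C + 1)))"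
      using C by (rule mult_left_mono)
    also have "\<dots> \<le> e / 2" using e C by (simp add: field_simps)
    finally have Ch: "C * (h * sqrt h) \<le> e / 2 * h"
      using mult_right_mono[OF _ h(1)] by (metis mult.assoc mult.commute)
    consider "x = t" | "x > t" | "x < t" by linarith
    then show ?thesis
    proof cases
      case 2
      then have "cmod (f x - f t - of_real (x - t) * D t) \<le> C * (h * sqrt h)"
        using incr[of t x] t h by (simp add: h_def)
      also have "\<dots> \<le> e / 2 * h" by (rule Ch)
      also have "\<dots> \<le> e * h" using e h by (intro mult_right_mono) auto
      finally show ?thesis by (simp add: scaleR_conv_of_real h_def)
    next
      case 3
      have "cmod (f t - f x - of_real (t - x) * D x) \<le> C * (h * sqrt h)"
        using incr[of x t] x 3 h by (simp add: h_def)
      also have "\<dots> \<le> e / 2 * h" by (rule Ch)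
      finally have 1: "cmod (f t - f x - of_real (t - x) * D x) \<le> e / 2 * h" .
      have "cmod (of_real (t - x) * (D x - D t)) = h * cmod (D x - D t)"
        using 3 unfolding norm_mult norm_of_real by (simp add: h_def)
      also have "\<dots> \<le> h * (e / 2)"
        using d(2)[of x] x h by (intro mult_left_mono) (auto simp: h_def)
      finally have 2: "cmod (of_real (t - x) * (D x - D t)) \<le> e / 2 * h" by (simp only: mult.commute)
      have "f x - f t - (x - t) *\<^sub>R D t
          = - (f t - f x - of_real (t - x) * D x) - of_real (t - x) * (D x - D t)"
        by (simp add: scaleR_conv_of_real algebra_simps)
      then have "norm (f x - f t - (x - t) *\<^sub>R D t)
          \<le> cmod (f t - f x - of_real (t - x) * D x) + cmod (of_real (t - x) * (D x - D t))"
        using norm_triangle_ineq4[of "- (f t - f x - of_real (t - x) * D x)" "of_real (t - x) * (D x - D t)"]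
        by (simp only: norm_minus_cancel)
      also have "\<dots> \<le> e / 2 * h + e / 2 * h" using 1 2 by (rule add_mono)
      finally show ?thesis by (simp add: h_def)
    qed simp
  qed
  then show "\<exists>d>0. \<forall>y\<in>{0..}. norm (y - t) < d \<longrightarrow> norm (f y - f t - (y - t) *\<^sub>R D t) \<le> e * norm (y - t)"
    using \<delta> by blast
qed (rule bounded_linear_scaleR_left)

section \<open>Traces of words with several increments\<close>

context free_ubm
begin

lemma norm_increment_le: "0 \<le> s \<Longrightarrow> 0 \<le> t \<Longrightarrow> norm (Y t - Y s) \<le> 2"
  using norm_triangle_ineq4[of "Y t" "Y s"] norm_Y[of s] norm_Y[of t] by simp

lemma norm_mult_le_two: "norm A \<le> 1 \<Longrightarrow> norm D \<le> 2 \<Longrightarrow> norm (A * D) \<le> 2" for A D :: "'h cop"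
  using norm_mult_ineq[of A D] mult_mono[of "norm A" 1 "norm D" 2] by simp

context
  fixes s t :: real
  assumes st: "0 \<le> s" "s < t" "t \<le> s + 1"
begin

text \<open>The increment \<open>\<Delta>\<close> is split as \<open>x + \<epsilon>\<close> with the
  explicit martingale part \<open>x = \<i> *\<^sub>C (W * \<xi>)\<close> of L2 size
  \<open>sqrt h\<close> and a remainder \<open>\<epsilon>\<close> of L2 size
  \<open>4 * h\<close>.\<close>

private definition "h = t - s"
private definition "W = Y s"
private definition "\<Delta> = Y t - Y s"
private definition "\<xi> = inc s t"
private definition "x = \<i> *\<^sub>C (W * \<xi>)"
private definition "\<epsilon> = \<Delta> - x"

private lemma h: "0 < h" "h \<le> 1" "0 \<le> sqrt h" "h * h \<le> h * sqrt h"
proof -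
  show 1: "0 < h" "h \<le> 1" "0 \<le> sqrt h" using st by (simp_all add: h_def)
  have "h\<^sup>2 \<le> h" using 1 mult_left_mono[of h 1 h] by (simp add: power2_eq_square)
  then have "h \<le> sqrt h" by (rule real_le_rsqrt)
  then show "h * h \<le> h * sqrt h" using 1 by (intro mult_left_mono) auto
qed

private lemma in_M [simp]: "W \<in> M" "\<Delta> \<in> M" "\<xi> \<in> M" "x \<in> M" "\<epsilon> \<in> M"
  using st by (simp_all add: W_def \<Delta>_def \<xi>_def x_def \<epsilon>_def)

private lemma W_F: "W \<in> F s" using st Y_adapted by (simp add: W_def)

private lemma norm_W: "norm W \<le> 1" using st norm_Y by (simp add: W_def)

private lemma split: "\<Delta> = x + \<epsilon>" by (simp add: \<epsilon>_def)

private lemma l2_eps: "l2 \<epsilon> \<le> 4 * h"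
  using l2_increment_approx[OF st] by (simp add: \<epsilon>_def x_def W_def \<xi>_def h_def \<Delta>_def)

private lemma l2_Delta: "l2 \<Delta> \<le> 2 * sqrt h"
  using l2_increment_le[of s t] st by (simp add: \<Delta>_def h_def)

private lemma norm_Delta: "norm \<Delta> \<le> 2"
  using norm_increment_le st by (simp add: \<Delta>_def)

private lemma l2_x: "l2 x \<le> sqrt h"
proof -
  have "l2 x = l2 (W * \<xi>)" unfolding x_def by (subst l2_scaleC) auto
  also have "\<dots> \<le> l2 \<xi>" by (intro l2_contraction_left norm_W) auto
  also have "l2 \<xi> = sqrt h" using st by (simp add: \<xi>_def h_def l2_inc)
  finally show ?thesis .
qed

private lemma l2_xBx: assumes "B \<in> M" "norm B \<le> 1" shows "l2 (x * B * x) \<le> 2 * h"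
proof -
  have "x * B * x = (- 1) *\<^sub>C (W * (\<xi> * (B * W) * \<xi>))"
    by (simp add: x_def mult.assoc scaleC_scaleC)
  then have "l2 (x * B * x) = l2 (W * (\<xi> * (B * W) * \<xi>))"
    using assms by (simp add: l2_scaleC)
  also have "\<dots> \<le> l2 (\<xi> * (B * W) * \<xi>)"
    using assms by (intro l2_contraction_left norm_W) auto
  also have "\<dots> \<le> 2 * h"
    unfolding \<xi>_def h_def using st assms by (intro l2_inc_mult_inc norm_mult_le_one norm_W) auto
  finally show ?thesis .
qed

private lemma cmod_tau_mult_le':
  assumes "A \<in> M" "B \<in> M" "l2 A \<le> a" "l2 B \<le> b"
  shows "cmod (\<tau> (A * B)) \<le> a * b"
proof -
  have "cmod (\<tau> (A * B)) \<le> l2 A * l2 B" using assms by (intro cmod_tau_mult_le)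
  also have "\<dots> \<le> a * b" using assms by (intro mult_mono) (auto intro: order_trans[OF l2_nonneg])
  finally show ?thesis .
qed

private lemma l2_left: "A \<in> M \<Longrightarrow> norm A \<le> 1 \<Longrightarrow> D \<in> M \<Longrightarrow> l2 D \<le> c \<Longrightarrow> l2 (A * D) \<le> c"
  using l2_contraction_left order_trans by blast

text \<open>The main term is that with \<open>x\<close> in both places: freeness evaluates it, and
  \<open>\<i> ^ 2\<close> gives the sign. The two terms with a factor \<open>\<epsilon>\<close>
  contribute \<open>8 + 4 = 12\<close> by Cauchy-Schwarz.\<close>

lemma second_order_increment:
  assumes A: "A \<in> F s" "norm A \<le> 1" and B: "B \<in> F s" "norm B \<le> 1"
  shows "cmod (\<tau> (A * (Y t - Y s) * B * (Y t - Y s)) + of_real (t - s) * (\<tau> (A * Y s) * \<tau> (B * Y s)))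
    \<le> 12 * ((t - s) * sqrt (t - s))"
proof -
  have AM [simp]: "A \<in> M" and BM [simp]: "B \<in> M" using A B st by auto
  have "A * x * B * x = (- 1) *\<^sub>C ((A * W) * \<xi> * (B * W) * \<xi>)"
    by (simp add: x_def mult.assoc scaleC_scaleC)
  also have "\<tau> \<dots> = - (of_real h * (\<tau> (A * W) * \<tau> (B * W)))"
    using tau_mult_inc_mult_inc[of s t "A * W" "B * W"] A B W_F st
    by (simp add: F_mult \<xi>_def[symmetric] h_def mult.commute)
  finally have main: "\<tau> (A * x * B * x) = - (of_real h * (\<tau> (A * W) * \<tau> (B * W)))" .
  have "A * \<Delta> * B * \<Delta> = A * x * B * x + (A * \<epsilon>) * (B * \<Delta>) + (A * x) * (B * \<epsilon>)"
    by (simp add: split algebra_simps)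
  then have "\<tau> (A * \<Delta> * B * \<Delta>) + of_real h * (\<tau> (A * W) * \<tau> (B * W))
      = \<tau> ((A * \<epsilon>) * (B * \<Delta>)) + \<tau> ((A * x) * (B * \<epsilon>))"
    using main by simp
  also have "cmod \<dots> \<le> 4 * h * (2 * sqrt h) + sqrt h * (4 * h)"
    by (intro order_trans[OF norm_triangle_ineq] add_mono cmod_tau_mult_le' l2_left A B l2_eps l2_Delta l2_x) auto
  also have "\<dots> = 12 * (h * sqrt h)" by simp
  finally show ?thesis by (simp only: h_def W_def \<Delta>_def)
qed

text \<open>Cauchy-Schwarz takes care of two L2 factors only, so with three increments another bound
  is needed: \<open>x * B * x\<close> is treated as a single factor of L2 size \<open>2 * h\<close>,
  and elsewhere one \<open>\<Delta>\<close> is estimated by its norm 2. With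
  \<open>h * h \<le> h * sqrt h\<close> the constants add up to \<open>2 + 8 + 8 + 16 = 34\<close>.
  No adaptedness is assumed, which allows factors depending on \<open>Y t\<close>.\<close>

lemma third_order_increment:
  assumes A: "A \<in> M" "norm A \<le> 1" and B: "B \<in> M" "norm B \<le> 1" and C: "C \<in> M" "norm C \<le> 1"
  shows "cmod (\<tau> (A * (Y t - Y s) * B * (Y t - Y s) * C * (Y t - Y s))) \<le> 34 * ((t - s) * sqrt (t - s))"
proof -
  have eq: "A * \<Delta> * B * \<Delta> * C * \<Delta> = (A * (x * B * x)) * (C * x) + (A * \<epsilon>) * (B * (x * C * x))
      + (A * \<Delta> * (B * \<epsilon>)) * (C * x) + ((A * \<Delta>) * (B * \<Delta>)) * (C * \<epsilon>)"
    by (simp add: split algebra_simps)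
  have 1: "cmod (\<tau> ((A * (x * B * x)) * (C * x))) \<le> 2 * h * sqrt h"
    by (intro cmod_tau_mult_le' l2_left A B C l2_xBx l2_x) (use A B C in auto)
  have 2: "cmod (\<tau> ((A * \<epsilon>) * (B * (x * C * x)))) \<le> 4 * h * (2 * h)"
    by (intro cmod_tau_mult_le' l2_left A B C l2_xBx l2_eps) (use A B C in auto)
  have "\<tau> ((A * \<Delta> * (B * \<epsilon>)) * (C * x)) = \<tau> (((C * x) * (A * \<Delta>)) * (B * \<epsilon>))"
    using A B C by (subst tau_commute) (auto simp: mult.assoc)
  moreover have "l2 ((C * x) * (A * \<Delta>)) \<le> sqrt h * 2"
  proof -
    have "l2 ((C * x) * (A * \<Delta>)) \<le> l2 (C * x) * norm (A * \<Delta>)"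
      using A C by (intro l2_mult_le_right) auto
    also have "\<dots> \<le> sqrt h * 2"
      using A C h by (intro mult_mono l2_left l2_x norm_mult_le_two norm_Delta) auto
    finally show ?thesis .
  qed
  ultimately have 3: "cmod (\<tau> ((A * \<Delta> * (B * \<epsilon>)) * (C * x))) \<le> sqrt h * 2 * (4 * h)"
    using A B C cmod_tau_mult_le'[of "(C * x) * (A * \<Delta>)" "B * \<epsilon>" "sqrt h * 2" "4 * h"]
      l2_left[of B \<epsilon> "4 * h"] l2_eps by simp
  have "l2 ((A * \<Delta>) * (B * \<Delta>)) \<le> 2 * (2 * sqrt h)"
  proof -
    have "l2 ((A * \<Delta>) * (B * \<Delta>)) \<le> norm (A * \<Delta>) * l2 (B * \<Delta>)"
      using A B by (intro l2_mult_le) auto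
    also have "\<dots> \<le> 2 * (2 * sqrt h)"
      using A B h by (intro mult_mono l2_left l2_Delta norm_mult_le_two norm_Delta) auto
    finally show ?thesis .
  qed
  then have 4: "cmod (\<tau> (((A * \<Delta>) * (B * \<Delta>)) * (C * \<epsilon>))) \<le> 2 * (2 * sqrt h) * (4 * h)"
    using A B C cmod_tau_mult_le'[of "(A * \<Delta>) * (B * \<Delta>)" "C * \<epsilon>" "2 * (2 * sqrt h)" "4 * h"]
      l2_left[of C \<epsilon> "4 * h"] l2_eps by simp
  have "cmod (\<tau> (A * \<Delta> * B * \<Delta> * C * \<Delta>)) \<le> 2 * h * sqrt h + 4 * h * (2 * h) + sqrt h * 2 * (4 * h)
      + 2 * (2 * sqrt h) * (4 * h)"
    unfolding eq using A B C
    by (simp only: tau_add M_add M_mult in_M) (intro order_trans[OF norm_triangle_ineq] add_mono 1 2 3 4)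
  also have "\<dots> \<le> 34 * (h * sqrt h)" using h(4) by (simp add: algebra_simps)
  finally show ?thesis by (simp only: h_def \<Delta>_def)
qed

end

section \<open>Differential equations for the moments of the unitary Brownian motion\<close>

definition q :: "nat \<Rightarrow> real \<Rightarrow> complex" where "q k t = \<tau> (Y t ^ k)"

text \<open>\<open>k - 1 - c\<close> is the number of pairs of letters in \<open>Y ^ k\<close> with
  exactly \<open>c\<close> letters between them; such a pair cuts the cyclic word into pieces with
  \<open>c + 1\<close> and \<open>k - 1 - c\<close> letters. For \<open>c = k - 1\<close> the
  coefficient is zero.\<close>

definition drift :: "nat \<Rightarrow> real \<Rightarrow> complex" where
  "drift k t = - (of_nat k / 2 * q k t) - (\<Sum>c<k. of_nat (k - 1 - c) * (q (Suc c) t * q (k - 1 - c) t))"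

text \<open>Telescoping \<open>V ^ k - W ^ k\<close> leaves powers of \<open>V = Y t\<close> on the
  right of the increment, which are not adapted at time \<open>s\<close>. They are telescoped again,
  up to three increments, where \<open>third_order_increment\<close> applies without adaptedness.
  The words with one and two increments then have powers of \<open>W\<close> only, and the nested
  constant collects 1, 12 and 34 from the three levels.\<close>

lemma moment_increment:
  assumes st: "0 \<le> s" "s < t" "t \<le> s + 1"
  shows "cmod (q k t - q k s - of_real (t - s) * drift k s)
    \<le> real k * (1 + real k * (12 + 34 * real k)) * ((t - s) * sqrt (t - s))"
proof -
  define h where "h = t - s"
  define \<eta> where "\<eta> = h * sqrt h"
  define V W where "V = Y t" and "W = Y s"
  define \<Delta> where "\<Delta> = V - W"
  have \<eta>: "\<eta> \<ge> 0" using st by (simp add: \<eta>_def h_def)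
  have M [simp]: "V \<in> M" "W \<in> M" "\<Delta> \<in> M" using st by (simp_all add: V_def W_def \<Delta>_def)
  have nV: "norm (V ^ n) \<le> 1" and nW: "norm (W ^ n) \<le> 1" for n
    unfolding V_def W_def using st by (intro norm_power_le_one norm_Y; simp)+
  have WF: "W ^ n \<in> F s" for n using st Y_adapted by (simp add: W_def F_power)
  have qW: "\<tau> (W ^ n) = q n s" for n by (simp add: W_def q_def)
  have V_pow: "V ^ n = W ^ n + (\<Sum>a<n. W ^ a * \<Delta> * V ^ (n - 1 - a))" for n
    using power_diff_telescope[of V n W] by (simp add: \<Delta>_def algebra_simps)
  have rot: "\<tau> (A * V ^ n) = \<tau> (V ^ n * A)" if "A \<in> M" for A n
    using that by (intro tau_commute) auto
  have rotW: "\<tau> (A * W ^ n) = \<tau> (W ^ n * A)" if "A \<in> M" for A n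
    using that by (intro tau_commute) auto
  have third: "cmod (\<tau> (W ^ a * \<Delta> * W ^ c * \<Delta> * (W ^ d * \<Delta> * V ^ e))) \<le> 34 * \<eta>" for a c d e
  proof -
    have "\<tau> (W ^ a * \<Delta> * W ^ c * \<Delta> * (W ^ d * \<Delta> * V ^ e)) = \<tau> ((V ^ e * W ^ a) * \<Delta> * W ^ c * \<Delta> * W ^ d * \<Delta>)"
      using rot[of "W ^ a * \<Delta> * W ^ c * \<Delta> * W ^ d * \<Delta>" e] by (simp add: mult.assoc)
    also have "cmod \<dots> \<le> 34 * \<eta>"
      unfolding \<Delta>_def V_def[symmetric] W_def[symmetric] \<eta>_def h_def
      using third_order_increment[OF st, of "V ^ e * W ^ a" "W ^ c" "W ^ d"] nV nW
      by (simp add: norm_mult_le_one V_def[symmetric] W_def[symmetric])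
    finally show ?thesis .
  qed
  have second: "cmod (\<tau> (W ^ a * \<Delta> * (W ^ c * \<Delta> * V ^ e)) + of_real h * (q (a + e + 1) s * q (c + 1) s))
      \<le> (12 + 34 * real e) * \<eta>" for a c e
  proof -
    have "\<tau> (W ^ a * \<Delta> * W ^ c * \<Delta> * V ^ e) = \<tau> (W ^ a * \<Delta> * W ^ c * \<Delta> * W ^ e)
        + (\<Sum>d<e. \<tau> (W ^ a * \<Delta> * W ^ c * \<Delta> * (W ^ d * \<Delta> * V ^ (e - 1 - d))))"
      by (subst V_pow) (simp add: distrib_left sum_distrib_left tau_sum M_sum)
    also have "\<tau> (W ^ a * \<Delta> * W ^ c * \<Delta> * W ^ e) = \<tau> (W ^ (e + a) * \<Delta> * W ^ c * \<Delta>)"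
      using rotW[of "W ^ a * \<Delta> * W ^ c * \<Delta>" e] by (simp add: power_add mult.assoc)
    finally have eq: "\<tau> (W ^ a * \<Delta> * (W ^ c * \<Delta> * V ^ e)) + of_real h * (q (a + e + 1) s * q (c + 1) s)
      = (\<tau> (W ^ (e + a) * \<Delta> * W ^ c * \<Delta>) + of_real h * (\<tau> (W ^ (e + a) * W) * \<tau> (W ^ c * W)))
        + (\<Sum>d<e. \<tau> (W ^ a * \<Delta> * W ^ c * \<Delta> * (W ^ d * \<Delta> * V ^ (e - 1 - d))))"
      by (simp add: mult.assoc qW power_Suc2[symmetric] add.commute del: power_Suc)
    have "cmod (\<tau> (W ^ (e + a) * \<Delta> * W ^ c * \<Delta>) + of_real h * (\<tau> (W ^ (e + a) * W) * \<tau> (W ^ c * W))) \<le> 12 * \<eta>"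
      unfolding \<Delta>_def V_def W_def \<eta>_def h_def
      using st by (intro second_order_increment WF[unfolded W_def] nW[unfolded W_def])
    moreover have "cmod (\<Sum>d<e. \<tau> (W ^ a * \<Delta> * W ^ c * \<Delta> * (W ^ d * \<Delta> * V ^ (e - 1 - d))))
        \<le> of_nat (card {..<e}) * (34 * \<eta>)"
      by (intro sum_norm_bound third)
    ultimately show ?thesis
      unfolding eq by (intro order_trans[OF norm_triangle_ineq]) (simp add: algebra_simps)
  qed
  have first: "cmod (\<tau> (W ^ a * \<Delta> * V ^ b) + of_real h * (1/2 * q (a + b + 1) s
      + (\<Sum>c<b. q (a + b - c) s * q (c + 1) s))) \<le> (1 + real b * (12 + 34 * real b)) * \<eta>" for a b
  proof -
    have "\<tau> (W ^ a * \<Delta> * V ^ b) = \<tau> (W ^ a * \<Delta> * W ^ b)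
        + (\<Sum>c<b. \<tau> (W ^ a * \<Delta> * (W ^ c * \<Delta> * V ^ (b - 1 - c))))"
      by (subst V_pow) (simp add: distrib_left sum_distrib_left tau_sum M_sum)
    also have "\<tau> (W ^ a * \<Delta> * W ^ b) = \<tau> (W ^ (b + a) * \<Delta>)"
      using rotW[of "W ^ a * \<Delta>" b] by (simp add: power_add mult.assoc)
    finally have eq: "\<tau> (W ^ a * \<Delta> * V ^ b) + of_real h * (1/2 * q (a + b + 1) s + (\<Sum>c<b. q (a + b - c) s * q (c + 1) s))
      = (\<tau> (W ^ (b + a) * \<Delta>) + of_real (h / 2) * \<tau> (W ^ (b + a) * W))
        + (\<Sum>c<b. \<tau> (W ^ a * \<Delta> * (W ^ c * \<Delta> * V ^ (b - 1 - c))) + of_real h * (q (a + b - c) s * q (c + 1) s))"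
      by (simp add: qW power_Suc2[symmetric] add.commute sum.distrib sum_distrib_left algebra_simps del: power_Suc)
    have "cmod (\<tau> (W ^ (b + a) * \<Delta>) + of_real (h / 2) * \<tau> (W ^ (b + a) * W)) \<le> \<eta>"
      unfolding \<Delta>_def V_def W_def \<eta>_def h_def
      using st by (intro tau_increment WF[unfolded W_def] nW[unfolded W_def])
    moreover have "cmod (\<Sum>c<b. \<tau> (W ^ a * \<Delta> * (W ^ c * \<Delta> * V ^ (b - 1 - c))) + of_real h * (q (a + b - c) s * q (c + 1) s))
        \<le> of_nat (card {..<b}) * ((12 + 34 * real b) * \<eta>)"
    proof (rule sum_norm_bound)
      fix c assume c: "c \<in> {..<b}"
      then have "a + (b - 1 - c) + 1 = a + b - c" by auto
      then have "cmod (\<tau> (W ^ a * \<Delta> * (W ^ c * \<Delta> * V ^ (b - 1 - c))) + of_real h * (q (a + b - c) s * q (c + 1) s))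
          \<le> (12 + 34 * real (b - 1 - c)) * \<eta>"
        using second[of a c "b - 1 - c"] by (simp only:)
      also have "\<dots> \<le> (12 + 34 * real b) * \<eta>"
        using \<eta> c by (intro mult_right_mono) auto
      finally show "cmod (\<tau> (W ^ a * \<Delta> * (W ^ c * \<Delta> * V ^ (b - 1 - c))) + of_real h * (q (a + b - c) s * q (c + 1) s))
          \<le> (12 + 34 * real b) * \<eta>" .
    qed
    ultimately show ?thesis
      unfolding eq by (intro order_trans[OF norm_triangle_ineq]) (simp add: algebra_simps)
  qed
  have "q k t = q k s + (\<Sum>a<k. \<tau> (W ^ a * \<Delta> * V ^ (k - 1 - a)))"
    using V_pow[of k] by (simp add: q_def V_def[symmetric] W_def[symmetric] tau_sum M_sum)
  moreover have "drift k s = - (\<Sum>a<k. 1/2 * q k s + (\<Sum>c<k - 1 - a. q (k - 1 - c) s * q (c + 1) s))"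
    unfolding drift_def sum_triangle_count[symmetric] sum.distrib
    by (simp add: mult.commute)
  ultimately have "q k t - q k s - of_real h * drift k s = (\<Sum>a<k. \<tau> (W ^ a * \<Delta> * V ^ (k - 1 - a)))
      + of_real h * (\<Sum>a<k. 1/2 * q k s + (\<Sum>c<k - 1 - a. q (k - 1 - c) s * q (c + 1) s))"
    by (simp only: mult_minus_right) simp
  then have eq: "q k t - q k s - of_real h * drift k s
      = (\<Sum>a<k. \<tau> (W ^ a * \<Delta> * V ^ (k - 1 - a))
          + of_real h * (1/2 * q k s + (\<Sum>c<k - 1 - a. q (k - 1 - c) s * q (c + 1) s)))"
    by (subst sum.distrib) (simp only: sum_distrib_left[symmetric])
  have "cmod (q k t - q k s - of_real h * drift k s) \<le> of_nat (card {..<k}) * ((1 + real k * (12 + 34 * real k)) * \<eta>)"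
    unfolding eq
  proof (rule sum_norm_bound)
    fix a assume a: "a \<in> {..<k}"
    then have "a + (k - 1 - a) + 1 = k" "a + (k - 1 - a) - c = k - 1 - c" for c by auto
    then have "cmod (\<tau> (W ^ a * \<Delta> * V ^ (k - 1 - a)) + of_real h * (1/2 * q k s + (\<Sum>c<k - 1 - a. q (k - 1 - c) s * q (c + 1) s)))
        \<le> (1 + real (k - 1 - a) * (12 + 34 * real (k - 1 - a))) * \<eta>"
      using first[of a "k - 1 - a"] by simp
    also have "\<dots> \<le> (1 + real k * (12 + 34 * real k)) * \<eta>"
      using \<eta> a by (intro mult_right_mono add_mono mult_mono) auto
    finally show "cmod (\<tau> (W ^ a * \<Delta> * V ^ (k - 1 - a)) + of_real h * (1/2 * q k s + (\<Sum>c<k - 1 - a. q (k - 1 - c) s * q (c + 1) s)))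
        \<le> (1 + real k * (12 + 34 * real k)) * \<eta>" .
  qed
  then show ?thesis by (simp add: h_def \<eta>_def mult.assoc)
qed

lemma q_lipschitz:
  assumes st: "0 \<le> s" "s \<le> t" "t \<le> s + 1"
  shows "cmod (q k t - q k s) \<le> real k * (2 * sqrt (t - s))"
proof -
  have M: "Y t \<in> M" "Y s \<in> M" using st by auto
  have "cmod (q k t - q k s) = cmod (\<Sum>a<k. \<tau> (Y s ^ a * (Y t - Y s) * Y t ^ (k - 1 - a)))"
    using M by (simp add: q_def tau_diff[symmetric] power_diff_telescope[of "Y t"] tau_sum del: tau_diff)
  also have "\<dots> \<le> of_nat (card {..<k}) * (2 * sqrt (t - s))"
  proof (rule sum_norm_bound)
    fix a
    have "cmod (\<tau> (Y s ^ a * (Y t - Y s) * Y t ^ (k - 1 - a))) \<le> l2 (Y s ^ a * (Y t - Y s) * Y t ^ (k - 1 - a))"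
      using M by (intro cmod_tau_le) auto
    also have "\<dots> \<le> l2 (Y s ^ a * (Y t - Y s))"
      using M st by (intro l2_contraction_right norm_power_le_one norm_Y) auto
    also have "\<dots> \<le> l2 (Y t - Y s)"
      using M st by (intro l2_contraction_left norm_power_le_one norm_Y) auto
    also have "\<dots> \<le> 2 * sqrt (t - s)" by (rule l2_increment_le[OF st])
    finally show "cmod (\<tau> (Y s ^ a * (Y t - Y s) * Y t ^ (k - 1 - a))) \<le> 2 * sqrt (t - s)" .
  qed
  finally show ?thesis by simp
qed

lemma continuous_on_q: "continuous_on {0..} (q k)"
  unfolding continuous_on_def
proof
  fix t :: real assume t: "t \<in> {0..}"
  show "(q k \<longlongrightarrow> q k t) (at t within {0..})"
  proof (rule Lim_transform_bound[of _ "\<lambda>x. real k * (2 * sqrt \<bar>x - t\<bar>)", THEN LIM_zero_cancel])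
    have "\<forall>\<^sub>F x in at t within {0..}. dist x t < 1 \<and> x \<in> {0..}"
      by (auto simp: eventually_at intro: exI[of _ 1])
    then show "\<forall>\<^sub>F x in at t within {0..}. cmod (q k x - q k t) \<le> norm (real k * (2 * sqrt \<bar>x - t\<bar>))"
    proof eventually_elim
      case (elim x)
      then show ?case
        using q_lipschitz[of x t k] q_lipschitz[of t x k] t
        by (cases "x \<le> t") (auto simp: dist_real_def norm_minus_commute)
    qed
    have "((\<lambda>x. real k * (2 * sqrt \<bar>x - t\<bar>)) \<longlongrightarrow> real k * (2 * sqrt \<bar>t - t\<bar>)) (at t within {0..})"
      by (intro tendsto_intros)
    then show "((\<lambda>x. real k * (2 * sqrt \<bar>x - t\<bar>)) \<longlongrightarrow> 0) (at t within {0..})" by simp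
  qed
qed

theorem q_has_derivative:
  assumes "0 \<le> t" shows "(q k has_vector_derivative drift k t) (at t within {0..})"
proof (rule has_vector_derivative_from_increments[OF moment_increment])
  show "continuous_on {0..} (drift k)"
    unfolding drift_def by (intro continuous_intros continuous_on_q)
qed (use assms in auto)

end

section \<open>Ito data\<close>

text \<open>
  An element \<open>A\<close> of the algebra generated by \<open>Y\<^sub>t\<close> and constants, together with its Ito data:
  \<open>dA = \<i> \<Sum> l dX r + gen dt\<close>, where \<open>(l, r)\<close> runs through the list \<open>grad\<close>.
\<close>

datatype 'a ito = Ito (val: 'a) (grad: "('a \<times> 'a) list") (gen: 'a)

context nc_space
begin

text \<open>The minus sign is the square of the factor \<open>\<i>\<close> that stands in front of
  both gradients.\<close>

definition carre :: "('h cop \<times> 'h cop) list \<Rightarrow> ('h cop \<times> 'h cop) list \<Rightarrow> 'h cop" where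
  "carre xs ys = - (\<Sum>(l, r)\<leftarrow>xs. \<Sum>(l', r')\<leftarrow>ys. \<tau> (r * l') *\<^sub>C (l * r'))"

text \<open>The Ito product rule: \<open>carre\<close> comes from \<open>dX B dX = \<tau>(B) dt\<close>.\<close>

definition ito_mult :: "'h cop ito \<Rightarrow> 'h cop ito \<Rightarrow> 'h cop ito"  (infixl "\<star>" 70) where
  "a \<star> b = Ito (val a * val b)
     (map (\<lambda>(l, r). (l, r * val b)) (grad a) @ map (\<lambda>(l, r). (val a * l, r)) (grad b))
     (gen a * val b + val a * gen b + carre (grad a) (grad b))"

definition ito_add :: "'h cop ito \<Rightarrow> 'h cop ito \<Rightarrow> 'h cop ito"  (infixl "\<oplus>" 65) where
  "a \<oplus> b = Ito (val a + val b) (grad a @ grad b) (gen a + gen b)"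

definition ito_wf :: "'h cop ito \<Rightarrow> bool" where
  "ito_wf a \<longleftrightarrow> val a \<in> M \<and> gen a \<in> M \<and> (\<forall>(l, r)\<in>set (grad a). l \<in> M \<and> r \<in> M)"

text \<open>Testing with all such maps replaces the construction of a tensor product. The test maps
  that matter are those sending a pair to a summand of \<open>carre\<close>, and compositions with
  multiplication on the outside.\<close>

definition bilin :: "('h cop \<Rightarrow> 'h cop \<Rightarrow> 'h cop) \<Rightarrow> bool" where
  "bilin f \<longleftrightarrow> (\<forall>l\<in>M. \<forall>l'\<in>M. \<forall>r\<in>M. f (l + l') r = f l r + f l' r) \<and>
     (\<forall>l\<in>M. \<forall>r\<in>M. \<forall>r'\<in>M. f l (r + r') = f l r + f l r') \<and>
     (\<forall>l\<in>M. \<forall>r\<in>M. \<forall>c. f (c *\<^sub>C l) r = c *\<^sub>C f l r \<and> f l (c *\<^sub>C r) = c *\<^sub>C f l r)"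

text \<open>The lists \<open>grad\<close> are compared as elements of the tensor square of \<open>M\<close>.\<close>

definition ito_eq :: "'h cop ito \<Rightarrow> 'h cop ito \<Rightarrow> bool"  (infix "\<simeq>" 50) where
  "a \<simeq> b \<longleftrightarrow> val a = val b \<and> gen a = gen b \<and>
     (\<forall>f. bilin f \<longrightarrow> (\<Sum>(l, r)\<leftarrow>grad a. f l r) = (\<Sum>(l, r)\<leftarrow>grad b. f l r))"

lemma ito_eq_refl [simp]: "a \<simeq> a" by (simp add: ito_eq_def)
lemma ito_eq_sym: "a \<simeq> b \<Longrightarrow> b \<simeq> a" by (simp add: ito_eq_def)
lemma ito_eq_trans [trans]: "a \<simeq> b \<Longrightarrow> b \<simeq> c \<Longrightarrow> a \<simeq> c" by (simp add: ito_eq_def)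

lemma bilin_left: "bilin f \<Longrightarrow> A \<in> M \<Longrightarrow> bilin (\<lambda>l r. f (A * l) r)"
  by (simp add: bilin_def distrib_left)

lemma bilin_right: "bilin f \<Longrightarrow> A \<in> M \<Longrightarrow> bilin (\<lambda>l r. f l (r * A))"
  by (simp add: bilin_def distrib_right)

lemma sum_list_swap:
  "(\<Sum>x\<leftarrow>xs. \<Sum>y\<leftarrow>ys. f x y) = (\<Sum>y\<leftarrow>ys. \<Sum>x\<leftarrow>xs. f x y)" for f :: "'b \<Rightarrow> 'c \<Rightarrow> 'h cop"
  by (induction xs) (simp_all add: sum_list_addf)

lemma carre_cong_right:
  assumes xs: "\<And>l r. (l, r) \<in> set xs \<Longrightarrow> l \<in> M \<and> r \<in> M"
    and eq: "\<And>f. bilin f \<Longrightarrow> (\<Sum>(l, r)\<leftarrow>ys. f l r) = (\<Sum>(l, r)\<leftarrow>zs. f l r)"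
  shows "carre xs ys = carre xs zs"
proof -
  have "(\<Sum>p\<leftarrow>ys. \<tau> (r * fst p) *\<^sub>C (l * snd p)) = (\<Sum>p\<leftarrow>zs. \<tau> (r * fst p) *\<^sub>C (l * snd p))"
    if "(l, r) \<in> set xs" for l r
  proof -
    have "bilin (\<lambda>l' r'. \<tau> (r * l') *\<^sub>C (l * r'))"
      using xs[OF that] by (simp add: bilin_def distrib_left scaleC_add_left scaleC_add_right scaleC_scaleC mult.commute)
    from eq[OF this] show ?thesis by (simp add: case_prod_unfold)
  qed
  then show ?thesis
    unfolding carre_def case_prod_unfold by (simp cong: map_cong)
qed

lemma carre_cong_left:
  assumes zs: "\<And>l r. (l, r) \<in> set zs \<Longrightarrow> l \<in> M \<and> r \<in> M"
    and eq: "\<And>f. bilin f \<Longrightarrow> (\<Sum>(l, r)\<leftarrow>xs. f l r) = (\<Sum>(l, r)\<leftarrow>ys. f l r)"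
  shows "carre xs zs = carre ys zs"
proof -
  have "(\<Sum>p\<leftarrow>xs. \<tau> (snd p * l) *\<^sub>C (fst p * r)) = (\<Sum>p\<leftarrow>ys. \<tau> (snd p * l) *\<^sub>C (fst p * r))"
    if "(l, r) \<in> set zs" for l r
  proof -
    have "bilin (\<lambda>l' r'. \<tau> (r' * l) *\<^sub>C (l' * r))"
      using zs[OF that] by (simp add: bilin_def distrib_right scaleC_add_left scaleC_add_right scaleC_scaleC mult.commute)
    from eq[OF this] show ?thesis by (simp add: case_prod_unfold)
  qed
  then show ?thesis
    unfolding carre_def case_prod_unfold
    by (subst (1 2) sum_list_swap) (simp cong: map_cong)
qed

lemma carre_append_left: "carre (xs @ ys) zs = carre xs zs + carre ys zs"
  by (simp add: carre_def)

lemma carre_append_right: "carre xs (ys @ zs) = carre xs ys + carre xs zs"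
  by (simp add: carre_def sum_list_addf case_prod_unfold)

lemma carre_Nil [simp]: "carre [] ys = 0" "carre xs [] = 0"
  by (simp_all add: carre_def case_prod_unfold)

lemma carre_mult_left: "carre (map (\<lambda>(l, r). (A * l, r)) xs) ys = A * carre xs ys"
  by (simp add: carre_def case_prod_unfold comp_def sum_list_const_mult[symmetric] mult.assoc)

lemma carre_mult_right: "carre xs (map (\<lambda>(l, r). (l, r * A)) ys) = carre xs ys * A"
  by (simp add: carre_def case_prod_unfold comp_def sum_list_mult_const[symmetric] mult.assoc)

lemma carre_mult_mid: "carre (map (\<lambda>(l, r). (l, r * A)) xs) ys = carre xs (map (\<lambda>(l, r). (A * l, r)) ys)"
  by (simp add: carre_def case_prod_unfold comp_def mult.assoc)

lemma carre_in_M: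
  assumes "\<And>l r. (l, r) \<in> set xs \<Longrightarrow> l \<in> M \<and> r \<in> M" "\<And>l r. (l, r) \<in> set ys \<Longrightarrow> l \<in> M \<and> r \<in> M"
  shows "carre xs ys \<in> M"
  unfolding carre_def using assms by (intro M_minus M_sum_list) (auto intro!: M_sum_list)

text \<open>An equality of data, not only up to \<open>\<simeq>\<close>: gradient lists are
  concatenated in the same order, and both sides contain the three contractions of two factors;
  \<open>carre_mult_mid\<close> matches the one between \<open>a\<close> and \<open>c\<close> across
  \<open>val b\<close>.\<close>

lemma ito_mult_assoc: "a \<star> b \<star> c = a \<star> (b \<star> c)"
  by (simp add: ito_mult_def carre_append_left carre_append_right carre_mult_left carre_mult_right
      carre_mult_mid comp_def case_prod_unfold mult.assoc algebra_simps
      carre_mult_left[unfolded case_prod_unfold] carre_mult_right[unfolded case_prod_unfold]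
      carre_mult_mid[unfolded case_prod_unfold])

lemma ito_wf_mult: "ito_wf a \<Longrightarrow> ito_wf b \<Longrightarrow> ito_wf (a \<star> b)"
  unfolding ito_wf_def ito_mult_def by (auto intro!: carre_in_M)

lemma ito_wf_add: "ito_wf a \<Longrightarrow> ito_wf b \<Longrightarrow> ito_wf (a \<oplus> b)"
  unfolding ito_wf_def ito_add_def by auto

lemma ito_wfD: "ito_wf a \<Longrightarrow> (l, r) \<in> set (grad a) \<Longrightarrow> l \<in> M \<and> r \<in> M"
  unfolding ito_wf_def by blast

lemma ito_mult_cong_right:
  assumes a: "ito_wf a" and eq: "b \<simeq> c"
  shows "a \<star> b \<simeq> a \<star> c"
proof -
  have "carre (grad a) (grad b) = carre (grad a) (grad c)"
    using eq by (intro carre_cong_right ito_wfD[OF a]) (auto simp: ito_eq_def)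
  moreover have "(\<Sum>(l, r)\<leftarrow>grad b. f (val a * l) r) = (\<Sum>(l, r)\<leftarrow>grad c. f (val a * l) r)" if "bilin f" for f
    using eq bilin_left[OF that, of "val a"] a by (auto simp: ito_eq_def ito_wf_def)
  ultimately show ?thesis
    using eq by (simp add: ito_eq_def ito_mult_def comp_def case_prod_unfold)
qed

lemma ito_mult_cong_left:
  assumes c: "ito_wf c" and eq: "a \<simeq> b"
  shows "a \<star> c \<simeq> b \<star> c"
proof -
  have "carre (grad a) (grad c) = carre (grad b) (grad c)"
    using eq by (intro carre_cong_left ito_wfD[OF c]) (auto simp: ito_eq_def)
  moreover have "(\<Sum>(l, r)\<leftarrow>grad a. f l (r * val c)) = (\<Sum>(l, r)\<leftarrow>grad b. f l (r * val c))" if "bilin f" for f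
    using eq bilin_right[OF that, of "val c"] c by (auto simp: ito_eq_def ito_wf_def)
  ultimately show ?thesis
    using eq by (simp add: ito_eq_def ito_mult_def comp_def case_prod_unfold)
qed

text \<open>Only up to \<open>\<simeq>\<close>: a gradient entry with right leg
  \<open>r * (val b + val c)\<close> corresponds to two entries on the other side.\<close>

lemma ito_distrib_left:
  assumes "ito_wf a" "ito_wf b" "ito_wf c"
  shows "a \<star> (b \<oplus> c) \<simeq> a \<star> b \<oplus> a \<star> c"
proof -
  have "(\<Sum>p\<leftarrow>grad a. f (fst p) (snd p * (val b + val c)))
    = (\<Sum>p\<leftarrow>grad a. f (fst p) (snd p * val b)) + (\<Sum>p\<leftarrow>grad a. f (fst p) (snd p * val c))"
    if f: "bilin f" for f
  proof -
    have "f (fst p) (snd p * (val b + val c)) = f (fst p) (snd p * val b) + f (fst p) (snd p * val c)"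
      if "p \<in> set (grad a)" for p
      using ito_wfD[OF assms(1), of "fst p" "snd p"] that f assms(2,3)
      by (simp add: distrib_left bilin_def ito_wf_def)
    then show ?thesis by (simp add: sum_list_addf[symmetric] cong: map_cong)
  qed
  then show ?thesis
    by (simp add: ito_eq_def ito_mult_def ito_add_def comp_def case_prod_unfold carre_append_right algebra_simps)
qed

lemma ito_distrib_right:
  assumes "ito_wf a" "ito_wf b" "ito_wf c"
  shows "(a \<oplus> b) \<star> c \<simeq> a \<star> c \<oplus> b \<star> c"
proof -
  have "(\<Sum>p\<leftarrow>grad c. f ((val a + val b) * fst p) (snd p))
    = (\<Sum>p\<leftarrow>grad c. f (val a * fst p) (snd p)) + (\<Sum>p\<leftarrow>grad c. f (val b * fst p) (snd p))"
    if f: "bilin f" for f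
  proof -
    have "f ((val a + val b) * fst p) (snd p) = f (val a * fst p) (snd p) + f (val b * fst p) (snd p)"
      if "p \<in> set (grad c)" for p
      using ito_wfD[OF assms(3), of "fst p" "snd p"] that f assms(1,2)
      by (simp add: distrib_right bilin_def ito_wf_def)
    then show ?thesis by (simp add: sum_list_addf[symmetric] cong: map_cong)
  qed
  then show ?thesis
    by (simp add: ito_eq_def ito_mult_def ito_add_def comp_def case_prod_unfold carre_append_left algebra_simps)
qed

definition ito_const :: "'h cop \<Rightarrow> 'h cop ito" where "ito_const A = Ito A [] 0"

text \<open>A differentiable scalar function at one instant: \<open>c\<close> is its value and
  \<open>c'\<close> its derivative.\<close>

definition ito_scalar :: "complex \<Rightarrow> complex \<Rightarrow> 'h cop ito" where
  "ito_scalar c c' = Ito (c *\<^sub>C 1) [] (c' *\<^sub>C 1)"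

lemma ito_wf_const [simp]: "A \<in> M \<Longrightarrow> ito_wf (ito_const A)"
  by (simp add: ito_wf_def ito_const_def)

lemma ito_wf_scalar [simp]: "ito_wf (ito_scalar c c')"
  by (simp add: ito_wf_def ito_scalar_def)

lemma ito_one_mult [simp]: "ito_const 1 \<star> a = a"
  by (cases a) (simp add: ito_const_def ito_mult_def case_prod_unfold)

lemma ito_mult_one [simp]: "a \<star> ito_const 1 = a"
  by (cases a) (simp add: ito_const_def ito_mult_def case_prod_unfold)

lemma ito_scalar_commute: "ito_wf a \<Longrightarrow> a \<star> ito_scalar c c' \<simeq> ito_scalar c c' \<star> a"
proof -
  assume a: "ito_wf a"
  have "(\<Sum>p\<leftarrow>grad a. f (fst p) (c *\<^sub>C snd p)) = (\<Sum>p\<leftarrow>grad a. f (c *\<^sub>C fst p) (snd p))" if "bilin f" for f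
    using that ito_wfD[OF a] by (intro arg_cong[of _ _ sum_list] map_cong) (auto simp: bilin_def)
  then show ?thesis
    by (simp add: ito_eq_def ito_mult_def ito_scalar_def comp_def case_prod_unfold)
qed

lemma ito_scalar_mult_scalar: "ito_scalar c c' \<star> ito_scalar d d' = ito_scalar (c * d) (c' * d + c * d')"
  by (simp add: ito_mult_def ito_scalar_def scaleC_scaleC scaleC_add_left mult.commute)

lemma ito_scalar_one: "ito_scalar 1 0 = ito_const 1"
  by (simp add: ito_scalar_def ito_const_def)

primrec ito_pow :: "'h cop ito \<Rightarrow> nat \<Rightarrow> 'h cop ito" where
  "ito_pow a 0 = ito_const 1"
| "ito_pow a (Suc n) = a \<star> ito_pow a n"

lemma val_pow: "val (ito_pow a n) = val a ^ n"
  by (induction n) (simp_all add: ito_const_def ito_mult_def)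

lemma ito_wf_pow: "ito_wf a \<Longrightarrow> ito_wf (ito_pow a n)"
  by (induction n) (simp_all add: ito_wf_mult)

definition ito_Y :: "'h cop \<Rightarrow> 'h cop ito" where
  "ito_Y U = Ito U [(U, 1)] ((- (1/2)) *\<^sub>C U)"

text \<open>The adjoint of the equation for \<open>Y\<close>: the increment now stands to the left
  of \<open>star U\<close>, and conjugating \<open>\<i>\<close> gives the minus sign, which is kept
  in the left leg.\<close>

definition ito_Ystar :: "'h cop \<Rightarrow> 'h cop ito" where
  "ito_Ystar U = Ito (star U) [(- 1, star U)] ((- (1/2)) *\<^sub>C star U)"

lemma ito_wf_Y [simp]: "U \<in> M \<Longrightarrow> ito_wf (ito_Y U)" "U \<in> M \<Longrightarrow> ito_wf (ito_Ystar U)"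
  by (simp_all add: ito_wf_def ito_Y_def ito_Ystar_def)

lemma bilin_minus: "bilin f \<Longrightarrow> l \<in> M \<Longrightarrow> r \<in> M \<Longrightarrow> f (- l) r = - f l r"
  unfolding bilin_def by (metis scaleC_minus1)

text \<open>The gradient entries \<open>(U, star U)\<close> and \<open>(- U, star U)\<close> cancel
  as tensors, and the contraction contributes 1 against two drifts of \<open>- 1/2\<close>.\<close>

lemma ito_Y_Ystar:
  assumes "U \<in> M" "U * star U = 1" shows "ito_Y U \<star> ito_Ystar U \<simeq> ito_const 1"
proof -
  have "(- (1/2)) *\<^sub>C 1 + (- (1/2)) *\<^sub>C 1 + 1 = (0 :: 'h cop)"
    by (simp add: scaleC_add_left[symmetric] del: scaleC_minus_left)
       (simp add: scaleC_add_left[of "1/2" "1/2" "1 :: 'h cop", symmetric])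
  then show ?thesis
    using assms by (simp add: ito_eq_def ito_mult_def ito_Y_def ito_Ystar_def ito_const_def carre_def bilin_minus)
qed

lemma ito_Ystar_Y:
  assumes "U \<in> M" "star U * U = 1" shows "ito_Ystar U \<star> ito_Y U \<simeq> ito_const 1"
proof -
  have "(- (1/2)) *\<^sub>C 1 + (- (1/2)) *\<^sub>C 1 + 1 = (0 :: 'h cop)"
    by (simp add: scaleC_add_left[symmetric] del: scaleC_minus_left)
       (simp add: scaleC_add_left[of "1/2" "1/2" "1 :: 'h cop", symmetric])
  then show ?thesis
    using assms by (simp add: ito_eq_def ito_mult_def ito_Y_def ito_Ystar_def ito_const_def carre_def bilin_minus)
qed

text \<open>The drift of \<open>A ^ n\<close> when \<open>A\<close> has gradient
  \<open>(A, 1)\<close> and drift \<open>- A / 2\<close>. The coefficients count pairs of letters as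
  in \<open>drift\<close>, which for \<open>A = Y t\<close> is the trace of this operator.\<close>

definition pow_gen :: "'h cop \<Rightarrow> nat \<Rightarrow> 'h cop" where
  "pow_gen A n = (- (of_nat n / 2)) *\<^sub>C A ^ n
     - (\<Sum>c<n. (of_nat (n - 1 - c) * \<tau> (A ^ Suc c)) *\<^sub>C A ^ (n - 1 - c))"

text \<open>The recursion has the shape of the product rule for \<open>A\<close> times
  \<open>A ^ n\<close>: in \<open>n - c = (n - 1 - c) + 1\<close> the summand 1 is the pair formed
  with the new first letter.\<close>

lemma pow_gen_Suc:
  "pow_gen A (Suc n) = (- (1/2)) *\<^sub>C A ^ Suc n + A * pow_gen A n - (\<Sum>c<n. \<tau> (A ^ Suc c) *\<^sub>C A ^ (n - c))"
proof -
  have "(\<Sum>c<Suc n. (of_nat (Suc n - 1 - c) * \<tau> (A ^ Suc c)) *\<^sub>C A ^ (Suc n - 1 - c))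
      = (\<Sum>c<n. (of_nat (n - c) * \<tau> (A ^ Suc c)) *\<^sub>C A ^ (n - c))"
    by simp
  also have "\<dots> = (\<Sum>c<n. A * ((of_nat (n - 1 - c) * \<tau> (A ^ Suc c)) *\<^sub>C A ^ (n - 1 - c)) + \<tau> (A ^ Suc c) *\<^sub>C A ^ (n - c))"
  proof (rule sum.cong)
    fix c assume "c \<in> {..<n}"
    then have n: "n - c = Suc (n - 1 - c)" by auto
    have "(of_nat (n - c) * \<tau> (A ^ Suc c)) *\<^sub>C A ^ (n - c)
        = (of_nat (n - 1 - c) * \<tau> (A ^ Suc c)) *\<^sub>C A ^ (n - c) + \<tau> (A ^ Suc c) *\<^sub>C A ^ (n - c)"
      by (subst n) (simp add: scaleC_add_left[symmetric] algebra_simps)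
    also have "A ^ (n - c) = A * A ^ (n - 1 - c)" by (subst n) simp
    finally show "(of_nat (n - c) * \<tau> (A ^ Suc c)) *\<^sub>C A ^ (n - c)
        = A * ((of_nat (n - 1 - c) * \<tau> (A ^ Suc c)) *\<^sub>C A ^ (n - 1 - c)) + \<tau> (A ^ Suc c) *\<^sub>C A ^ (n - c)"
      using n by simp
  qed simp
  also have "\<dots> = A * (\<Sum>c<n. (of_nat (n - 1 - c) * \<tau> (A ^ Suc c)) *\<^sub>C A ^ (n - 1 - c)) + (\<Sum>c<n. \<tau> (A ^ Suc c) *\<^sub>C A ^ (n - c))"
    by (simp only: sum.distrib sum_distrib_left)
  finally have 1: "(\<Sum>c<Suc n. (of_nat (Suc n - 1 - c) * \<tau> (A ^ Suc c)) *\<^sub>C A ^ (Suc n - 1 - c)) = \<dots>" .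
  have "(- (of_nat (Suc n) / 2)) *\<^sub>C A ^ Suc n = (- (1/2)) *\<^sub>C A ^ Suc n + A * ((- (of_nat n / 2)) *\<^sub>C A ^ n)"
    by (simp add: scaleC_add_left[symmetric] add_divide_distrib del: scaleC_minus_left)
  then show ?thesis
    unfolding pow_gen_def 1 right_diff_distrib by (simp add: algebra_simps del: scaleC_minus_left)
qed

lemma grad_pow_left:
  assumes "grad a = [(val a, 1)]"
  shows "grad (ito_pow a n) = map (\<lambda>j. (val a ^ Suc j, val a ^ (n - 1 - j))) [0..<n]"
proof (induction n)
  case (Suc n)
  have "[0..<Suc n] = 0 # map Suc [0..<n]" by (simp add: map_Suc_upt upt_conv_Cons del: upt_Suc)
  then show ?case
    using assms Suc by (simp add: ito_mult_def val_pow comp_def del: upt_Suc)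
qed (simp add: ito_const_def)

lemma gen_pow_left:
  assumes "grad a = [(val a, 1)]" "gen a = (- (1/2)) *\<^sub>C val a"
  shows "gen (ito_pow a n) = pow_gen (val a) n"
proof (induction n)
  case (Suc n)
  have "carre (grad a) (grad (ito_pow a n)) = - (\<Sum>j<n. \<tau> (val a ^ Suc j) *\<^sub>C (val a * val a ^ (n - 1 - j)))"
    unfolding grad_pow_left[OF assms(1)] assms(1) carre_def
    by (simp add: comp_def interv_sum_list_conv_sum_set_nat atLeast0LessThan)
  also have "(\<Sum>j<n. \<tau> (val a ^ Suc j) *\<^sub>C (val a * val a ^ (n - 1 - j))) = (\<Sum>j<n. \<tau> (val a ^ Suc j) *\<^sub>C val a ^ (n - j))"
    by (intro sum.cong refl) (simp add: power_Suc[symmetric] Suc_diff_Suc del: power_Suc)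
  finally show ?case
    using assms Suc by (simp add: pow_gen_Suc ito_mult_def val_pow)
qed (simp add: ito_const_def pow_gen_def)

lemma grad_pow_right:
  assumes "grad a = [(- p, u)]"
  shows "grad (ito_pow a n) = map (\<lambda>j. (- (val a ^ j * p), u * val a ^ (n - 1 - j))) [0..<n]"
proof (induction n)
  case (Suc n)
  have "[0..<Suc n] = 0 # map Suc [0..<n]" by (simp add: map_Suc_upt upt_conv_Cons del: upt_Suc)
  then show ?case
    using assms Suc by (simp add: ito_mult_def val_pow comp_def mult.assoc del: upt_Suc)
qed (simp add: ito_const_def)

text \<open>This serves \<open>star Y\<close> with \<open>p = 1\<close> and
  \<open>P * star Y\<close> with \<open>p = P\<close>. The two minus signs of the gradients cancel
  in the contraction, and since \<open>A = p * u\<close> the trace of \<open>u * A ^ j * p\<close>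
  is that of \<open>A ^ Suc j\<close>, so the drift has the same form as in
  \<open>gen_pow_left\<close>.\<close>

lemma gen_pow_right:
  assumes "grad a = [(- p, u)]" "gen a = (- (1/2)) *\<^sub>C val a" "val a = p * u" "p \<in> M" "u \<in> M"
  shows "gen (ito_pow a n) = pow_gen (val a) n"
proof (induction n)
  case (Suc n)
  have tr: "\<tau> (u * (val a ^ j * p)) = \<tau> (val a ^ Suc j)" for j
  proof -
    have "val a \<in> M" using assms by simp
    then have "\<tau> (u * (val a ^ j * p)) = \<tau> ((val a ^ j * p) * u)"
      using assms by (intro tau_commute) auto
    then show ?thesis using assms(3) by (simp add: mult.assoc power_Suc2 del: power_Suc)
  qed
  have "carre (grad a) (grad (ito_pow a n)) = - (\<Sum>j<n. \<tau> (u * (val a ^ j * p)) *\<^sub>C (val a * val a ^ (n - 1 - j)))"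
    unfolding grad_pow_right[OF assms(1)] assms(1) carre_def
    using assms by (simp add: comp_def interv_sum_list_conv_sum_set_nat atLeast0LessThan mult.assoc)
  also have "(\<Sum>j<n. \<tau> (u * (val a ^ j * p)) *\<^sub>C (val a * val a ^ (n - 1 - j))) = (\<Sum>j<n. \<tau> (val a ^ Suc j) *\<^sub>C val a ^ (n - j))"
    unfolding tr by (intro sum.cong refl) (simp add: power_Suc[symmetric] Suc_diff_Suc del: power_Suc)
  finally show ?case
    using assms(2) Suc by (simp add: pow_gen_Suc ito_mult_def val_pow)
qed (simp add: ito_const_def pow_gen_def)

end

section \<open>Freeness and the Ito product rule\<close>

locale free_compression = free_ubm M \<tau> X Y
  for M :: "'h::complex_hilbert_space cop set" and \<tau> and X and Y +
  fixes P :: "'h cop" and \<alpha> :: complex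
  assumes P_in_M [simp]: "P \<in> M"
    and P_selfadjoint [simp]: "star P = P"
    and P_idem [simp]: "P * P = P"
    and tau_P [simp]: "\<tau> P = \<alpha>"
    and P_free: "star_free \<tau> {P} (Y ` {0..})"
begin

abbreviation algY :: "'h cop set" where "algY \<equiv> star_algebra (Y ` {0..})"

lemma algY_in_M [simp]: "A \<in> algY \<Longrightarrow> A \<in> M"
  using star_algebra_subset_M[of "Y ` {0..}" A] by force

lemma Y_in_algY: "0 \<le> t \<Longrightarrow> Y t \<in> algY"
  by (intro star_algebra.incl) auto

section \<open>Reduced words and the vanishing of their traces\<close>

definition P0 :: "'h cop" where "P0 = center P"

lemma P0_eq: "P0 = P - \<alpha> *\<^sub>C 1"
  by (simp add: P0_def center_def)

lemma P0_in_M [simp]: "P0 \<in> M"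
  by (simp add: P0_def)

lemma tau_P0: "\<tau> P0 = 0"
  by (simp add: P0_def)

lemma P0_in_algP: "P0 \<in> star_algebra {P}"
  unfolding P0_def by (intro center_in_star_algebra star_algebra.incl) auto

text \<open>The relation by which two neighbouring \<open>P0\<close> in a word are merged, with
  coefficients that do not depend on time.\<close>

lemma P0_sq: "P0 * P0 = (1 - 2 * \<alpha>) *\<^sub>C P0 + (\<alpha> * (1 - \<alpha>)) *\<^sub>C 1"
proof -
  have 1: "P0 * P0 = P - (\<alpha> *\<^sub>C P + \<alpha> *\<^sub>C P) + (\<alpha> * \<alpha>) *\<^sub>C 1"
    by (simp add: P0_eq algebra_simps scaleC_scaleC scaleC_diff_right)
  have "(1 - 2 * \<alpha>) *\<^sub>C P0 = (1 - 2 * \<alpha>) *\<^sub>C P - ((1 - 2 * \<alpha>) * \<alpha>) *\<^sub>C 1"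
    by (simp only: P0_eq scaleC_diff_right scaleC_scaleC)
  also have "(1 - 2 * \<alpha>) *\<^sub>C P = P - (\<alpha> *\<^sub>C P + \<alpha> *\<^sub>C P)"
    by (simp only: scaleC_diff_left scaleC_one mult_2 scaleC_add_left)
  finally have "(1 - 2 * \<alpha>) *\<^sub>C P0 + (\<alpha> * (1 - \<alpha>)) *\<^sub>C 1
      = P - (\<alpha> *\<^sub>C P + \<alpha> *\<^sub>C P) + (\<alpha> * (1 - \<alpha>) - (1 - 2 * \<alpha>) * \<alpha>) *\<^sub>C 1"
    by (simp only: scaleC_diff_left) (simp only: algebra_simps)
  also have "\<alpha> * (1 - \<alpha>) - (1 - 2 * \<alpha>) * \<alpha> = \<alpha> * \<alpha>"
    by (simp add: algebra_simps)
  finally show ?thesis using 1 by simp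
qed

text \<open>Words alternating between \<open>P0\<close> and letters from the algebra of
  \<open>Y\<close>, starting with \<open>P0\<close>, with centred inner letters. The last letter may
  be arbitrary: under the trace it joins cyclically whatever multiplies the word from the
  left.\<close>

inductive_set reduced :: "'h cop set" where
  last: "c \<in> algY \<Longrightarrow> P0 * c \<in> reduced"
| step: "c \<in> algY \<Longrightarrow> \<tau> c = 0 \<Longrightarrow> v \<in> reduced \<Longrightarrow> P0 * (c * v) \<in> reduced"

lemma reduced_in_M: "v \<in> reduced \<Longrightarrow> v \<in> M"
  by (induction rule: reduced.induct) auto

lemma reduced_as_word:
  assumes "v \<in> reduced"
  shows "\<exists>w d. w \<noteq> [] \<and> fst (hd w) \<and> distinct_adj (map fst w) \<and> d \<in> algY \<and> v = prod_list (map snd w) * d \<and>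
     (\<forall>(b, A)\<in>set w. A \<in> star_algebra (if b then {P} else Y ` {0..}) \<and> \<tau> A = 0)"
  using assms
proof (induction rule: reduced.induct)
  case (last c)
  then show ?case
    using tau_P0 P0_in_algP by (intro exI[of _ "[(True, P0)]"] exI[of _ c]) auto
next
  case (step c v)
  then obtain w d where w: "w \<noteq> []" "fst (hd w)" "distinct_adj (map fst w)" "d \<in> algY" "v = prod_list (map snd w) * d"
    "\<forall>(b, A)\<in>set w. A \<in> star_algebra (if b then {P} else Y ` {0..}) \<and> \<tau> A = 0" by blast
  then show ?case
    using step.hyps(1,2) tau_P0 P0_in_algP
    by (intro exI[of _ "(True, P0) # (False, c) # w"] exI[of _ d]) (auto simp: distinct_adj_Cons hd_map mult.assoc)
qed

text \<open>Cyclicity brings the last letter \<open>d\<close> to the front, where it forms the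
  single letter \<open>e = d * c\<close>. Both for \<open>center e\<close> and for the scalar part
  of \<open>e\<close> an alternating word with centred letters remains.\<close>

lemma tau_mult_reduced:
  assumes "c \<in> algY" "v \<in> reduced" shows "\<tau> (c * v) = 0"
proof -
  obtain w d where w: "w \<noteq> []" "fst (hd w)" "distinct_adj (map fst w)" "d \<in> algY" "v = prod_list (map snd w) * d"
    and w': "\<And>b A. (b, A) \<in> set w \<Longrightarrow> A \<in> star_algebra (if b then {P} else Y ` {0..}) \<and> \<tau> A = 0"
    using reduced_as_word[OF assms(2)] by blast
  define p where "p = prod_list (map snd w)"
  define e where "e = d * c"
  have e: "e \<in> algY" using w assms by (simp add: e_def star_algebra.mult)
  have "A \<in> M" if "A \<in> set (map snd w)" for A
  proof -
    obtain p where "p \<in> set w" "A = snd p" using \<open>A \<in> set (map snd w)\<close> unfolding set_map by blast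
    then have "(fst p, A) \<in> set w" by simp
    from w'[OF this] show ?thesis
      using star_algebra_subset_M[of "{P}" A] by (cases "fst p") auto
  qed
  then have p: "p \<in> M" unfolding p_def by (induction w) auto
  have "\<tau> p = 0"
    unfolding p_def using w w' by (intro star_free_word[OF P_free])
  moreover have "\<tau> (prod_list (map snd ((False, center e) # w))) = 0"
  proof (rule star_free_word[OF P_free])
    show "distinct_adj (map fst ((False, center e) # w))"
      using w by (auto simp: distinct_adj_Cons hd_map)
    show "A \<in> star_algebra (if b then {P} else Y ` {0..}) \<and> \<tau> A = 0"
      if "(b, A) \<in> set ((False, center e) # w)" for b A
      using that w' center_in_star_algebra[OF e] e by fastforce
  qed simp
  then have "\<tau> (center e * p) = 0" by (simp add: p_def)
  ultimately have "\<tau> (e * p) = 0"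
    using p e by (simp add: center_def algebra_simps)
  moreover have "\<tau> (c * v) = \<tau> (d * (c * p))"
    using tau_commute[of "c * p" d] w(4,5) assms(1) p by (simp add: p_def mult.assoc)
  ultimately show ?thesis by (simp add: e_def mult.assoc)
qed

text \<open>Paths of Ito data; all relations are required at times \<open>t \<ge> 0\<close> only.\<close>

definition path_mult :: "(real \<Rightarrow> 'h cop ito) \<Rightarrow> (real \<Rightarrow> 'h cop ito) \<Rightarrow> real \<Rightarrow> 'h cop ito"  (infixl "\<cdot>" 70)
  where "(a \<cdot> b) t = a t \<star> b t"

definition path_add :: "(real \<Rightarrow> 'h cop ito) \<Rightarrow> (real \<Rightarrow> 'h cop ito) \<Rightarrow> real \<Rightarrow> 'h cop ito"  (infixl "\<uplus>" 65)
  where "(a \<uplus> b) t = a t \<oplus> b t"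

definition path_eq :: "(real \<Rightarrow> 'h cop ito) \<Rightarrow> (real \<Rightarrow> 'h cop ito) \<Rightarrow> bool"  (infix "\<doteq>" 50)
  where "a \<doteq> b \<longleftrightarrow> (\<forall>t\<ge>0. a t \<simeq> b t)"

definition path_wf :: "(real \<Rightarrow> 'h cop ito) \<Rightarrow> bool" where "path_wf a \<longleftrightarrow> (\<forall>t\<ge>0. ito_wf (a t))"

text \<open>Ito's formula after taking the trace. Sums and \<open>\<doteq>\<close> preserve it
  directly, whereas products are handled by reduction to normal forms.\<close>

definition has_tau_derivative :: "(real \<Rightarrow> 'h cop ito) \<Rightarrow> bool" where
  "has_tau_derivative a \<longleftrightarrow>
     (\<forall>t\<ge>0. ((\<lambda>s. \<tau> (val (a s))) has_vector_derivative \<tau> (gen (a t))) (at t within {0..}))"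

definition in_algY :: "(real \<Rightarrow> 'h cop ito) \<Rightarrow> bool" where
  "in_algY a \<longleftrightarrow> (\<forall>t\<ge>0. val (a t) \<in> algY \<and> gen (a t) \<in> algY \<and> (\<forall>(l, r)\<in>set (grad (a t)). l \<in> algY \<and> r \<in> algY))"

lemma path_eq_refl [simp]: "a \<doteq> a" by (simp add: path_eq_def)
lemma path_eq_sym: "a \<doteq> b \<Longrightarrow> b \<doteq> a" by (simp add: path_eq_def ito_eq_sym)
lemma path_eq_trans [trans]: "a \<doteq> b \<Longrightarrow> b \<doteq> c \<Longrightarrow> a \<doteq> c"
  unfolding path_eq_def using ito_eq_trans by blast

lemma path_mult_assoc: "a \<cdot> b \<cdot> c = a \<cdot> (b \<cdot> c)"
  by (simp add: path_mult_def fun_eq_iff ito_mult_assoc)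

lemma path_wf_mult: "path_wf a \<Longrightarrow> path_wf b \<Longrightarrow> path_wf (a \<cdot> b)"
  by (simp add: path_wf_def path_mult_def ito_wf_mult)

lemma path_wf_add: "path_wf a \<Longrightarrow> path_wf b \<Longrightarrow> path_wf (a \<uplus> b)"
  by (simp add: path_wf_def path_add_def ito_wf_add)

lemma path_cong_right: "path_wf a \<Longrightarrow> b \<doteq> c \<Longrightarrow> a \<cdot> b \<doteq> a \<cdot> c"
  by (simp add: path_wf_def path_mult_def path_eq_def ito_mult_cong_right)

lemma path_cong_left: "path_wf c \<Longrightarrow> a \<doteq> b \<Longrightarrow> a \<cdot> c \<doteq> b \<cdot> c"
  by (simp add: path_wf_def path_mult_def path_eq_def ito_mult_cong_left)

lemma path_distrib_left: "path_wf a \<Longrightarrow> path_wf b \<Longrightarrow> path_wf c \<Longrightarrow> a \<cdot> (b \<uplus> c) \<doteq> a \<cdot> b \<uplus> a \<cdot> c"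
  by (simp add: path_wf_def path_mult_def path_add_def path_eq_def ito_distrib_left)

lemma path_distrib_right: "path_wf a \<Longrightarrow> path_wf b \<Longrightarrow> path_wf c \<Longrightarrow> (a \<uplus> b) \<cdot> c \<doteq> a \<cdot> c \<uplus> b \<cdot> c"
  by (simp add: path_wf_def path_mult_def path_add_def path_eq_def ito_distrib_right)

lemma in_algY_wf: "in_algY a \<Longrightarrow> path_wf a"
  unfolding in_algY_def path_wf_def ito_wf_def by fastforce

lemma carre_in_algY:
  assumes "\<And>l r. (l, r) \<in> set xs \<Longrightarrow> l \<in> algY \<and> r \<in> algY" "\<And>l r. (l, r) \<in> set ys \<Longrightarrow> l \<in> algY \<and> r \<in> algY"
  shows "carre xs ys \<in> algY"
proof -
  have sum: "(\<Sum>x\<leftarrow>zs. f x) \<in> algY" if "\<And>x. x \<in> set zs \<Longrightarrow> f x \<in> algY" for f :: "'x \<Rightarrow> 'h cop" and zs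
    using that by (induction zs) (auto intro: star_algebra.add star_algebra_zero)
  have "(\<Sum>p\<leftarrow>xs. \<Sum>q\<leftarrow>ys. \<tau> (snd p * fst q) *\<^sub>C (fst p * snd q)) \<in> algY"
    using assms by (intro sum star_algebra.scale star_algebra.mult) (metis prod.collapse)+
  then show ?thesis unfolding carre_def case_prod_unfold by (rule star_algebra_minus)
qed

lemma in_algY_mult: "in_algY a \<Longrightarrow> in_algY b \<Longrightarrow> in_algY (a \<cdot> b)"
  unfolding in_algY_def path_mult_def ito_mult_def
  by (auto intro!: star_algebra.mult star_algebra.add carre_in_algY)

lemma in_algY_add: "in_algY a \<Longrightarrow> in_algY b \<Longrightarrow> in_algY (a \<uplus> b)"
  unfolding in_algY_def path_add_def ito_add_def by (auto intro!: star_algebra.add)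

definition path_Y :: "real \<Rightarrow> 'h cop ito" where "path_Y t = ito_Y (Y t)"
definition path_Ystar :: "real \<Rightarrow> 'h cop ito" where "path_Ystar t = ito_Ystar (Y t)"
definition path_const :: "'h cop \<Rightarrow> real \<Rightarrow> 'h cop ito" where "path_const A t = ito_const A"
definition path_scalar :: "(real \<Rightarrow> complex) \<Rightarrow> (real \<Rightarrow> complex) \<Rightarrow> real \<Rightarrow> 'h cop ito" where
  "path_scalar c c' t = ito_scalar (c t) (c' t)"

definition path_pow :: "(real \<Rightarrow> 'h cop ito) \<Rightarrow> nat \<Rightarrow> real \<Rightarrow> 'h cop ito" where
  "path_pow a n t = ito_pow (a t) n"

lemma path_pow_0 [simp]: "path_pow a 0 = path_const 1"
  by (simp add: path_pow_def path_const_def fun_eq_iff)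

lemma path_pow_Suc: "path_pow a (Suc n) = a \<cdot> path_pow a n"
  by (simp add: path_pow_def path_mult_def fun_eq_iff)

lemma path_one_mult [simp]: "path_const 1 \<cdot> a = a" "a \<cdot> path_const 1 = a"
  by (simp_all add: path_mult_def path_const_def fun_eq_iff)

lemma in_algY_Y [simp]: "in_algY path_Y" "in_algY path_Ystar" "in_algY (path_const 1)" "in_algY (path_scalar c c')"
  unfolding in_algY_def path_Y_def path_Ystar_def path_const_def path_scalar_def
    ito_Y_def ito_Ystar_def ito_const_def ito_scalar_def
  by (auto intro!: star_algebra.scale star_algebra.one Y_in_algY star_algebra.star star_algebra_minus star_algebra_zero
      simp del: scaleC_minus_left)

lemma in_algY_pow: "in_algY a \<Longrightarrow> in_algY (path_pow a n)"
  by (induction n) (simp_all add: path_pow_Suc in_algY_mult)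

lemma path_wf_const [simp]: "A \<in> M \<Longrightarrow> path_wf (path_const A)"
  by (simp add: path_wf_def path_const_def)

lemma path_wf_scalar [simp]: "path_wf (path_scalar c c')"
  by (simp add: path_wf_def path_scalar_def)

lemma path_wf_Y [simp]: "path_wf path_Y" "path_wf path_Ystar"
  by (simp_all add: in_algY_wf)

lemma path_Y_Ystar: "path_Y \<cdot> path_Ystar \<doteq> path_const 1" "path_Ystar \<cdot> path_Y \<doteq> path_const 1"
  by (simp_all add: path_eq_def path_mult_def path_Y_def path_Ystar_def path_const_def ito_Y_Ystar ito_Ystar_Y)

lemma path_scalar_commute: "path_wf a \<Longrightarrow> a \<cdot> path_scalar c c' \<doteq> path_scalar c c' \<cdot> a"
  by (simp add: path_eq_def path_mult_def path_scalar_def path_wf_def ito_scalar_commute)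

lemma path_scalar_mult_scalar:
  "path_scalar c c' \<cdot> path_scalar d d' = path_scalar (\<lambda>t. c t * d t) (\<lambda>t. c' t * d t + c t * d' t)"
  by (simp add: fun_eq_iff path_mult_def path_scalar_def ito_scalar_mult_scalar)

section \<open>Derivatives of traces along paths\<close>

definition derivs :: "(real \<Rightarrow> complex) \<Rightarrow> (real \<Rightarrow> complex) \<Rightarrow> bool" where
  "derivs c c' \<longleftrightarrow> (\<forall>t\<ge>0. (c has_vector_derivative c' t) (at t within {0..}))"

lemma derivs_mult: "derivs c c' \<Longrightarrow> derivs d d' \<Longrightarrow> derivs (\<lambda>t. c t * d t) (\<lambda>t. c' t * d t + c t * d' t)"
  unfolding derivs_def
proof (intro allI impI)
  fix t :: real
  assume "\<forall>t\<ge>0. (c has_vector_derivative c' t) (at t within {0..})"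
    "\<forall>t\<ge>0. (d has_vector_derivative d' t) (at t within {0..})" "0 \<le> t"
  then have "((\<lambda>t. c t * d t) has_vector_derivative (c t * d' t + c' t * d t)) (at t within {0..})"
    by (intro has_vector_derivative_mult) blast+
  then show "((\<lambda>t. c t * d t) has_vector_derivative (c' t * d t + c t * d' t)) (at t within {0..})"
    by (simp only: add.commute)
qed

lemma derivs_const [simp]: "derivs (\<lambda>t. c) (\<lambda>t. 0)"
  by (simp add: derivs_def)

lemma derivs_minus: "derivs c c' \<Longrightarrow> derivs (\<lambda>t. - c t) (\<lambda>t. - c' t)"
  by (auto simp: derivs_def intro: has_vector_derivative_minus)

lemma has_tau_derivative_add:
  assumes "path_wf a" "path_wf b" "has_tau_derivative a" "has_tau_derivative b"
  shows "has_tau_derivative (a \<uplus> b)"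
  unfolding has_tau_derivative_def
proof (intro allI impI)
  fix t :: real assume t: "0 \<le> t"
  have "((\<lambda>s. \<tau> (val (a s)) + \<tau> (val (b s))) has_vector_derivative (\<tau> (gen (a t)) + \<tau> (gen (b t)))) (at t within {0..})"
    using assms(3,4) t unfolding has_tau_derivative_def by (intro has_vector_derivative_add) auto
  moreover have "\<tau> (gen (a t)) + \<tau> (gen (b t)) = \<tau> (gen ((a \<uplus> b) t))"
    using assms t by (simp add: path_wf_def ito_wf_def path_add_def ito_add_def)
  moreover have "\<tau> (val (a s)) + \<tau> (val (b s)) = \<tau> (val ((a \<uplus> b) s))" if "s \<in> {0..}" for s
    using assms that by (simp add: path_wf_def ito_wf_def path_add_def ito_add_def)
  ultimately show "((\<lambda>s. \<tau> (val ((a \<uplus> b) s))) has_vector_derivative \<tau> (gen ((a \<uplus> b) t))) (at t within {0..})"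
    using t by (auto elim!: has_vector_derivative_transform[rotated 2])
qed

lemma has_tau_derivative_cong:
  assumes "a \<doteq> b" "has_tau_derivative a" shows "has_tau_derivative b"
  unfolding has_tau_derivative_def
proof (intro allI impI)
  fix t :: real assume t: "0 \<le> t"
  have "((\<lambda>s. \<tau> (val (a s))) has_vector_derivative \<tau> (gen (b t))) (at t within {0..})"
    using assms t unfolding has_tau_derivative_def path_eq_def ito_eq_def by auto
  moreover have "\<tau> (val (a s)) = \<tau> (val (b s))" if "s \<in> {0..}" for s
    using assms that by (simp add: path_eq_def ito_eq_def)
  ultimately show "((\<lambda>s. \<tau> (val (b s))) has_vector_derivative \<tau> (gen (b t))) (at t within {0..})"
    using t by (auto elim!: has_vector_derivative_transform[rotated 2])
qed

lemma tau_pow_gen: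
  assumes "A \<in> M"
  shows "\<tau> (pow_gen A n) = - (of_nat n / 2 * \<tau> (A ^ n)) - (\<Sum>c<n. of_nat (n - 1 - c) * (\<tau> (A ^ Suc c) * \<tau> (A ^ (n - 1 - c))))"
  unfolding pow_gen_def using assms by (subst tau_diff) (auto intro!: M_sum simp: tau_sum mult.assoc simp del: scaleC_minus_left)

text \<open>The point where analysis enters: \<open>q_has_derivative\<close>, its complex conjugate
  for powers of \<open>star Y\<close>, and the product rule for the scalar factor.\<close>

lemma has_tau_derivative_scalar_pow:
  assumes c: "derivs c c'" and U: "U = path_Y \<or> U = path_Ystar"
  shows "has_tau_derivative (path_scalar c c' \<cdot> path_pow U k)"
proof -
  define f where "f t = \<tau> (val (path_pow U k t))" for t
  define f' where "f' t = \<tau> (gen (path_pow U k t))" for t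
  have f: "f t = (if U = path_Y then q k t else cnj (q k t))"
    and f': "f' t = (if U = path_Y then drift k t else cnj (drift k t))" if "0 \<le> t" for t
  proof -
    have star_pow: "\<tau> (star (Y t) ^ n) = cnj (\<tau> (Y t ^ n))" for n
      using that tau_star[of "Y t ^ n"] by (simp add: star_power)
    show "f t = (if U = path_Y then q k t else cnj (q k t))"
      using U that star_pow by (auto simp: f_def path_pow_def val_pow path_Y_def path_Ystar_def ito_Y_def ito_Ystar_def q_def)
    have "gen (path_pow path_Y k t) = pow_gen (Y t) k"
      using gen_pow_left[of "ito_Y (Y t)" k] by (simp add: path_pow_def path_Y_def ito_Y_def)
    moreover have "gen (path_pow path_Ystar k t) = pow_gen (star (Y t)) k"
      using gen_pow_right[of "ito_Ystar (Y t)" 1 "star (Y t)" k] that by (simp add: path_pow_def path_Ystar_def ito_Ystar_def)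
    ultimately show "f' t = (if U = path_Y then drift k t else cnj (drift k t))"
      using U that by (auto simp: f'_def tau_pow_gen star_pow drift_def q_def simp del: power_Suc)
  qed
  have "derivs f f'"
    unfolding derivs_def
  proof (intro allI impI)
    fix t :: real assume t: "0 \<le> t"
    have "((\<lambda>t. if U = path_Y then q k t else cnj (q k t)) has_vector_derivative f' t) (at t within {0..})"
      using q_has_derivative[OF t, of k] f'[OF t]
        bounded_linear.has_vector_derivative[OF bounded_linear_cnj q_has_derivative[OF t, of k]] by auto
    then show "(f has_vector_derivative f' t) (at t within {0..})"
      using t f by (auto elim!: has_vector_derivative_transform[rotated 2])
  qed
  then have prod: "derivs (\<lambda>t. c t * f t) (\<lambda>t. c' t * f t + c t * f' t)"
    by (rule derivs_mult[OF c])
  have wf: "ito_wf (path_pow U k t)" if "0 \<le> t" for t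
    using that U in_algY_wf[OF in_algY_pow[of U k]] by (auto simp: path_wf_def)
  have 1: "\<tau> (val ((path_scalar c c' \<cdot> path_pow U k) t)) = c t * f t"
    and 2: "\<tau> (gen ((path_scalar c c' \<cdot> path_pow U k) t)) = c' t * f t + c t * f' t" if "0 \<le> t" for t
    using wf[OF that] by (simp_all add: path_mult_def ito_mult_def path_scalar_def ito_scalar_def f_def f'_def ito_wf_def)
  show ?thesis
    unfolding has_tau_derivative_def
  proof (intro allI impI)
    fix t :: real assume t: "0 \<le> t"
    have "((\<lambda>t. c t * f t) has_vector_derivative \<tau> (gen ((path_scalar c c' \<cdot> path_pow U k) t))) (at t within {0..})"
      using prod t 2[OF t] by (simp add: derivs_def)
    then show "((\<lambda>t. \<tau> (val ((path_scalar c c' \<cdot> path_pow U k) t))) has_vector_derivative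
        \<tau> (gen ((path_scalar c c' \<cdot> path_pow U k) t))) (at t within {0..})"
      using t 1 by (auto elim!: has_vector_derivative_transform[rotated 2])
  qed
qed

text \<open>Laurent polynomials in \<open>Y\<close> whose coefficients are differentiable functions
  of time. Membership of \<open>b\<close> in the algebra is demanded in \<open>equiv\<close> because
  \<open>\<doteq>\<close> compares gradients as tensors and says nothing about their individual
  entries.\<close>

inductive polyY :: "(real \<Rightarrow> 'h cop ito) \<Rightarrow> bool" where
  mono: "derivs c c' \<Longrightarrow> U = path_Y \<or> U = path_Ystar \<Longrightarrow> polyY (path_scalar c c' \<cdot> path_pow U k)"
| add: "polyY a \<Longrightarrow> polyY b \<Longrightarrow> polyY (a \<uplus> b)"
| equiv: "polyY a \<Longrightarrow> a \<doteq> b \<Longrightarrow> in_algY b \<Longrightarrow> polyY b"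

lemma polyY_in_algY: "polyY a \<Longrightarrow> in_algY a"
  by (induction rule: polyY.induct) (auto intro!: in_algY_mult in_algY_add in_algY_pow)

lemma polyY_wf: "polyY a \<Longrightarrow> path_wf a"
  by (intro in_algY_wf polyY_in_algY)

lemma polyY_has_tau_derivative: "polyY a \<Longrightarrow> has_tau_derivative a"
  by (induction rule: polyY.induct)
    (auto intro: has_tau_derivative_scalar_pow has_tau_derivative_add has_tau_derivative_cong polyY_wf)

lemma polyY_scalar: "derivs c c' \<Longrightarrow> polyY (path_scalar c c')"
  using polyY.mono[of c c' path_Y 0] by simp

lemma polyY_one: "polyY (path_const 1)"
proof -
  have "path_scalar (\<lambda>t. 1) (\<lambda>t. 0) = path_const 1"
    by (simp add: path_scalar_def path_const_def ito_scalar_one fun_eq_iff)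
  then show ?thesis using polyY_scalar[OF derivs_const[of 1]] by simp
qed

lemma polyY_scalar_mult:
  assumes d: "derivs d d'" and "polyY a"
  shows "polyY (path_scalar d d' \<cdot> a)"
  using assms(2)
proof (induction rule: polyY.induct)
  case (mono c c' U k)
  then show ?case
    using polyY.mono[OF derivs_mult[OF d mono(1)], of U k]
    by (simp add: path_mult_assoc[symmetric] path_scalar_mult_scalar)
next
  case (add a b)
  have "polyY (path_scalar d d' \<cdot> a \<uplus> path_scalar d d' \<cdot> b)" by (intro polyY.add add)
  then show ?case
    by (rule polyY.equiv)
      (intro path_eq_sym[OF path_distrib_left] in_algY_mult in_algY_add path_wf_scalar polyY_wf polyY_in_algY in_algY_Y add)+
next
  case (equiv a b)
  show ?case
    by (rule polyY.equiv[OF equiv.IH]) (intro path_cong_right in_algY_mult in_algY_Y path_wf_scalar equiv)+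
qed

text \<open>Multiplying a power of \<open>Y\<close> or \<open>star Y\<close> by one of the two
  either raises the exponent or cancels one factor; the cancellation is valid for formal
  differentials by \<open>path_Y_Ystar\<close>.\<close>

lemma polyY_Y_mult:
  assumes U: "U = path_Y \<or> U = path_Ystar" and "polyY a"
  shows "polyY (U \<cdot> a)"
  using assms(2)
proof (induction rule: polyY.induct)
  case (mono c c' V k)
  have UV [simp]: "in_algY U" "in_algY V" using U mono by auto
  have wf: "path_wf U" "path_wf (path_pow V k)" by (intro in_algY_wf in_algY_pow UV)+
  have "\<exists>V' k'. (V' = path_Y \<or> V' = path_Ystar) \<and> U \<cdot> path_pow V k \<doteq> path_pow V' k'"
  proof (cases "U = V")
    case True
    then show ?thesis using U by (intro exI[of _ U] exI[of _ "Suc k"]) (simp add: path_pow_Suc)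
  next
    case False
    show ?thesis
    proof (cases k)
      case 0
      then show ?thesis using U by (intro exI[of _ U] exI[of _ 1]) (simp add: path_pow_Suc)
    next
      case (Suc n)
      have "U \<cdot> V \<doteq> path_const 1" using False U mono(2) path_Y_Ystar by auto
      then have "U \<cdot> V \<cdot> path_pow V n \<doteq> path_const 1 \<cdot> path_pow V n"
        by (intro path_cong_left in_algY_wf in_algY_pow UV)
      then show ?thesis
        using Suc mono(2) by (intro exI[of _ V] exI[of _ n]) (simp add: path_pow_Suc path_mult_assoc)
    qed
  qed
  then obtain V' k' where V': "V' = path_Y \<or> V' = path_Ystar" "U \<cdot> path_pow V k \<doteq> path_pow V' k'" by blast
  have "path_scalar c c' \<cdot> path_pow V' k' \<doteq> path_scalar c c' \<cdot> (U \<cdot> path_pow V k)"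
    by (intro path_cong_right path_eq_sym[OF V'(2)]) simp
  also have "path_scalar c c' \<cdot> (U \<cdot> path_pow V k) \<doteq> U \<cdot> (path_scalar c c' \<cdot> path_pow V k)"
    unfolding path_mult_assoc[symmetric]
    by (intro path_cong_left path_eq_sym[OF path_scalar_commute] wf)
  finally show ?case
    by (rule polyY.equiv[OF polyY.mono[OF mono(1) V'(1)]]) (intro in_algY_mult in_algY_pow in_algY_Y UV)
next
  case (add a b)
  have Uwf: "in_algY U" using U by auto
  have "polyY (U \<cdot> a \<uplus> U \<cdot> b)" by (intro polyY.add add)
  then show ?case
    by (rule polyY.equiv)
      (intro path_eq_sym[OF path_distrib_left] in_algY_mult in_algY_add in_algY_wf[OF Uwf] polyY_wf polyY_in_algY Uwf add)+
next
  case (equiv a b)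
  have Uwf: "in_algY U" using U by auto
  show ?case
    by (rule polyY.equiv[OF equiv.IH]) (intro path_cong_right in_algY_mult Uwf in_algY_wf[OF Uwf] equiv)+
qed

text \<open>The scalar is subtracted together with its derivative, so the drift is centred as well
  as the value. Both are needed, since the drift of a word has letters replaced by their
  drifts.\<close>

definition path_center :: "(real \<Rightarrow> 'h cop ito) \<Rightarrow> real \<Rightarrow> 'h cop ito" where
  "path_center b = b \<uplus> path_scalar (\<lambda>t. - \<tau> (val (b t))) (\<lambda>t. - \<tau> (gen (b t)))"

definition centered :: "(real \<Rightarrow> 'h cop ito) \<Rightarrow> bool" where
  "centered b \<longleftrightarrow> (\<forall>t\<ge>0. \<tau> (val (b t)) = 0 \<and> \<tau> (gen (b t)) = 0)"

lemma polyY_derivs: "polyY b \<Longrightarrow> derivs (\<lambda>t. \<tau> (val (b t))) (\<lambda>t. \<tau> (gen (b t)))"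
  using polyY_has_tau_derivative[of b] by (simp add: has_tau_derivative_def derivs_def)

lemma polyY_center: "polyY b \<Longrightarrow> polyY (path_center b)"
  unfolding path_center_def by (intro polyY.add polyY_scalar derivs_minus polyY_derivs)

lemma centered_center: "polyY b \<Longrightarrow> centered (path_center b)"
  using polyY_wf[of b]
  by (auto simp: centered_def path_center_def path_add_def ito_add_def path_scalar_def ito_scalar_def
      path_wf_def ito_wf_def simp del: scaleC_minus_left)

lemma uncenter_path:
  "b \<doteq> path_center b \<uplus> path_scalar (\<lambda>t. \<tau> (val (b t))) (\<lambda>t. \<tau> (gen (b t)))"
  by (simp add: path_eq_def ito_eq_def path_center_def path_add_def ito_add_def path_scalar_def ito_scalar_def)

abbreviation path_P0 :: "real \<Rightarrow> 'h cop ito" where "path_P0 \<equiv> path_const P0"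

inductive reduced_path :: "(real \<Rightarrow> 'h cop ito) \<Rightarrow> bool" where
  last: "polyY b \<Longrightarrow> reduced_path (path_P0 \<cdot> b)"
| step: "polyY b \<Longrightarrow> centered b \<Longrightarrow> reduced_path w \<Longrightarrow> reduced_path (path_P0 \<cdot> (b \<cdot> w))"

lemma reduced_path_wf: "reduced_path w \<Longrightarrow> path_wf w"
  by (induction rule: reduced_path.induct) (auto intro!: path_wf_mult intro: polyY_wf)

text \<open>The drift of a reduced word is not a single word but a sum with one letter at a time
  differentiated.\<close>

inductive_set reduced_sums :: "'h cop set" where
  incl: "v \<in> reduced \<Longrightarrow> v \<in> reduced_sums"
| add: "v \<in> reduced_sums \<Longrightarrow> w \<in> reduced_sums \<Longrightarrow> v + w \<in> reduced_sums"

lemma reduced_sums_in_M: "v \<in> reduced_sums \<Longrightarrow> v \<in> M"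
  by (induction rule: reduced_sums.induct) (auto intro: reduced_in_M)

lemma tau_mult_reduced_sums: "v \<in> reduced_sums \<Longrightarrow> c \<in> algY \<Longrightarrow> \<tau> (c * v) = 0"
  by (induction rule: reduced_sums.induct)
    (simp_all add: distrib_left tau_mult_reduced reduced_sums_in_M)

lemma reduced_sums_step: "v \<in> reduced_sums \<Longrightarrow> c \<in> algY \<Longrightarrow> \<tau> c = 0 \<Longrightarrow> P0 * (c * v) \<in> reduced_sums"
  by (induction rule: reduced_sums.induct)
    (auto simp: distrib_left intro: reduced_sums.intros reduced.step)

text \<open>Freeness removes the Ito correction between letters separated by \<open>P0\<close>: its
  scalar coefficient is the trace of a letter times a reduced word.\<close>

lemma carre_reduced_zero:
  assumes "\<And>l r. (l, r) \<in> set xs \<Longrightarrow> r \<in> algY" "\<And>l r. (l, r) \<in> set ys \<Longrightarrow> l \<in> reduced"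
  shows "carre xs ys = 0"
proof -
  have "(\<Sum>q\<leftarrow>ys. \<tau> (snd p * fst q) *\<^sub>C (fst p * snd q)) = (\<Sum>q\<leftarrow>ys. 0)" if "p \<in> set xs" for p
    using that assms tau_mult_reduced
    by (intro arg_cong[of _ _ sum_list] map_cong refl) (metis prod.collapse scaleC_zero_left)
  then have "(\<Sum>p\<leftarrow>xs. \<Sum>q\<leftarrow>ys. \<tau> (snd p * fst q) *\<^sub>C (fst p * snd q)) = (\<Sum>p\<leftarrow>xs. 0)"
    by (intro arg_cong[of _ _ sum_list] map_cong refl) simp
  then show ?thesis unfolding carre_def case_prod_unfold by simp
qed

text \<open>Since the contraction vanishes, the drift acts letter by letter, and centred drifts keep
  each summand reduced. Of the gradient only the left legs are tracked: cutting within a letter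
  leaves a reduced word, because the last letter is unrestricted, and left legs are all that
  \<open>carre_reduced_zero\<close> uses in its second argument.\<close>

lemma reduced_path_reduced:
  assumes "reduced_path w" "0 \<le> t"
  shows "val (w t) \<in> reduced \<and> gen (w t) \<in> reduced_sums \<and> (\<forall>(l, r)\<in>set (grad (w t)). l \<in> reduced)"
  using assms(1)
proof (induction rule: reduced_path.induct)
  case (last b)
  have "in_algY b" by (rule polyY_in_algY[OF last])
  then show ?case
    using assms(2) by (auto simp: in_algY_def path_mult_def ito_mult_def path_const_def ito_const_def
        intro!: reduced.last reduced_sums.incl)
next
  case (step b w)
  have b: "val (b t) \<in> algY" "gen (b t) \<in> algY" "\<And>l r. (l, r) \<in> set (grad (b t)) \<Longrightarrow> l \<in> algY \<and> r \<in> algY"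
    using polyY_in_algY[OF step(1)] assms(2) by (auto simp: in_algY_def)
  have c: "\<tau> (val (b t)) = 0" "\<tau> (gen (b t)) = 0"
    using step(2) assms(2) by (auto simp: centered_def)
  have zero: "carre (grad (b t)) (grad (w t)) = 0"
    using b(3) step.IH by (intro carre_reduced_zero) auto
  have grad_eq: "grad ((path_P0 \<cdot> (b \<cdot> w)) t) = map (\<lambda>(l, r). (P0 * l, r * val (w t))) (grad (b t))
      @ map (\<lambda>(l, r). (P0 * (val (b t) * l), r)) (grad (w t))"
    by (simp add: path_mult_def ito_mult_def path_const_def ito_const_def comp_def case_prod_unfold)
  have gen_eq: "gen ((path_P0 \<cdot> (b \<cdot> w)) t) = P0 * (gen (b t) * val (w t)) + P0 * (val (b t) * gen (w t))"
    by (simp add: path_mult_def ito_mult_def path_const_def ito_const_def zero distrib_left)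
  have "val ((path_P0 \<cdot> (b \<cdot> w)) t) \<in> reduced"
    using reduced.step[OF b(1) c(1)] step.IH by (simp add: path_mult_def ito_mult_def path_const_def ito_const_def)
  moreover have "gen ((path_P0 \<cdot> (b \<cdot> w)) t) \<in> reduced_sums"
    unfolding gen_eq using step.IH b c
    by (intro reduced_sums.add reduced_sums.incl[OF reduced.step] reduced_sums_step) auto
  moreover have "\<forall>(l, r)\<in>set (grad ((path_P0 \<cdot> (b \<cdot> w)) t)). l \<in> reduced"
    unfolding grad_eq using reduced.last reduced.step[OF b(1) c(1)] b(3) step.IH by fastforce
  ultimately show ?case by blast
qed

text \<open>The normal forms; in \<open>red\<close> the factor \<open>b\<close> allows a word to
  begin with a letter from the algebra of \<open>Y\<close>.\<close>

inductive reducible :: "(real \<Rightarrow> 'h cop ito) \<Rightarrow> bool" where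
  poly: "polyY b \<Longrightarrow> reducible b"
| red: "polyY b \<Longrightarrow> reduced_path w \<Longrightarrow> reducible (b \<cdot> w)"
| add: "reducible a \<Longrightarrow> reducible b \<Longrightarrow> reducible (a \<uplus> b)"
| equiv: "reducible a \<Longrightarrow> a \<doteq> b \<Longrightarrow> path_wf b \<Longrightarrow> reducible b"

lemma reducible_wf: "reducible a \<Longrightarrow> path_wf a"
  by (induction rule: reducible.induct) (auto intro: polyY_wf reduced_path_wf path_wf_mult path_wf_add)

lemma reducible_has_tau_derivative: "reducible a \<Longrightarrow> has_tau_derivative a"
proof (induction rule: reducible.induct)
  case (red b w)
  have "\<tau> (val ((b \<cdot> w) t)) = 0 \<and> \<tau> (gen ((b \<cdot> w) t)) = 0" if t: "0 \<le> t" for t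
  proof -
    note w = reduced_path_reduced[OF red(2) t]
    have b: "val (b t) \<in> algY" "gen (b t) \<in> algY" "\<And>l r. (l, r) \<in> set (grad (b t)) \<Longrightarrow> l \<in> algY \<and> r \<in> algY"
      using polyY_in_algY[OF red(1)] t by (auto simp: in_algY_def)
    have zero: "carre (grad (b t)) (grad (w t)) = 0"
      using b(3) w by (intro carre_reduced_zero) auto
    have "val (w t) \<in> M" "gen (w t) \<in> M" using w reduced_in_M reduced_sums_in_M by auto
    then show ?thesis
      using w b by (simp add: path_mult_def ito_mult_def zero tau_mult_reduced tau_mult_reduced_sums)
  qed
  then show ?case
    unfolding has_tau_derivative_def
    by (auto intro!: has_vector_derivative_transform[OF _ _ has_vector_derivative_const])
qed (auto intro: polyY_has_tau_derivative has_tau_derivative_add has_tau_derivative_cong reducible_wf)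

lemma reducible_mult_algebra:
  assumes U: "path_wf U" "\<And>b. polyY b \<Longrightarrow> polyY (U \<cdot> b)" and "reducible a"
  shows "reducible (U \<cdot> a)"
  using assms(3)
proof (induction rule: reducible.induct)
  case (poly b)
  then show ?case by (intro reducible.poly U)
next
  case (red b w)
  then show ?case unfolding path_mult_assoc[symmetric] by (intro reducible.red U)
next
  case (add a b)
  show ?case
    by (rule reducible.equiv[OF reducible.add[OF add.IH] path_eq_sym[OF path_distrib_left]])
      (intro U path_wf_mult path_wf_add reducible_wf add)+
next
  case (equiv a b)
  show ?case
    by (rule reducible.equiv[OF equiv.IH]) (intro path_cong_right path_wf_mult U equiv)+
qed

lemma P0_scalar_P0:
  "path_P0 \<cdot> (path_scalar c c' \<cdot> path_P0) \<doteq>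
     path_scalar c c' \<cdot> path_scalar (\<lambda>t. 1 - 2 * \<alpha>) (\<lambda>t. 0) \<cdot> path_P0
     \<uplus> path_scalar c c' \<cdot> path_scalar (\<lambda>t. \<alpha> * (1 - \<alpha>)) (\<lambda>t. 0)"
  by (simp add: path_eq_def ito_eq_def path_mult_def path_add_def ito_mult_def ito_add_def path_scalar_def
      ito_scalar_def path_const_def ito_const_def P0_sq scaleC_scaleC scaleC_add_right mult.commute)

text \<open>Putting \<open>P0\<close> in front of \<open>b \<cdot> w\<close> turns \<open>b\<close>
  into an inner letter, which must be centred. Its centred part gives a longer reduced word; its
  scalar part brings \<open>P0\<close> next to the leading \<open>P0\<close> of \<open>w\<close>,
  and \<open>P0_sq\<close> merges the two.\<close>

lemma reducible_P0_mult:
  assumes "reducible a" shows "reducible (path_P0 \<cdot> a)"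
  using assms
proof (induction rule: reducible.induct)
  case (poly b)
  then show ?case using reducible.red[OF polyY_one reduced_path.last[OF poly]] by simp
next
  case (red b w)
  define c where "c t = \<tau> (val (b t))" for t
  define c' where "c' t = \<tau> (gen (b t))" for t
  have c: "derivs c c'" unfolding c_def[abs_def] c'_def[abs_def] by (rule polyY_derivs[OF red(1)])
  let ?s = "path_scalar c c'"
  let ?\<beta> = "path_scalar (\<lambda>t. 1 - 2 * \<alpha>) (\<lambda>t. 0)" and ?\<gamma> = "path_scalar (\<lambda>t. \<alpha> * (1 - \<alpha>)) (\<lambda>t. 0)"
  have wf [intro]: "path_wf b" "path_wf w" "path_wf (path_center b)"
    using red by (auto intro: polyY_wf reduced_path_wf polyY_center)
  have s\<beta>: "polyY (?s \<cdot> ?\<beta>)" and s\<gamma>: "polyY (?s \<cdot> ?\<gamma>)"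
    by (intro polyY_scalar_mult polyY_scalar c derivs_const)+
  have centered_part: "reducible (path_P0 \<cdot> (path_center b \<cdot> w))"
    using reducible.red[OF polyY_one reduced_path.step[OF polyY_center[OF red(1)] centered_center[OF red(1)] red(2)]]
    by simp
  have scalar_part: "reducible (path_P0 \<cdot> (?s \<cdot> w))"
  proof -
    \<comment> \<open>\<open>u\<close> is \<open>w\<close> without its leading \<open>P0\<close>:
      either a final letter, or a letter followed by a shorter reduced word.\<close>
    obtain u where u: "w = path_P0 \<cdot> u" "polyY u \<or> (\<exists>b' w'. u = b' \<cdot> w' \<and> polyY b' \<and> reduced_path w')"
      using red(2) by cases blast+
    have wfu: "path_wf u" using u(2) by (auto intro: polyY_wf reduced_path_wf path_wf_mult)
    have "reducible (?s \<cdot> ?\<gamma> \<cdot> u)"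
      using u(2)
    proof
      assume "polyY u"
      then show ?thesis
        unfolding path_mult_assoc by (intro reducible.poly polyY_scalar_mult c derivs_const)
    next
      assume "\<exists>b' w'. u = b' \<cdot> w' \<and> polyY b' \<and> reduced_path w'"
      then obtain b' w' where b': "u = b' \<cdot> w'" "polyY b'" "reduced_path w'" by blast
      have "reducible ((?s \<cdot> (?\<gamma> \<cdot> b')) \<cdot> w')"
        by (intro reducible.red polyY_scalar_mult c derivs_const b')
      then show ?thesis by (simp add: b'(1) path_mult_assoc)
    qed
    moreover have "reducible (?s \<cdot> ?\<beta> \<cdot> w)" by (intro reducible.red s\<beta> red(2))
    ultimately have sum: "reducible (?s \<cdot> ?\<beta> \<cdot> w \<uplus> ?s \<cdot> ?\<gamma> \<cdot> u)" by (rule reducible.add[rotated])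
    have 1: "(path_P0 \<cdot> (?s \<cdot> path_P0)) \<cdot> u \<doteq> (?s \<cdot> ?\<beta> \<cdot> path_P0 \<uplus> ?s \<cdot> ?\<gamma>) \<cdot> u"
      by (rule path_cong_left[OF wfu P0_scalar_P0])
    have 2: "(?s \<cdot> ?\<beta> \<cdot> path_P0 \<uplus> ?s \<cdot> ?\<gamma>) \<cdot> u \<doteq> ?s \<cdot> ?\<beta> \<cdot> path_P0 \<cdot> u \<uplus> ?s \<cdot> ?\<gamma> \<cdot> u"
      by (rule path_distrib_right) (intro path_wf_mult path_wf_scalar wfu path_wf_const P0_in_M)+
    have "path_P0 \<cdot> (?s \<cdot> w) \<doteq> ?s \<cdot> ?\<beta> \<cdot> w \<uplus> ?s \<cdot> ?\<gamma> \<cdot> u"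
      using path_eq_trans[OF 1 2] by (simp only: u(1) path_mult_assoc)
    then show ?thesis
      by (rule reducible.equiv[OF sum path_eq_sym]) (intro path_wf_mult path_wf_scalar path_wf_const P0_in_M wf)
  qed
  have 1: "b \<cdot> w \<doteq> (path_center b \<uplus> ?s) \<cdot> w"
    unfolding c_def[abs_def] c'_def[abs_def] by (rule path_cong_left[OF wf(2) uncenter_path])
  have 2: "(path_center b \<uplus> ?s) \<cdot> w \<doteq> path_center b \<cdot> w \<uplus> ?s \<cdot> w"
    by (rule path_distrib_right[OF wf(3) path_wf_scalar wf(2)])
  have 3: "path_P0 \<cdot> (b \<cdot> w) \<doteq> path_P0 \<cdot> (path_center b \<cdot> w \<uplus> ?s \<cdot> w)"
    by (rule path_cong_right[OF path_wf_const[OF P0_in_M] path_eq_trans[OF 1 2]])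
  have 4: "path_P0 \<cdot> (path_center b \<cdot> w \<uplus> ?s \<cdot> w) \<doteq> path_P0 \<cdot> (path_center b \<cdot> w) \<uplus> path_P0 \<cdot> (?s \<cdot> w)"
    by (rule path_distrib_left) (intro path_wf_const P0_in_M path_wf_mult wf path_wf_scalar)+
  from path_eq_trans[OF 3 4] show ?case
    by (rule reducible.equiv[OF reducible.add[OF centered_part scalar_part] path_eq_sym])
      (intro path_wf_mult path_wf_const P0_in_M wf)
next
  case (add a b)
  show ?case
    by (rule reducible.equiv[OF reducible.add[OF add.IH] path_eq_sym[OF path_distrib_left]])
      (intro path_wf_const P0_in_M path_wf_mult path_wf_add reducible_wf add)+
next
  case (equiv a b)
  show ?case
    by (rule reducible.equiv[OF equiv.IH]) (intro path_cong_right path_wf_mult path_wf_const P0_in_M equiv)+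
qed

lemma reducible_P_mult:
  assumes "reducible a" shows "reducible (path_const P \<cdot> a)"
proof -
  let ?\<alpha> = "path_scalar (\<lambda>t. \<alpha>) (\<lambda>t. 0)"
  have wf: "path_wf a" by (rule reducible_wf[OF assms])
  have "reducible (path_P0 \<cdot> a \<uplus> ?\<alpha> \<cdot> a)"
    by (intro reducible.add reducible_P0_mult assms reducible_mult_algebra polyY_scalar_mult path_wf_scalar derivs_const)
  moreover have "path_P0 \<cdot> a \<uplus> ?\<alpha> \<cdot> a \<doteq> (path_P0 \<uplus> ?\<alpha>) \<cdot> a"
    by (intro path_eq_sym[OF path_distrib_right] wf path_wf_const path_wf_scalar P0_in_M)
  moreover have "(path_P0 \<uplus> ?\<alpha>) \<cdot> a \<doteq> path_const P \<cdot> a"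
    by (intro path_cong_left wf)
      (simp add: path_eq_def ito_eq_def path_add_def ito_add_def path_const_def ito_const_def path_scalar_def
        ito_scalar_def P0_eq)
  ultimately show ?thesis
    using path_eq_trans reducible.equiv path_wf_mult[OF path_wf_const[OF P_in_M] wf] by blast
qed

lemma reducible_Y_mult: "reducible a \<Longrightarrow> reducible (path_Y \<cdot> a)" "reducible a \<Longrightarrow> reducible (path_Ystar \<cdot> a)"
  by (auto intro!: reducible_mult_algebra polyY_Y_mult)

definition PY :: "real \<Rightarrow> 'h cop ito" where "PY = path_const P \<cdot> path_Y"
definition PYstar :: "real \<Rightarrow> 'h cop ito" where "PYstar = path_const P \<cdot> path_Ystar"

lemma reducible_word: "reducible (path_pow PY m \<cdot> path_pow PYstar n)"
proof (induction m)
  case 0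
  have "reducible (path_pow PYstar n)"
    by (induction n) (auto simp: path_pow_Suc PYstar_def path_mult_assoc
        intro!: reducible.poly polyY_one reducible_P_mult reducible_Y_mult)
  then show ?case by simp
next
  case (Suc m)
  then show ?case
    by (auto simp: path_pow_Suc PY_def path_mult_assoc intro!: reducible_P_mult reducible_Y_mult)
qed

end

section \<open>The mixed moments\<close>

text \<open>In the \<open>l\<close>-th equation only functions of smaller index occur, so the solution is unique.\<close>

lemma quadratic_hierarchy_unique:
  fixes f g :: "nat \<Rightarrow> real \<Rightarrow> complex"
  assumes f: "\<And>l t. 1 \<le> l \<Longrightarrow> 0 \<le> t \<Longrightarrow> (f l has_vector_derivative
        - (\<Sum>c<l. of_nat (l - 1 - c) * (f (Suc c) t * f (l - 1 - c) t))) (at t within {0..})"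
    and g: "\<And>l t. 1 \<le> l \<Longrightarrow> 0 \<le> t \<Longrightarrow> (g l has_vector_derivative
        - (\<Sum>c<l. of_nat (l - 1 - c) * (g (Suc c) t * g (l - 1 - c) t))) (at t within {0..})"
    and init: "\<And>l. 1 \<le> l \<Longrightarrow> f l 0 = g l 0"
    and l: "1 \<le> l" and t: "0 \<le> t"
  shows "f l t = g l t"
  using l t
proof (induction l arbitrary: t rule: less_induct)
  case (less l)
  have "(\<Sum>c<l. of_nat (l - 1 - c) * (f (Suc c) s * f (l - 1 - c) s))
      = (\<Sum>c<l. of_nat (l - 1 - c) * (g (Suc c) s * g (l - 1 - c) s))" if "0 \<le> s" for s
  proof (rule sum.cong)
    fix c assume "c \<in> {..<l}"
    show "of_nat (l - 1 - c) * (f (Suc c) s * f (l - 1 - c) s) = of_nat (l - 1 - c) * (g (Suc c) s * g (l - 1 - c) s)"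
    \<comment> \<open>The exceptional term \<open>c = l - 1\<close> is the only one with indices
      \<open>l\<close> and 0, and its coefficient is zero.\<close>
    proof (cases "l - 1 - c = 0")
      case False
      then show ?thesis using less.IH[of "Suc c" s] less.IH[of "l - 1 - c" s] that by auto
    qed simp
  qed simp
  then have "((\<lambda>s. f l s - g l s) has_vector_derivative 0) (at s within {0..})" if "s \<in> {0..}" for s
    using has_vector_derivative_diff[OF f[OF less.prems(1), of s] g[OF less.prems(1), of s]] that by simp
  then obtain k where k: "\<And>s. s \<in> {0..} \<Longrightarrow> f l s - g l s = k"
    using has_vector_derivative_zero_constant[of "{0..}" "\<lambda>s. f l s - g l s"] by (auto simp: convex_real_interval)
  have "k = 0" using k[of 0] init[OF less.prems(1)] by simp
  then show ?case using k[of t] less.prems by simp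
qed

locale free_compression_real = free_compression M \<tau> X Y P "complex_of_real \<alpha>"
  for M :: "'h::complex_hilbert_space cop set" and \<tau> and X and Y and P and \<alpha> :: real +
  assumes alpha_pos: "0 < \<alpha>"
begin

text \<open>The value at \<open>(0, 0)\<close> is \<open>\<tau> P\<close>, which makes both formulas
  of \<open>tau_word_P\<close> true for all exponents.\<close>

definition moment :: "nat \<Rightarrow> nat \<Rightarrow> real \<Rightarrow> complex" where
  "moment m n t = (if m = 0 \<and> n = 0 then of_real \<alpha> else \<tau> ((P * Y t) ^ m * (P * star (Y t)) ^ n))"

lemma P_mult_pow: "0 < n \<Longrightarrow> P * (P * A) ^ n = (P * A) ^ n"
  by (cases n) (simp_all add: mult.assoc[symmetric])

lemma tau_word_P:
  assumes t: "0 \<le> t"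
  shows "\<tau> ((P * Y t) ^ m * (P * star (Y t)) ^ n * P) = moment m n t"
    and "\<tau> ((P * Y t) ^ m * P * (P * star (Y t)) ^ n) = moment m n t"
proof -
  let ?A = "P * Y t" and ?C = "P * star (Y t)"
  have M: "?A \<in> M" "?C \<in> M" using t by auto
  have "\<tau> (?A ^ m * ?C ^ n * P) = \<tau> (P * (?A ^ m * ?C ^ n))"
    using M by (intro tau_commute) auto
  also have "\<dots> = moment m n t"
    by (cases "m = 0"; cases "n = 0") (simp_all add: moment_def P_mult_pow mult.assoc[symmetric])
  finally show "\<tau> (?A ^ m * ?C ^ n * P) = moment m n t" .
  have "?A ^ m * P * ?C ^ n = ?A ^ m * ?C ^ n" if "n \<noteq> 0"
    using that by (simp add: P_mult_pow mult.assoc)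
  moreover have "\<tau> (?A ^ m * P) = moment m 0 t"
    using \<open>\<tau> (?A ^ m * ?C ^ n * P) = moment m n t\<close> M tau_commute[of "?A ^ m" P]
    by (cases "m = 0") (simp_all add: moment_def P_mult_pow)
  ultimately show "\<tau> (?A ^ m * P * ?C ^ n) = moment m n t"
    by (cases "n = 0") (simp_all add: moment_def)
qed

text \<open>Contracting a letter \<open>Y\<close> with a letter \<open>star Y\<close> splits the
  word into an inner part, closed by a \<open>P\<close> left over from the second letter, and an
  outer part, in which \<open>Y * star Y = 1\<close> leaves a \<open>P\<close> in the middle;
  \<open>tau_word_P\<close> identifies both traces. The minus signs of \<open>carre\<close> and of
  the gradient of \<open>star Y\<close> cancel. This term becomes the square of the generating
  function.\<close>

lemma tau_carre_word:
  assumes t: "0 \<le> t"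
  shows "\<tau> (carre (grad (path_pow PY m t)) (grad (path_pow PYstar n t)))
    = (\<Sum>i<m. \<Sum>j<n. moment (m - 1 - i) j t * moment i (n - 1 - j) t)"
proof -
  let ?A = "P * Y t" and ?C = "P * star (Y t)"
  have M [simp]: "?A \<in> M" "?C \<in> M" "Y t \<in> M" using t by auto
  have vals: "val (PY t) = ?A" "val (PYstar t) = ?C"
    and grads: "grad (PY t) = [(?A, 1)]" "grad (PYstar t) = [(- P, star (Y t))]"
    by (simp_all add: PY_def PYstar_def path_mult_def ito_mult_def path_const_def ito_const_def
        path_Y_def path_Ystar_def ito_Y_def ito_Ystar_def)
  have gm: "grad (path_pow PY m t) = map (\<lambda>i. (?A ^ Suc i, ?A ^ (m - 1 - i))) [0..<m]"
    unfolding path_pow_def using grad_pow_left[of "PY t" m] by (simp only: vals grads)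
  have gn: "grad (path_pow PYstar n t) = map (\<lambda>j. (- (?C ^ j * P), star (Y t) * ?C ^ (n - 1 - j))) [0..<n]"
    unfolding path_pow_def using grad_pow_right[of "PYstar t" P "star (Y t)" n] by (simp only: vals grads)
  have 1: "\<tau> (?A ^ k * (- (?C ^ j * P))) = - moment k j t" for k j
    using tau_word_P(1)[OF t, of k j] by (simp add: mult.assoc)
  have 2: "\<tau> (?A ^ Suc i * (star (Y t) * ?C ^ k)) = moment i k t" for i k
  proof -
    have "?A ^ Suc i * (star (Y t) * ?C ^ k) = ?A ^ i * (P * (Y t * star (Y t)) * ?C ^ k)"
      by (simp only: power_Suc2 mult.assoc)
    then show ?thesis using t tau_word_P(2)[OF t, of i k] by (simp add: mult.assoc)
  qed
  have "carre (grad (path_pow PY m t)) (grad (path_pow PYstar n t))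
    = - (\<Sum>i<m. \<Sum>j<n. \<tau> (?A ^ (m - 1 - i) * (- (?C ^ j * P))) *\<^sub>C (?A ^ Suc i * (star (Y t) * ?C ^ (n - 1 - j))))"
    unfolding carre_def gm gn
    by (simp add: comp_def interv_sum_list_conv_sum_set_nat atLeast0LessThan del: power_Suc)
  also have "\<dots> = (\<Sum>i<m. \<Sum>j<n. moment (m - 1 - i) j t *\<^sub>C (?A ^ Suc i * (star (Y t) * ?C ^ (n - 1 - j))))"
    unfolding 1 by (simp add: sum_negf)
  also have "\<tau> \<dots> = (\<Sum>i<m. \<Sum>j<n. moment (m - 1 - i) j t * moment i (n - 1 - j) t)"
    unfolding 2[symmetric] by (subst tau_sum, force intro!: M_sum) (simp add: tau_sum del: power_Suc)
  finally show ?thesis .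
qed

lemma moment_derivative:
  assumes t: "0 \<le> t" and mn: "m \<noteq> 0 \<or> n \<noteq> 0"
  shows "(moment m n has_vector_derivative
     (- (of_nat (m + n) / 2 * moment m n t)
      - (\<Sum>c<m. of_nat (m - 1 - c) * (moment (Suc c) 0 t * moment (m - 1 - c) n t))
      - (\<Sum>c<n. of_nat (n - 1 - c) * (moment 0 (Suc c) t * moment m (n - 1 - c) t))
      + (\<Sum>i<m. \<Sum>j<n. moment (m - 1 - i) j t * moment i (n - 1 - j) t))) (at t within {0..})"
proof -
  let ?A = "P * Y t" and ?C = "P * star (Y t)"
  have M [simp]: "?A \<in> M" "?C \<in> M" "Y t \<in> M" using t by auto
  have vals: "val (PY s) = P * Y s" "val (PYstar s) = P * star (Y s)" for s
    by (simp_all add: PY_def PYstar_def path_mult_def ito_mult_def path_const_def ito_const_def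
        path_Y_def path_Ystar_def ito_Y_def ito_Ystar_def)
  have grads: "grad (PY t) = [(?A, 1)]" "grad (PYstar t) = [(- P, star (Y t))]"
    and gens: "gen (PY t) = (- (1/2)) *\<^sub>C ?A" "gen (PYstar t) = (- (1/2)) *\<^sub>C ?C"
    by (simp_all add: PY_def PYstar_def path_mult_def ito_mult_def path_const_def ito_const_def
        path_Y_def path_Ystar_def ito_Y_def ito_Ystar_def)
  have gm: "gen (path_pow PY m t) = pow_gen ?A m"
    unfolding path_pow_def using gen_pow_left[of "PY t" m] by (simp only: vals grads gens)
  have gn: "gen (path_pow PYstar n t) = pow_gen ?C n"
    unfolding path_pow_def using gen_pow_right[of "PYstar t" P "star (Y t)" n]
    by (simp only: vals grads gens P_in_M M_star[OF M(3)])
  have val: "val ((path_pow PY m \<cdot> path_pow PYstar n) s) = (P * Y s) ^ m * (P * star (Y s)) ^ n" for s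
    by (simp add: path_mult_def ito_mult_def path_pow_def val_pow vals)
  have carre_M: "carre (grad (path_pow PY m t)) (grad (path_pow PYstar n t)) \<in> M"
  proof -
    have "path_wf PY" "path_wf PYstar" by (auto simp: PY_def PYstar_def intro!: path_wf_mult)
    then have "ito_wf (path_pow PY m t)" "ito_wf (path_pow PYstar n t)"
      using t by (simp_all add: path_wf_def path_pow_def ito_wf_pow)
    then show ?thesis by (intro carre_in_M ito_wfD)
  qed
  have pgM [simp]: "pow_gen A k \<in> M" if "A \<in> M" for A k
    unfolding pow_gen_def using that by (auto intro!: M_sum M_diff simp del: scaleC_minus_left)
  have m0: "\<tau> (?A ^ i * ?C ^ j) = moment i j t" if "i \<noteq> 0 \<or> j \<noteq> 0" for i j
    using that by (auto simp: moment_def)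
  have left: "\<tau> (pow_gen ?A m * ?C ^ n) = - (of_nat m / 2 * moment m n t)
      - (\<Sum>c<m. of_nat (m - 1 - c) * (moment (Suc c) 0 t * moment (m - 1 - c) n t))"
  proof -
    have "pow_gen ?A m * ?C ^ n = (- (of_nat m / 2)) *\<^sub>C (?A ^ m * ?C ^ n)
        - (\<Sum>c<m. (of_nat (m - 1 - c) * \<tau> (?A ^ Suc c)) *\<^sub>C (?A ^ (m - 1 - c) * ?C ^ n))"
      by (simp add: pow_gen_def left_diff_distrib sum_distrib_right del: scaleC_minus_left power_Suc)
    also have "\<tau> \<dots> = - (of_nat m / 2) * \<tau> (?A ^ m * ?C ^ n)
        - (\<Sum>c<m. (of_nat (m - 1 - c) * \<tau> (?A ^ Suc c)) * \<tau> (?A ^ (m - 1 - c) * ?C ^ n))"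
      by (subst tau_diff) (auto intro!: M_sum simp: tau_sum simp del: scaleC_minus_left power_Suc)
    also have "(\<Sum>c<m. (of_nat (m - 1 - c) * \<tau> (?A ^ Suc c)) * \<tau> (?A ^ (m - 1 - c) * ?C ^ n))
       = (\<Sum>c<m. of_nat (m - 1 - c) * (moment (Suc c) 0 t * moment (m - 1 - c) n t))"
    proof (rule sum.cong)
      fix c
      show "of_nat (m - 1 - c) * \<tau> (?A ^ Suc c) * \<tau> (?A ^ (m - 1 - c) * ?C ^ n)
        = of_nat (m - 1 - c) * (moment (Suc c) 0 t * moment (m - 1 - c) n t)"
        \<comment> \<open>For \<open>m - 1 - c = 0\<close> and \<open>n = 0\<close> the trace is 1
          and not \<open>moment 0 0\<close>, but then the coefficient is zero.\<close>
        using m0[of "Suc c" 0] m0[of "m - 1 - c" n] by (cases "m - 1 - c = 0") auto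
    qed simp
    finally show ?thesis using m0[OF mn] by simp
  qed
  have right: "\<tau> (?A ^ m * pow_gen ?C n) = - (of_nat n / 2 * moment m n t)
      - (\<Sum>c<n. of_nat (n - 1 - c) * (moment 0 (Suc c) t * moment m (n - 1 - c) t))"
  proof -
    have "?A ^ m * pow_gen ?C n = (- (of_nat n / 2)) *\<^sub>C (?A ^ m * ?C ^ n)
        - (\<Sum>c<n. (of_nat (n - 1 - c) * \<tau> (?C ^ Suc c)) *\<^sub>C (?A ^ m * ?C ^ (n - 1 - c)))"
      by (simp add: pow_gen_def right_diff_distrib sum_distrib_left del: scaleC_minus_left power_Suc)
    also have "\<tau> \<dots> = - (of_nat n / 2) * \<tau> (?A ^ m * ?C ^ n)
        - (\<Sum>c<n. (of_nat (n - 1 - c) * \<tau> (?C ^ Suc c)) * \<tau> (?A ^ m * ?C ^ (n - 1 - c)))"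
      by (subst tau_diff) (auto intro!: M_sum simp: tau_sum simp del: scaleC_minus_left power_Suc)
    also have "(\<Sum>c<n. (of_nat (n - 1 - c) * \<tau> (?C ^ Suc c)) * \<tau> (?A ^ m * ?C ^ (n - 1 - c)))
       = (\<Sum>c<n. of_nat (n - 1 - c) * (moment 0 (Suc c) t * moment m (n - 1 - c) t))"
    proof (rule sum.cong)
      fix c
      show "of_nat (n - 1 - c) * \<tau> (?C ^ Suc c) * \<tau> (?A ^ m * ?C ^ (n - 1 - c))
        = of_nat (n - 1 - c) * (moment 0 (Suc c) t * moment m (n - 1 - c) t)"
        using m0[of 0 "Suc c"] m0[of m "n - 1 - c"] by (cases "n - 1 - c = 0") auto
    qed simp
    finally show ?thesis using m0[OF mn] by simp
  qed
  have gen: "\<tau> (gen ((path_pow PY m \<cdot> path_pow PYstar n) t)) = \<tau> (pow_gen ?A m * ?C ^ n) + \<tau> (?A ^ m * pow_gen ?C n)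
      + \<tau> (carre (grad (path_pow PY m t)) (grad (path_pow PYstar n t)))"
  proof -
    have "gen ((path_pow PY m \<cdot> path_pow PYstar n) t) = pow_gen ?A m * ?C ^ n + ?A ^ m * pow_gen ?C n
        + carre (grad (path_pow PY m t)) (grad (path_pow PYstar n t))"
      by (simp only: path_mult_def ito_mult_def gm gn ito.sel) (simp add: path_pow_def val_pow vals)
    then show ?thesis using carre_M by simp
  qed
  have "((\<lambda>s. \<tau> ((P * Y s) ^ m * (P * star (Y s)) ^ n)) has_vector_derivative
      \<tau> (gen ((path_pow PY m \<cdot> path_pow PYstar n) t))) (at t within {0..})"
    using reducible_has_tau_derivative[OF reducible_word[of m n]] t
    unfolding has_tau_derivative_def val by blast
  moreover have "moment m n = (\<lambda>s. \<tau> ((P * Y s) ^ m * (P * star (Y s)) ^ n))"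
    using mn by (auto simp: moment_def fun_eq_iff)
  ultimately show ?thesis
    unfolding gen left right tau_carre_word[OF t] by (simp add: algebra_simps add_divide_distrib)
qed

section \<open>Exponentially rescaled moments\<close>

lemma exp_scaled_derivative:
  fixes f :: "real \<Rightarrow> complex"
  assumes "(f has_vector_derivative f') (at t within S)"
  shows "((\<lambda>s. of_real (exp (c * s)) * f s) has_vector_derivative of_real (exp (c * t)) * (of_real c * f t + f')) (at t within S)"
proof -
  have "((\<lambda>s. exp (c * s)) has_real_derivative c * exp (c * t)) (at t within S)"
    by (auto intro!: derivative_eq_intros)
  then have "((\<lambda>s. complex_of_real (exp (c * s))) has_vector_derivative of_real (c * exp (c * t))) (at t within S)"
    by (intro has_vector_derivative_of_real) (simp add: has_real_derivative_iff_has_vector_derivative)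
  from has_vector_derivative_mult[OF this assms] show ?thesis
    by (simp add: algebra_simps)
qed

abbreviation R :: "nat \<Rightarrow> nat \<Rightarrow> real \<Rightarrow> complex" where "R \<equiv> R_mom \<tau> \<alpha> P Y"
abbreviation Q :: "nat \<Rightarrow> real \<Rightarrow> complex" where "Q \<equiv> Q_mom \<tau> Y"

lemma R_eq: "R m n t = of_real (exp (real (m + n) / 2 * t)) * moment m n t"
  by (simp add: R_mom_def moment_def mult.commute)

lemma mult_rearrange: "k * ((x * a) * (y * b)) = x * y * (k * (a * b))" for k x y a b :: complex
  by (simp add: mult_ac)

lemma mult_rearrange3: "k * ((x * a) * (y * b)) = k * x * y * (a * b)" for k x y a b :: complex
  by (simp add: mult_ac)

text \<open>The rescaling cancels the linear terms with coefficient \<open>(m + n) / 2\<close>.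
  Products in the last two sums have \<open>m + n\<close> letters in total, so their weights agree;
  in the first sum the contracted pair of letters is gone, and \<open>exp t\<close> makes up for the
  two missing half units.\<close>

definition R_deriv :: "nat \<Rightarrow> nat \<Rightarrow> real \<Rightarrow> complex" where
  "R_deriv m n t = of_real (exp t) * (\<Sum>i<m. \<Sum>j<n. R (m - 1 - i) j t * R i (n - 1 - j) t)
      - (\<Sum>c<m. of_nat (m - 1 - c) * (R (Suc c) 0 t * R (m - 1 - c) n t))
      - (\<Sum>c<n. of_nat (n - 1 - c) * (R 0 (Suc c) t * R m (n - 1 - c) t))"

theorem R_has_derivative:
  assumes t: "0 \<le> t"
  shows "(R m n has_vector_derivative R_deriv m n t) (at t within {0..})"
proof (cases "m = 0 \<and> n = 0")
  case True
  then have "R m n = (\<lambda>s. of_real \<alpha>)" by (simp add: R_mom_def fun_eq_iff)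
  moreover have "R_deriv m n t = 0" using True by (simp add: R_deriv_def)
  ultimately show ?thesis by simp
next
  case False
  define e where "e k = complex_of_real (exp (real k / 2 * t))" for k :: nat
  have e_add: "e j * e k = e (j + k)" for j k
    by (simp add: e_def exp_add[symmetric] add_divide_distrib distrib_right flip: of_real_mult)
  have Re: "R i j t = e (i + j) * moment i j t" for i j
    by (simp add: R_eq e_def)
  have e2: "complex_of_real (exp t) = e 2" by (simp add: e_def)
  define E where "E = e (m + n)"
  have 1: "(\<Sum>c<m. of_nat (m - 1 - c) * (R (Suc c) 0 t * R (m - 1 - c) n t))
      = E * (\<Sum>c<m. of_nat (m - 1 - c) * (moment (Suc c) 0 t * moment (m - 1 - c) n t))"
    unfolding sum_distrib_left
  proof (rule sum.cong)
    fix c assume "c \<in> {..<m}"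
    then have "Suc c + 0 + (m - 1 - c + n) = m + n" by simp
    then have "e (Suc c + 0) * e (m - 1 - c + n) = E" unfolding e_add E_def by (simp only:)
    then show "of_nat (m - 1 - c) * (R (Suc c) 0 t * R (m - 1 - c) n t)
      = E * (of_nat (m - 1 - c) * (moment (Suc c) 0 t * moment (m - 1 - c) n t))"
      unfolding Re mult_rearrange by (simp only:)
  qed simp
  have 2: "(\<Sum>c<n. of_nat (n - 1 - c) * (R 0 (Suc c) t * R m (n - 1 - c) t))
      = E * (\<Sum>c<n. of_nat (n - 1 - c) * (moment 0 (Suc c) t * moment m (n - 1 - c) t))"
    unfolding sum_distrib_left
  proof (rule sum.cong)
    fix c assume "c \<in> {..<n}"
    then have "0 + Suc c + (m + (n - 1 - c)) = m + n" by simp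
    then have "e (0 + Suc c) * e (m + (n - 1 - c)) = E" unfolding e_add E_def by (simp only:)
    then show "of_nat (n - 1 - c) * (R 0 (Suc c) t * R m (n - 1 - c) t)
      = E * (of_nat (n - 1 - c) * (moment 0 (Suc c) t * moment m (n - 1 - c) t))"
      unfolding Re mult_rearrange by (simp only:)
  qed simp
  have 3: "of_real (exp t) * (\<Sum>i<m. \<Sum>j<n. R (m - 1 - i) j t * R i (n - 1 - j) t)
      = E * (\<Sum>i<m. \<Sum>j<n. moment (m - 1 - i) j t * moment i (n - 1 - j) t)"
    unfolding sum_distrib_left
  proof (intro sum.cong refl)
    fix i j assume "i \<in> {..<m}" "j \<in> {..<n}"
    then have "2 + (m - 1 - i + j) + (i + (n - 1 - j)) = m + n" by auto
    then have "e 2 * e (m - 1 - i + j) * e (i + (n - 1 - j)) = E" unfolding e_add E_def by (simp only:)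
    then show "of_real (exp t) * (R (m - 1 - i) j t * R i (n - 1 - j) t)
      = E * (moment (m - 1 - i) j t * moment i (n - 1 - j) t)"
      unfolding Re e2 mult_rearrange3 by (simp only:)
  qed
  have "R m n = (\<lambda>s. of_real (exp (real (m + n) / 2 * s)) * moment m n s)"
    by (simp add: R_eq fun_eq_iff)
  moreover have "R_deriv m n t = of_real (exp (real (m + n) / 2 * t)) * (of_real (real (m + n) / 2) * moment m n t
     + (- (of_nat (m + n) / 2 * moment m n t)
      - (\<Sum>c<m. of_nat (m - 1 - c) * (moment (Suc c) 0 t * moment (m - 1 - c) n t))
      - (\<Sum>c<n. of_nat (n - 1 - c) * (moment 0 (Suc c) t * moment m (n - 1 - c) t))
      + (\<Sum>i<m. \<Sum>j<n. moment (m - 1 - i) j t * moment i (n - 1 - j) t)))"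
    unfolding R_deriv_def 1 2 3 E_def e_def by (simp add: right_diff_distrib distrib_left)
  ultimately show ?thesis
    using exp_scaled_derivative[OF moment_derivative[OF t, of m n], of "real (m + n) / 2"] False
    by simp
qed

lemma Q_has_derivative:
  assumes t: "0 \<le> t"
  shows "(Q l has_vector_derivative - (\<Sum>c<l. of_nat (l - 1 - c) * (Q (Suc c) t * Q (l - 1 - c) t))) (at t within {0..})"
proof -
  define e where "e k = complex_of_real (exp (real k / 2 * t))" for k :: nat
  have e_add: "e j * e k = e (j + k)" for j k
    by (simp add: e_def exp_add[symmetric] add_divide_distrib distrib_right flip: of_real_mult)
  have Qe: "Q k t = e k * q k t" for k
    by (simp add: Q_mom_def q_def e_def)
  have 1: "(\<Sum>c<l. of_nat (l - 1 - c) * (Q (Suc c) t * Q (l - 1 - c) t))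
      = e l * (\<Sum>c<l. of_nat (l - 1 - c) * (q (Suc c) t * q (l - 1 - c) t))"
    unfolding sum_distrib_left
  proof (rule sum.cong)
    fix c assume "c \<in> {..<l}"
    then have "Suc c + (l - 1 - c) = l" by simp
    then have "e (Suc c) * e (l - 1 - c) = e l" unfolding e_add by (simp only:)
    then show "of_nat (l - 1 - c) * (Q (Suc c) t * Q (l - 1 - c) t) = e l * (of_nat (l - 1 - c) * (q (Suc c) t * q (l - 1 - c) t))"
      unfolding Qe mult_rearrange by (simp only:)
  qed simp
  have "Q l = (\<lambda>s. of_real (exp (real l / 2 * s)) * q l s)"
    by (simp add: Q_mom_def q_def fun_eq_iff)
  moreover have "of_real (exp (real l / 2 * t)) * (of_real (real l / 2) * q l t + drift l t)
     = - (\<Sum>c<l. of_nat (l - 1 - c) * (Q (Suc c) t * Q (l - 1 - c) t))"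
    unfolding 1 drift_def by (simp add: e_def)
  ultimately show ?thesis
    using exp_scaled_derivative[OF q_has_derivative[OF t, of l], of "real l / 2"] by simp
qed

text \<open>The quadratic system is invariant under this scaling: the outer \<alpha> and the inner
  derivative give \<alpha> squared, one factor for each \<open>Q\<close> in the product.\<close>

lemma scaled_Q_has_derivative:
  assumes t: "0 \<le> t"
  defines "g \<equiv> \<lambda>l s. of_real \<alpha> * Q l (\<alpha> * s)"
  shows "(g l has_vector_derivative - (\<Sum>c<l. of_nat (l - 1 - c) * (g (Suc c) t * g (l - 1 - c) t))) (at t within {0..})"
proof -
  let ?S = "\<Sum>c<l. of_nat (l - 1 - c) * (Q (Suc c) (\<alpha> * t) * Q (l - 1 - c) (\<alpha> * t))"
  have "((\<lambda>s. \<alpha> * s) has_vector_derivative \<alpha>) (at t within {0..})"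
    by (auto intro!: derivative_eq_intros simp: has_real_derivative_iff_has_vector_derivative[symmetric])
  moreover have "(Q l has_vector_derivative - ?S) (at (\<alpha> * t) within (\<lambda>s. \<alpha> * s) ` {0..})"
    by (rule has_vector_derivative_within_subset[OF Q_has_derivative]) (use alpha_pos t in auto)
  ultimately have "((Q l \<circ> (\<lambda>s. \<alpha> * s)) has_vector_derivative \<alpha> *\<^sub>R (- ?S)) (at t within {0..})"
    by (rule vector_diff_chain_within)
  from has_vector_derivative_mult_right[OF this, of "of_real \<alpha>"]
  have "(g l has_vector_derivative of_real \<alpha> * (\<alpha> *\<^sub>R (- ?S))) (at t within {0..})"
    by (simp add: g_def comp_def)
  moreover have "of_real \<alpha> * (\<alpha> *\<^sub>R (- ?S)) = - (\<Sum>c<l. of_nat (l - 1 - c) * (g (Suc c) t * g (l - 1 - c) t))"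
    by (simp add: g_def scaleR_conv_of_real sum_distrib_left algebra_simps)
  ultimately show ?thesis by simp
qed

lemma P_pow: "0 < l \<Longrightarrow> P ^ l = P"
proof (induction l)
  case (Suc l)
  then show ?case by (cases "l = 0") simp_all
qed simp

lemma R_left_eq: "1 \<le> l \<Longrightarrow> 0 \<le> t \<Longrightarrow> R l 0 t = of_real \<alpha> * Q l (\<alpha> * t)"
proof (rule quadratic_hierarchy_unique[where f = "\<lambda>l. R l 0" and g = "\<lambda>l s. of_real \<alpha> * Q l (\<alpha> * s)"])
  show "(R l 0 has_vector_derivative - (\<Sum>c<l. of_nat (l - 1 - c) * (R (Suc c) 0 t * R (l - 1 - c) 0 t))) (at t within {0..})"
    if "0 \<le> t" for l t
    using R_has_derivative[OF that, of l 0] by (simp add: R_deriv_def)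
  show "R l 0 0 = of_real \<alpha> * Q l (\<alpha> * 0)" if "1 \<le> l" for l
    using that P_pow[of l] by (simp add: R_mom_def Q_mom_def)
qed (use scaled_Q_has_derivative in auto)

lemma R_right_eq: "1 \<le> l \<Longrightarrow> 0 \<le> t \<Longrightarrow> R 0 l t = of_real \<alpha> * Q l (\<alpha> * t)"
proof (rule quadratic_hierarchy_unique[where f = "\<lambda>l. R 0 l" and g = "\<lambda>l s. of_real \<alpha> * Q l (\<alpha> * s)"])
  show "(R 0 l has_vector_derivative - (\<Sum>c<l. of_nat (l - 1 - c) * (R 0 (Suc c) t * R 0 (l - 1 - c) t))) (at t within {0..})"
    if "0 \<le> t" for l t
    using R_has_derivative[OF that, of 0 l] by (simp add: R_deriv_def)
  show "R 0 l 0 = of_real \<alpha> * Q l (\<alpha> * 0)" if "1 \<le> l" for l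
    using that P_pow[of l] by (simp add: R_mom_def Q_mom_def)
qed (use scaled_Q_has_derivative in auto)

lemma norm_R_le:
  assumes t: "0 \<le> t" and a: "\<alpha> \<le> 1"
  shows "cmod (R m n t) \<le> exp (t / 2) ^ (m + n)"
proof -
  have nP: "norm P \<le> 1" by (rule norm_le_one_projection) auto
  have nYs: "norm (star (Y t)) \<le> 1" using norm_star_le[of "Y t"] norm_Y[OF t] by simp
  have "cmod (\<tau> ((P * Y t) ^ m * (P * star (Y t)) ^ n)) \<le> norm ((P * Y t) ^ m * (P * star (Y t)) ^ n)"
    using t by (intro cmod_tau_le_norm) auto
  also have "\<dots> \<le> 1"
    by (intro norm_mult_le_one norm_power_le_one nP norm_Y[OF t] nYs)
  finally have "cmod (moment m n t) \<le> 1" using a alpha_pos by (simp add: moment_def)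
  then have "cmod (R m n t) \<le> exp (real (m + n) / 2 * t)"
    using mult_left_mono[of "cmod (moment m n t)" 1 "exp (real (m + n) / 2 * t)"] unfolding R_eq norm_mult by simp
  also have "\<dots> = exp (t / 2) ^ (m + n)"
    by (simp add: exp_of_nat_mult[symmetric])
  finally show ?thesis .
qed

lemma norm_Q_le: "0 \<le> t \<Longrightarrow> cmod (Q n t) \<le> exp (t / 2) ^ n"
proof -
  assume t: "0 \<le> t"
  have "cmod (\<tau> (Y t ^ n)) \<le> norm (Y t ^ n)"
    using t by (intro cmod_tau_le_norm) auto
  also have "\<dots> \<le> 1" by (intro norm_power_le_one norm_Y[OF t])
  finally have "cmod (Q n t) \<le> exp (real n * t / 2)"
    using mult_left_mono[of "cmod (\<tau> (Y t ^ n))" 1 "exp (real n * t / 2)"] by (simp add: Q_mom_def norm_mult)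
  also have "\<dots> = exp (t / 2) ^ n" by (simp add: exp_of_nat_mult[symmetric])
  finally show ?thesis .
qed

end

section \<open>The generating function\<close>

no_notation Infinite_Set_Sum.abs_summable_on (infix \<open>abs'_summable'_on\<close> 50)

section \<open>Termwise differentiation and regrouping of double sums\<close>

lemma infsum_pair_sums:
  fixes g :: "nat \<times> nat \<Rightarrow> complex"
  assumes "g summable_on UNIV"
  shows "(\<lambda>n. g (prod_decode n)) sums infsum g UNIV"
proof (rule has_sum_imp_sums)
  have "(g has_sum infsum g UNIV) UNIV" using assms by (rule has_sum_infsum)
  then show "((\<lambda>n. g (prod_decode n)) has_sum infsum g UNIV) UNIV"
    using has_sum_reindex_bij_betw[OF bij_prod_decode, of g] by simp
qed

text \<open>The unordered sum is read as a series along \<open>prod_decode\<close>. The summable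
  majorant \<open>B\<close> makes the series of derivatives converge uniformly on \<open>S\<close>,
  as the termwise differentiation theorem requires.\<close>

lemma infsum_has_derivative:
  fixes f :: "nat \<times> nat \<Rightarrow> 'a::real_normed_vector \<Rightarrow> complex"
  assumes S: "convex S"
    and deriv: "\<And>i x. x \<in> S \<Longrightarrow> (f i has_derivative f' i x) (at x within S)"
    and bound: "\<And>i x h. x \<in> S \<Longrightarrow> norm (f' i x h) \<le> B i * norm h"
    and B: "B summable_on UNIV" "\<And>i. 0 \<le> B i"
    and sum: "\<And>x. x \<in> S \<Longrightarrow> (\<lambda>i. f i x) abs_summable_on UNIV"
    and x: "x \<in> S"
  shows "((\<lambda>x. infsum (\<lambda>i. f i x) UNIV) has_derivative (\<lambda>h. infsum (\<lambda>i. f' i x h) UNIV)) (at x within S)"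
proof -
  define b where "b n = B (prod_decode n)" for n
  have "b summable_on UNIV"
    unfolding b_def[abs_def] using B(1) summable_on_reindex_bij_betw[OF bij_prod_decode, of B] by simp
  then have b: "summable b" by (rule summable_on_imp_summable)
  have f_sums: "(\<lambda>n. f (prod_decode n) x) sums infsum (\<lambda>i. f i x) UNIV" if "x \<in> S" for x
    using sum[OF that] by (rule infsum_pair_sums[OF abs_summable_summable])
  have f'_sums: "(\<lambda>n. f' (prod_decode n) x h) sums infsum (\<lambda>i. f' i x h) UNIV" if "x \<in> S" for x h
  proof -
    have "(\<lambda>i. B i * norm h) summable_on UNIV" using B(1) by (rule summable_on_cmult_left)
    then have "(\<lambda>i. f' i x h) abs_summable_on UNIV"
      by (rule summable_on_comparison_test) (use bound[OF that] in auto)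
    then show ?thesis by (rule infsum_pair_sums[OF abs_summable_summable])
  qed
  have "\<exists>g. \<forall>x\<in>S. (\<lambda>n. f (prod_decode n) x) sums g x \<and>
      (g has_derivative (\<lambda>h. infsum (\<lambda>i. f' i x h) UNIV)) (at x within S)"
  proof (rule has_derivative_series[where f = "\<lambda>n. f (prod_decode n)" and f' = "\<lambda>n. f' (prod_decode n)"
        and g' = "\<lambda>x h. infsum (\<lambda>i. f' i x h) UNIV", OF S _ _ x f_sums[OF x]])
    show "(f (prod_decode n) has_derivative f' (prod_decode n) x) (at x within S)" if "x \<in> S" for n x
      by (rule deriv[OF that])
    fix e :: real assume "e > 0"
    then obtain N where N: "\<And>n. n \<ge> N \<Longrightarrow> norm (\<Sum>i. b (i + n)) < e"
      using suminf_exist_split[OF _ b] by blast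
    have "norm ((\<Sum>i<n. f' (prod_decode i) x h) - infsum (\<lambda>i. f' i x h) UNIV) \<le> e * norm h"
      if n: "n \<ge> N" and x: "x \<in> S" for n x h
    proof -
      have "infsum (\<lambda>i. f' i x h) UNIV - (\<Sum>i<n. f' (prod_decode i) x h) = (\<Sum>i. f' (prod_decode (i + n)) x h)"
        using suminf_minus_initial_segment[of "\<lambda>i. f' (prod_decode i) x h" n] f'_sums[OF x, of h]
        by (simp add: sums_iff)
      then have "norm ((\<Sum>i<n. f' (prod_decode i) x h) - infsum (\<lambda>i. f' i x h) UNIV)
          = norm (\<Sum>i. f' (prod_decode (i + n)) x h)"
        by (simp add: norm_minus_commute)
      also have "\<dots> \<le> (\<Sum>i. b (i + n) * norm h)"
        by (intro norm_suminf_le summable_mult2 summable_ignore_initial_segment b)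
          (simp only: b_def bound[OF x])
      also have "\<dots> = (\<Sum>i. b (i + n)) * norm h"
        by (intro suminf_mult2[symmetric] summable_ignore_initial_segment b)
      also have "\<dots> \<le> e * norm h"
        using N[OF n] by (intro mult_right_mono) auto
      finally show ?thesis .
    qed
    then show "\<forall>\<^sub>F n in sequentially. \<forall>x\<in>S. \<forall>h.
        norm ((\<Sum>i<n. f' (prod_decode i) x h) - infsum (\<lambda>i. f' i x h) UNIV) \<le> e * norm h"
      unfolding eventually_sequentially by blast
  qed
  then obtain g where g: "\<And>x. x \<in> S \<Longrightarrow> (\<lambda>n. f (prod_decode n) x) sums g x"
    "\<And>x. x \<in> S \<Longrightarrow> (g has_derivative (\<lambda>h. infsum (\<lambda>i. f' i x h) UNIV)) (at x within S)" by blast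
  have "infsum (\<lambda>i. f i x) UNIV = g x" if "x \<in> S" for x
    using sums_unique2[OF f_sums[OF that] g(1)[OF that]] .
  then show ?thesis
    using g(2)[OF x] x by (auto elim!: has_derivative_transform[rotated 2])
qed

lemma
  fixes f :: "'a \<Rightarrow> 'c::{real_normed_field, banach}" and g :: "'b \<Rightarrow> 'c"
  assumes f: "f abs_summable_on A" and g: "g abs_summable_on B"
  shows abs_summable_on_times: "(\<lambda>(a, b). f a * g b) abs_summable_on A \<times> B"
    and infsum_mult_infsum: "infsum f A * infsum g B = infsum (\<lambda>(a, b). f a * g b) (A \<times> B)"
proof -
  show abs: "(\<lambda>(a, b). f a * g b) abs_summable_on A \<times> B"
    unfolding Infinite_Sum.abs_summable_on_Sigma_iff
  proof (intro conjI ballI)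
    show "(\<lambda>b. case (a, b) of (a, b) \<Rightarrow> f a * g b) abs_summable_on B" for a
      using summable_on_cmult_right[OF g, of "norm (f a)"] by (simp add: norm_mult)
    have "(\<Sum>\<^sub>\<infinity>b\<in>B. norm (f a * g b)) = norm (f a) * (\<Sum>\<^sub>\<infinity>b\<in>B. norm (g b))" for a
      by (simp add: norm_mult infsum_cmult_right')
    then show "(\<lambda>a. \<Sum>\<^sub>\<infinity>b\<in>B. norm (case (a, b) of (a, b) \<Rightarrow> f a * g b)) abs_summable_on A"
      using summable_on_cmult_left[OF f, of "\<bar>\<Sum>\<^sub>\<infinity>b\<in>B. norm (g b)\<bar>"] by (simp add: abs_mult)
  qed
  have "infsum (\<lambda>(a, b). f a * g b) (A \<times> B) = (\<Sum>\<^sub>\<infinity>a\<in>A. \<Sum>\<^sub>\<infinity>b\<in>B. f a * g b)"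
    using infsum_Sigma_banach[OF abs_summable_summable[OF abs]] by simp
  also have "\<dots> = infsum f A * infsum g B"
    by (simp add: infsum_cmult_right' infsum_cmult_left')
  finally show "infsum f A * infsum g B = infsum (\<lambda>(a, b). f a * g b) (A \<times> B)" by simp
qed

text \<open>\<open>J k\<close> enumerates the terms that contribute to the monomial with exponent
  pair \<open>k\<close>, and \<open>h\<close> recovers the original index, as in a Cauchy
  product.\<close>

lemma
  fixes F :: "'a \<Rightarrow> complex"
  assumes F: "F abs_summable_on A" and h: "bij_betw h (Sigma UNIV J) A" and J: "\<And>k. finite (J k)"
  shows summable_on_regroup: "(\<lambda>k. \<Sum>j\<in>J k. F (h (k, j))) summable_on UNIV"
    and infsum_regroup_eq: "infsum F A = (\<Sum>\<^sub>\<infinity>k. \<Sum>j\<in>J k. F (h (k, j)))"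
proof -
  have "F summable_on A" using F by (rule abs_summable_summable)
  then have sum: "(\<lambda>x. F (h x)) summable_on Sigma UNIV J"
    using summable_on_reindex_bij_betw[OF h, of F] by simp
  show "(\<lambda>k. \<Sum>j\<in>J k. F (h (k, j))) summable_on UNIV"
    using summable_on_Sigma_banach[of "\<lambda>k j. F (h (k, j))" UNIV J] sum J by (simp add: case_prod_unfold)
  show "infsum F A = (\<Sum>\<^sub>\<infinity>k. \<Sum>j\<in>J k. F (h (k, j)))"
    using infsum_Sigma_banach[OF sum] infsum_reindex_bij_betw[OF h, of F] J by simp
qed

lemma mult_swap_eq: "y * d = s \<Longrightarrow> a * y * e * d = a * e * s" for y d s a e :: complex
  by auto

lemma infsum_linear_combination:
  fixes f g h :: "'a \<Rightarrow> complex"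
  assumes "f summable_on A" "g summable_on A" "h summable_on A"
  shows "infsum (\<lambda>k. c * f k - g k - h k) A = c * infsum f A - infsum g A - infsum h A"
proof (rule infsumI)
  have "((\<lambda>k. c * f k + - g k + - h k) has_sum (c * infsum f A + - infsum g A + - infsum h A)) A"
    using assms by (intro has_sum_add has_sum_cmult_right has_sum_uminusI has_sum_infsum)
  then show "((\<lambda>k. c * f k - g k - h k) has_sum (c * infsum f A - infsum g A - infsum h A)) A"
    by simp
qed

lemma summable_on_half_powers: "(\<lambda>(m, n). (1/2) ^ (m + n) :: real) summable_on (UNIV :: (nat \<times> nat) set)"
proof -
  have "(\<lambda>n. (1/2 :: real) ^ n) summable_on UNIV"
    by (subst summable_on_UNIV_nonneg_real_iff) auto
  then have "(\<lambda>n. (1/2 :: real) ^ n) abs_summable_on UNIV" by simp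
  from abs_summable_summable[OF abs_summable_on_times[OF this this]] show ?thesis
    by (simp add: power_add case_prod_unfold)
qed

lemma square_le_four_power: "real N * real N \<le> 4 ^ N"
proof -
  have "real N \<le> 2 ^ N" using of_nat_less_two_power[of N, where 'a = real] by simp
  then have "real N * real N \<le> 2 ^ N * 2 ^ N" by (intro mult_mono) auto
  then show ?thesis by (simp flip: power_mult_distrib)
qed

text \<open>Differentiation costs a weight of at most \<open>N ^ 2 \<le> 4 ^ N\<close>; this fixes
  the radius \<open>1 / (8 * K)\<close> below, because a ratio of \<open>4 / 8 = 1 / 2\<close>
  remains.\<close>

lemma weighted_eighth_power_le: "real N * real N * (1/8) ^ N \<le> (1/2) ^ N"
proof -
  have "real N * real N * (1/8) ^ N \<le> 4 ^ N * (1/8) ^ N"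
    using square_le_four_power by (intro mult_right_mono) auto
  then show ?thesis by (simp flip: power_mult_distrib)
qed

section \<open>Geometric bounds within the radius of convergence\<close>

context
  fixes K :: real
  assumes K1: "1 \<le> K"
begin

lemma powers_bound:
  assumes "cmod v < 1 / (8 * K)" "cmod w < 1 / (8 * K)"
  shows "K ^ (m + n) * (cmod v ^ m * cmod w ^ n) \<le> (1/8) ^ (m + n)"
proof -
  have "cmod v ^ m * cmod w ^ n \<le> (1 / (8 * K)) ^ m * (1 / (8 * K)) ^ n"
    using assms K1 by (intro mult_mono power_mono) auto
  then have "K ^ (m + n) * (cmod v ^ m * cmod w ^ n) \<le> K ^ (m + n) * (1 / (8 * K)) ^ (m + n)"
    using K1 by (simp only: power_add) (intro mult_left_mono; simp)
  also have "\<dots> = (1/8) ^ (m + n)"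
    using K1 by (simp add: power_mult_distrib[symmetric])
  finally show ?thesis .
qed

lemma weight_le: "c * (1/8) ^ (m + n) \<le> (1/2) ^ (m + n)"
  if "c \<le> real (m + n) * real (m + n) \<or> c \<le> 1" for c :: real
proof (cases "c \<le> 1")
  case True
  have "c * (1/8) ^ (m + n) \<le> 1 * (1/8) ^ (m + n)" using True by (intro mult_right_mono) auto
  also have "\<dots> \<le> (1/2) ^ (m + n)" unfolding mult_1 by (intro power_mono) auto
  finally show ?thesis .
next
  case False
  then have "c * (1/8) ^ (m + n) \<le> real (m + n) * real (m + n) * (1/8) ^ (m + n)"
    using that by (intro mult_right_mono) auto
  then show ?thesis using weighted_eighth_power_le[of "m + n"] by linarith
qed

lemma term_bound:
  assumes "cmod r \<le> c * K ^ (m + n)" "c \<le> real (m + n) * real (m + n) \<or> c \<le> 1" "0 \<le> c"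
    "cmod v < 1 / (8 * K)" "cmod w < 1 / (8 * K)"
  shows "cmod (r * v ^ m * w ^ n) \<le> (1/2) ^ (m + n)"
proof -
  have "cmod (r * v ^ m * w ^ n) = cmod r * (cmod v ^ m * cmod w ^ n)"
    by (simp add: norm_mult norm_power)
  also have "\<dots> \<le> c * K ^ (m + n) * (cmod v ^ m * cmod w ^ n)"
    using assms by (intro mult_right_mono) auto
  also have "\<dots> = c * (K ^ (m + n) * (cmod v ^ m * cmod w ^ n))" by (simp only: mult.assoc)
  also have "\<dots> \<le> c * (1/8) ^ (m + n)"
    using assms by (intro mult_left_mono powers_bound)
  also have "\<dots> \<le> (1/2) ^ (m + n)" by (rule weight_le[OF assms(2)])
  finally show ?thesis .
qed

lemma abs_summable_half:
  assumes "\<And>m n. cmod (f (m, n)) \<le> (1/2) ^ (m + n)"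
  shows "f abs_summable_on UNIV"
  by (rule summable_on_comparison_test[OF summable_on_half_powers]) (use assms in auto)

lemma double_series_abs_summable:
  fixes a :: "nat \<Rightarrow> nat \<Rightarrow> complex"
  assumes "\<And>m n. cmod (a m n) \<le> K ^ (m + n)" "cmod v < 1 / (8 * K)" "cmod w < 1 / (8 * K)"
  shows "(\<lambda>(m, n). a m n * v ^ m * w ^ n) abs_summable_on UNIV"
  by (rule abs_summable_half, unfold prod.case) (rule term_bound[where c = 1], use assms in auto)

text \<open>Lowering the exponent of the first variable gives up one factor
  \<open>1 / (8 * K)\<close>, hence the majorant \<open>8 * K * (1/2) ^ (m + n)\<close>.\<close>

lemma double_series_derivative:
  fixes a :: "nat \<Rightarrow> nat \<Rightarrow> complex"
  assumes a: "\<And>m n. cmod (a m n) \<le> K ^ (m + n)"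
    and y: "cmod y < 1 / (8 * K)" and z: "cmod z < 1 / (8 * K)"
  shows "((\<lambda>w. \<Sum>\<^sub>\<infinity>(m, n). a m n * w ^ m * z ^ n) has_field_derivative (\<Sum>\<^sub>\<infinity>(m, n). a m n * (of_nat m * y ^ (m - 1)) * z ^ n)) (at y)"
proof -
  define d where "d w i = (case i of (m, n) \<Rightarrow> a m n * (of_nat m * w ^ (m - 1)) * z ^ n)" for w and i :: "nat \<times> nat"
  let ?S = "ball (0::complex) (1 / (8 * K))"
  have d: "cmod (d w (m, n)) \<le> 8 * K * (1/2) ^ (m + n)" if "w \<in> ?S" for w m n
  proof (cases m)
    case (Suc k)
    have "cmod (d w (m, n)) = real m * (cmod (a m n) * (cmod w ^ k * cmod z ^ n))"
      by (simp add: d_def Suc norm_mult norm_power del: of_nat_Suc)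
    also have "\<dots> \<le> real m * (K ^ (m + n) * (cmod w ^ k * cmod z ^ n))"
      by (intro mult_left_mono mult_right_mono a) auto
    also have "\<dots> = real m * (K * (K ^ (k + n) * (cmod w ^ k * cmod z ^ n)))"
      by (simp add: Suc)
    also have "\<dots> \<le> real m * (K * (1/8) ^ (k + n))"
      using that K1 z by (intro mult_left_mono powers_bound) auto
    also have "\<dots> = 8 * K * (real m * (1/8) ^ (m + n))" by (simp add: Suc)
    also have "\<dots> \<le> 8 * K * (1/2) ^ (m + n)"
    proof -
      have "m \<le> (m + n) * (m + n)" using le_square[of "m + n"] by linarith
      then have "real m \<le> real (m + n) * real (m + n)" by (metis of_nat_le_iff of_nat_mult)
      then show ?thesis using K1 by (intro mult_left_mono weight_le) auto
    qed
    finally show ?thesis .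
  qed (use K1 in \<open>simp add: d_def\<close>)
  have "((\<lambda>w. infsum (\<lambda>i. case i of (m, n) \<Rightarrow> a m n * w ^ m * z ^ n) UNIV) has_derivative
      (\<lambda>h. infsum (\<lambda>i. d y i * h) UNIV)) (at y within ?S)"
  proof (rule infsum_has_derivative[where B = "\<lambda>i. 8 * K * (case i of (m, n) \<Rightarrow> (1/2) ^ (m + n))"])
    fix i :: "nat \<times> nat" and w assume w: "w \<in> ?S"
    obtain m n where i: "i = (m, n)" by (cases i)
    have "((\<lambda>w. a m n * w ^ m * z ^ n) has_field_derivative d w i) (at w within ?S)"
      by (auto intro!: derivative_eq_intros simp: d_def i)
    then show "((\<lambda>w. case i of (m, n) \<Rightarrow> a m n * w ^ m * z ^ n) has_derivative (\<lambda>h. d w i * h)) (at w within ?S)"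
      by (simp add: i has_field_derivative_def)
    show "norm (d w i * h) \<le> (8 * K * (case i of (m, n) \<Rightarrow> (1/2) ^ (m + n))) * norm h" for h
      using mult_right_mono[OF d[OF w, of m n], of "cmod h"] by (simp add: i norm_mult)
  next
    show "(\<lambda>i. case i of (m, n) \<Rightarrow> a m n * w ^ m * z ^ n) abs_summable_on UNIV" if "w \<in> ?S" for w
      using that by (intro double_series_abs_summable a z) auto
    show "(\<lambda>i. 8 * K * (case i of (m, n) \<Rightarrow> (1/2) ^ (m + n))) summable_on (UNIV :: (nat \<times> nat) set)"
      by (intro summable_on_cmult_right summable_on_half_powers)
    show "0 \<le> 8 * K * (case i of (m, n) \<Rightarrow> (1/2) ^ (m + n))" for i :: "nat \<times> nat"
      using K1 by (auto split: prod.split)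
  qed (use y in auto)
  then have "((\<lambda>w. \<Sum>\<^sub>\<infinity>(m, n). a m n * w ^ m * z ^ n) has_field_derivative infsum (d y) UNIV) (at y within ?S)"
    by (simp add: has_field_derivative_def infsum_cmult_left')
  moreover have "at y within ?S = at y" using y by (intro at_within_open) auto
  ultimately show ?thesis by (simp add: d_def[abs_def])
qed

end

section \<open>The power series of the mixed moments\<close>

context free_compression_real
begin

text \<open>The three sums have total weight at most \<open>m * n + m ^ 2 + n ^ 2\<close>, which is
  below \<open>(m + n) ^ 2\<close>, and every product is bounded by \<open>K ^ (m + n)\<close>; in
  the first sum two powers of \<open>K\<close> are missing and \<open>exp s \<le> K ^ 2\<close>
  supplies them.\<close>

lemma norm_R_deriv_le:
  assumes s: "0 \<le> s" "s \<le> T" and a: "\<alpha> \<le> 1"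
  shows "cmod (R_deriv m n s) \<le> real (m + n) * real (m + n) * exp (T / 2) ^ (m + n)"
proof -
  define K where "K = exp (T / 2)"
  have K: "K \<ge> 1" using s by (simp add: K_def)
  have R: "cmod (R i j s) \<le> K ^ (i + j)" for i j
  proof -
    have "exp (s / 2) ^ (i + j) \<le> K ^ (i + j)" unfolding K_def using s by (intro power_mono) auto
    then show ?thesis using norm_R_le[OF s(1) a, of i j] by linarith
  qed
  have RR: "cmod (R i j s * R k l s) \<le> K ^ (i + j + (k + l))" for i j k l
    unfolding norm_mult power_add[of K "i + j"] using K by (intro mult_mono R) auto
  have e: "exp s \<le> K ^ 2"
    using s by (simp add: K_def power2_eq_square exp_add[symmetric])
  have 1: "cmod (of_real (exp s) * (\<Sum>i<m. \<Sum>j<n. R (m - 1 - i) j s * R i (n - 1 - j) s)) \<le> real m * real n * K ^ (m + n)"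
  proof (cases "m = 0 \<or> n = 0")
    case False
    have "cmod (\<Sum>i<m. \<Sum>j<n. R (m - 1 - i) j s * R i (n - 1 - j) s)
        \<le> of_nat (card {..<m}) * (of_nat (card {..<n}) * K ^ (m + n - 2))"
    proof (intro sum_norm_bound)
      fix i j assume "i \<in> {..<m}" "j \<in> {..<n}"
      then have "m - 1 - i + j + (i + (n - 1 - j)) = m + n - 2" by auto
      then show "cmod (R (m - 1 - i) j s * R i (n - 1 - j) s) \<le> K ^ (m + n - 2)"
        using RR[of "m - 1 - i" j i "n - 1 - j"] by simp
    qed
    then have "cmod (of_real (exp s) * (\<Sum>i<m. \<Sum>j<n. R (m - 1 - i) j s * R i (n - 1 - j) s))
        \<le> K ^ 2 * (real m * (real n * K ^ (m + n - 2)))"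
      unfolding norm_mult using e K by (intro mult_mono) auto
    also have "\<dots> = real m * real n * K ^ (2 + (m + n - 2))" by (simp only: power_add mult_ac)
    also have "2 + (m + n - 2) = m + n" using False by auto
    finally show ?thesis .
  qed auto
  have 2: "cmod (\<Sum>c<m. of_nat (m - 1 - c) * (R (Suc c) 0 s * R (m - 1 - c) n s)) \<le> of_nat (card {..<m}) * (real m * K ^ (m + n))"
  proof (rule sum_norm_bound)
    fix c assume "c \<in> {..<m}"
    then have "Suc c + 0 + (m - 1 - c + n) = m + n" by auto
    then have "cmod (R (Suc c) 0 s * R (m - 1 - c) n s) \<le> K ^ (m + n)"
      using RR[of "Suc c" 0 "m - 1 - c" n] by simp
    then show "cmod (of_nat (m - 1 - c) * (R (Suc c) 0 s * R (m - 1 - c) n s)) \<le> real m * K ^ (m + n)"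
      unfolding norm_mult[of "of_nat (m - 1 - c)"] norm_of_nat by (intro mult_mono) auto
  qed
  have 3: "cmod (\<Sum>c<n. of_nat (n - 1 - c) * (R 0 (Suc c) s * R m (n - 1 - c) s)) \<le> of_nat (card {..<n}) * (real n * K ^ (m + n))"
  proof (rule sum_norm_bound)
    fix c assume "c \<in> {..<n}"
    then have "0 + Suc c + (m + (n - 1 - c)) = m + n" by auto
    then have "cmod (R 0 (Suc c) s * R m (n - 1 - c) s) \<le> K ^ (m + n)"
      using RR[of 0 "Suc c" m "n - 1 - c"] by simp
    then show "cmod (of_nat (n - 1 - c) * (R 0 (Suc c) s * R m (n - 1 - c) s)) \<le> real n * K ^ (m + n)"
      unfolding norm_mult[of "of_nat (n - 1 - c)"] norm_of_nat by (intro mult_mono) auto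
  qed
  have "cmod (R_deriv m n s) \<le> real m * real n * K ^ (m + n) + real m * (real m * K ^ (m + n)) + real n * (real n * K ^ (m + n))"
    unfolding R_deriv_def
    using norm_triangle_ineq4 1 2 3 by (smt (verit) card_lessThan)
  also have "\<dots> = (real m * real n + real m * real m + real n * real n) * K ^ (m + n)"
    by (simp add: algebra_simps)
  also have "\<dots> \<le> real (m + n) * real (m + n) * K ^ (m + n)"
    using K by (intro mult_right_mono) (auto simp: algebra_simps)
  finally show ?thesis by (simp only: K_def)
qed

context
  fixes t :: real and y z :: complex and K :: real
  assumes t: "0 \<le> t" and a: "\<alpha> \<le> 1" and K_def: "K = exp ((t + 1) / 2)"
    and y: "cmod y < 1 / (8 * K)" and z: "cmod z < 1 / (8 * K)"
begin

private lemma K1: "K \<ge> 1" using t by (simp add: K_def)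

private lemma R_bound: "0 \<le> s \<Longrightarrow> s \<le> t + 1 \<Longrightarrow> cmod (R m n s) \<le> K ^ (m + n)"
proof -
  assume s: "0 \<le> s" "s \<le> t + 1"
  then have "exp (s / 2) ^ (m + n) \<le> K ^ (m + n)" unfolding K_def by (intro power_mono) auto
  then show ?thesis using norm_R_le[OF s(1) a, of m n] by linarith
qed

private lemma R_series_abs_summable:
  assumes "0 \<le> s" "s \<le> t + 1"
  shows "(\<lambda>(m, n). R m n s * y ^ m * z ^ n) abs_summable_on UNIV"
  by (intro double_series_abs_summable[OF K1] R_bound assms y z)

private lemma mR_bound: "cmod (of_nat m * (R m n t * v ^ m * w ^ n)) \<le> (1/2) ^ (m + n)"
    "cmod (of_nat n * (R m n t * v ^ m * w ^ n)) \<le> (1/2) ^ (m + n)"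
  if "cmod v < 1 / (8 * K)" "cmod w < 1 / (8 * K)" for v w
proof -
  have R: "cmod (of_nat k * R m n t) \<le> real k * K ^ (m + n)" for k
    using t by (simp add: norm_mult mult_left_mono R_bound)
  have sq: "real k \<le> real (m + n) * real (m + n)" if "k \<le> m + n" for k
  proof -
    have "k \<le> (m + n) * (m + n)" using that le_square[of "m + n"] by (rule order_trans)
    then show ?thesis by (metis of_nat_le_iff of_nat_mult)
  qed
  show "cmod (of_nat m * (R m n t * v ^ m * w ^ n)) \<le> (1/2) ^ (m + n)"
    using term_bound[OF K1 R[of m] disjI1[OF sq[of m]] _ that] by (simp add: mult.assoc)
  show "cmod (of_nat n * (R m n t * v ^ m * w ^ n)) \<le> (1/2) ^ (m + n)"
    using term_bound[OF K1 R[of n] disjI1[OF sq[of n]] _ that] by (simp add: mult.assoc)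
qed

text \<open>\<open>K\<close> is taken at time \<open>t + 1\<close> so that one majorant serves all
  times in \<open>[0, t + 1]\<close>, a relative neighbourhood of \<open>t\<close>.\<close>

lemma phi_time_derivative:
  "((\<lambda>s. phi \<tau> \<alpha> P Y s y z) has_vector_derivative (\<Sum>\<^sub>\<infinity>(m, n). R_deriv m n t * y ^ m * z ^ n)) (at t within {0..})"
    (is "(?\<phi> has_vector_derivative _) _")
proof -
  define d where "d s i = (case i of (m, n) \<Rightarrow> R_deriv m n s * y ^ m * z ^ n)" for s and i :: "nat \<times> nat"
  have d: "cmod (d s (m, n)) \<le> (1/2) ^ (m + n)" if "s \<in> {0..t + 1}" for s m n
    unfolding d_def prod.case
    by (rule term_bound[OF K1 norm_R_deriv_le[of s "t + 1", folded K_def] _ _ y z]) (use that a in auto)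
  have "((\<lambda>s. infsum (\<lambda>i. case i of (m, n) \<Rightarrow> R m n s * y ^ m * z ^ n) UNIV) has_derivative
      (\<lambda>h. infsum (\<lambda>i. h *\<^sub>R d t i) UNIV)) (at t within {0..t + 1})"
  proof (rule infsum_has_derivative[where B = "\<lambda>(m, n). (1/2) ^ (m + n)"])
    fix i :: "nat \<times> nat" and s :: real assume s: "s \<in> {0..t + 1}"
    obtain m n where i: "i = (m, n)" by (cases i)
    have "(R m n has_vector_derivative R_deriv m n s) (at s within {0..t + 1})"
      using s by (intro has_vector_derivative_within_subset[OF R_has_derivative]) auto
    then have "((\<lambda>s. R m n s * (y ^ m * z ^ n)) has_vector_derivative R_deriv m n s * (y ^ m * z ^ n)) (at s within {0..t + 1})"
      by (rule has_vector_derivative_mult_left)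
    then show "((\<lambda>s. case i of (m, n) \<Rightarrow> R m n s * y ^ m * z ^ n) has_derivative (\<lambda>h. h *\<^sub>R d s i)) (at s within {0..t + 1})"
      by (simp add: i d_def has_vector_derivative_def mult.assoc)
    show "norm (h *\<^sub>R d s i) \<le> (case i of (m, n) \<Rightarrow> (1/2) ^ (m + n)) * norm h" for h
      using mult_left_mono[OF d[OF s, of m n], of "\<bar>h\<bar>"] by (simp add: i mult.commute)
  next
    show "(\<lambda>i. case i of (m, n) \<Rightarrow> R m n s * y ^ m * z ^ n) abs_summable_on UNIV" if "s \<in> {0..t + 1}" for s
      using that by (intro R_series_abs_summable) auto
  qed (use t summable_on_half_powers in \<open>auto simp: convex_real_interval\<close>)
  moreover have "infsum (\<lambda>i. h *\<^sub>R d t i) UNIV = h *\<^sub>R infsum (d t) UNIV" for h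
    by (simp add: scaleR_conv_of_real infsum_cmult_right')
  ultimately have "(?\<phi> has_vector_derivative infsum (d t) UNIV) (at t within {0..t + 1})"
    by (simp add: has_vector_derivative_def phi_def)
  \<comment> \<open>Both sets agree near \<open>t\<close>, including \<open>t = 0\<close>, where the
    derivative is one-sided.\<close>
  moreover have "at t within {0..t + 1} = at t within {0..}"
    by (rule at_within_nhd[of t "{t - 1<..<t + 1}"]) auto
  ultimately show ?thesis by (simp add: d_def[abs_def])
qed

lemma phi_y_derivative:
  "((\<lambda>w. phi \<tau> \<alpha> P Y t w z) has_field_derivative (\<Sum>\<^sub>\<infinity>(m, n). R m n t * (of_nat m * y ^ (m - 1)) * z ^ n)) (at y)"
  unfolding phi_def using t by (intro double_series_derivative[OF K1 _ y z] R_bound) auto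

text \<open>Exchanging the summation indices turns this into a derivative in the first
  variable.\<close>

lemma phi_z_derivative:
  "((\<lambda>w. phi \<tau> \<alpha> P Y t y w) has_field_derivative (\<Sum>\<^sub>\<infinity>(m, n). R m n t * y ^ m * (of_nat n * z ^ (n - 1)))) (at z)"
proof -
  have swap: "infsum f UNIV = (\<Sum>\<^sub>\<infinity>(n, m). f (m, n))" for f :: "nat \<times> nat \<Rightarrow> complex"
    using infsum_reindex_bij_betw[of prod.swap UNIV UNIV f] by (simp add: prod.swap_def case_prod_unfold)
  have "((\<lambda>w. \<Sum>\<^sub>\<infinity>(n, m). R m n t * w ^ n * y ^ m) has_field_derivative
      (\<Sum>\<^sub>\<infinity>(n, m). R m n t * (of_nat n * z ^ (n - 1)) * y ^ m)) (at z)"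
  proof (rule double_series_derivative[OF K1 _ z y])
    show "cmod (R m n t) \<le> K ^ (n + m)" for m n
      using R_bound[of t m n] t by (simp add: add.commute)
  qed
  then show ?thesis
    unfolding phi_def swap[of "\<lambda>(m, n). R m n t * y ^ m * (of_nat n * z ^ (n - 1))"]
      swap[of "\<lambda>(m, n). R m n t * y ^ m * w ^ n" for w]
    by (simp add: mult_ac)
qed

lemma Q_abs_summable:
  assumes "cmod v < 1 / (8 * K)" shows "(\<lambda>n. Q n (\<alpha> * t) * v ^ n) abs_summable_on {1..}"
proof -
  have "(\<lambda>n. (1/2 :: real) ^ n) summable_on UNIV"
    by (subst summable_on_UNIV_nonneg_real_iff) auto
  then have "(\<lambda>n. (1/2 :: real) ^ n) summable_on {1..}"
    by (rule summable_on_subset_banach) simp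
  then show ?thesis
  proof (rule summable_on_comparison_test)
    fix n :: nat
    have at: "0 \<le> \<alpha> * t" "\<alpha> * t \<le> t" using t a alpha_pos mult_right_mono[of \<alpha> 1 t] by auto
    have "cmod (Q n (\<alpha> * t)) \<le> exp (\<alpha> * t / 2) ^ n" by (rule norm_Q_le[OF at(1)])
    also have "\<dots> \<le> K ^ n" unfolding K_def using at by (intro power_mono) auto
    finally have "cmod (Q n (\<alpha> * t)) \<le> 1 * K ^ (n + 0)" by simp
    from term_bound[OF K1 this _ _ assms z] show "norm (Q n (\<alpha> * t) * v ^ n) \<le> (1/2) ^ n" by simp
  qed simp
qed

private lemma eta_eq: "of_real \<alpha> * eta \<tau> Y (\<alpha> * t) v = (\<Sum>\<^sub>\<infinity>c. of_real \<alpha> * Q (Suc c) (\<alpha> * t) * v ^ Suc c)"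
proof -
  have bij: "bij_betw Suc UNIV {1..}"
    by (rule bij_betw_byWitness[where f' = "\<lambda>n. n - 1"]) auto
  show ?thesis
    unfolding eta_def infsum_reindex_bij_betw[OF bij, of "\<lambda>n. Q n (\<alpha> * t) * v ^ n", symmetric]
    by (simp only: infsum_cmult_right'[symmetric] mult.assoc)
qed

private lemma eta_abs_summable:
  assumes "cmod v < 1 / (8 * K)"
  shows "(\<lambda>c. of_real \<alpha> * Q (Suc c) (\<alpha> * t) * v ^ Suc c) abs_summable_on UNIV"
proof -
  have bij: "bij_betw Suc UNIV {1..}"
    by (rule bij_betw_byWitness[where f' = "\<lambda>n. n - 1"]) auto
  have "(\<lambda>c. norm (Q (Suc c) (\<alpha> * t) * v ^ Suc c)) summable_on UNIV"
    using Q_abs_summable[OF assms] summable_on_reindex_bij_betw[OF bij, of "\<lambda>n. norm (Q n (\<alpha> * t) * v ^ n)"] by simp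
  from summable_on_cmult_right[OF this, of \<alpha>] show ?thesis
    using alpha_pos by (simp add: norm_mult mult.assoc)
qed

text \<open>Comparison of coefficients: \<open>S1\<close>, \<open>S2\<close> and \<open>S3\<close>
  are the three sums in \<open>R_deriv\<close>, and regrouping absolutely convergent products
  identifies their totals with the square of \<open>phi\<close> and with the two products of
  \<open>eta\<close> and a derivative. There \<open>R_left_eq\<close> and \<open>R_right_eq\<close>
  replace the coefficients of \<open>eta\<close> by \<open>R l 0\<close> and
  \<open>R 0 l\<close>.\<close>

lemma phi_pde:
  "(\<Sum>\<^sub>\<infinity>(m, n). R_deriv m n t * y ^ m * z ^ n)
     + of_real \<alpha> * y * eta \<tau> Y (\<alpha> * t) y * (\<Sum>\<^sub>\<infinity>(m, n). R m n t * (of_nat m * y ^ (m - 1)) * z ^ n)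
     + of_real \<alpha> * z * eta \<tau> Y (\<alpha> * t) z * (\<Sum>\<^sub>\<infinity>(m, n). R m n t * y ^ m * (of_nat n * z ^ (n - 1)))
   = of_real (exp t) * y * z * (phi \<tau> \<alpha> P Y t y z)\<^sup>2"
proof -
  define T where "T i = (case i of (m, n) \<Rightarrow> R m n t * y ^ m * z ^ n)" for i :: "nat \<times> nat"
  \<comment> \<open>For \<open>m = 0\<close> or \<open>n = 0\<close> the sum is empty, so the
    truncated exponents \<open>m - 1\<close> and \<open>n - 1\<close> do no harm.\<close>
  define S1 where "S1 k = (\<Sum>j\<in>(case k of (m, n) \<Rightarrow> {..<m} \<times> {..<n}).
      (case k of (m, n) \<Rightarrow> case j of (i, j) \<Rightarrow> R (m - 1 - i) j t * R i (n - 1 - j) t * y ^ (m - 1) * z ^ (n - 1)))"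
    for k :: "nat \<times> nat"
  define S2 where "S2 k = (\<Sum>c<fst k. of_nat (fst k - 1 - c) * (R (Suc c) 0 t * R (fst k - 1 - c) (snd k) t) * y ^ fst k * z ^ snd k)"
    for k :: "nat \<times> nat"
  define S3 where "S3 k = (\<Sum>c<snd k. of_nat (snd k - 1 - c) * (R 0 (Suc c) t * R (fst k) (snd k - 1 - c) t) * y ^ fst k * z ^ snd k)"
    for k :: "nat \<times> nat"
  have T_sum: "T abs_summable_on UNIV"
    unfolding T_def[abs_def] using t by (intro R_series_abs_summable) auto
  have T_eq: "T (m, n) = R m n t * y ^ m * z ^ n" for m n by (simp add: T_def)
  have Tm_sum: "(\<lambda>i. of_nat (fst i) * T i) abs_summable_on UNIV" "(\<lambda>i. of_nat (snd i) * T i) abs_summable_on UNIV"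
    by (rule abs_summable_half[OF K1], use mR_bound[OF y z] in \<open>simp add: T_eq\<close>)+

  have 1: "S1 summable_on UNIV" "(phi \<tau> \<alpha> P Y t y z)\<^sup>2 = infsum S1 UNIV"
  proof -
    \<comment> \<open>The two index pairs add up to \<open>(m - 1, n - 1)\<close> and are crossed as
      in the double sum of \<open>R_deriv\<close>; in the inverse, \<open>(m, n)\<close> is their
      sum plus \<open>(1, 1)\<close>.\<close>
    define h where "h x = (case x of ((m, n), (i, j)) \<Rightarrow> ((m - 1 - i, j), (i, n - 1 - j)))" for x :: "(nat \<times> nat) \<times> (nat \<times> nat)"
    define J where "J k = (case k of (m, n) \<Rightarrow> {..<m} \<times> {..<n})" for k :: "nat \<times> nat"
    have h: "bij_betw h (Sigma UNIV J) (UNIV \<times> UNIV)"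
      by (rule bij_betw_byWitness[where f' = "\<lambda>((a, b), (c, d)). ((a + c + 1, b + d + 1), (c, b))"])
        (auto simp: h_def J_def)
    have J: "finite (J k)" for k by (cases k) (simp add: J_def)
    have eq: "(\<Sum>j\<in>J k. (case h (k, j) of (a, b) \<Rightarrow> T a * T b)) = S1 k" for k
      unfolding S1_def J_def[symmetric]
    proof (rule sum.cong)
      fix x assume x: "x \<in> J k"
      obtain m n i j where k: "k = (m, n)" "x = (i, j)" by (cases k, cases x)
      have "m - 1 - i + i = m - 1" "j + (n - 1 - j) = n - 1" using x by (auto simp: k J_def)
      then have "y ^ (m - 1) = y ^ (m - 1 - i) * y ^ i" "z ^ (n - 1) = z ^ j * z ^ (n - 1 - j)"
        by (metis power_add)+
      then show "(case h (k, x) of (a, b) \<Rightarrow> T a * T b) = (case k of (m, n) \<Rightarrow> case x of (i, j) \<Rightarrow>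
          R (m - 1 - i) j t * R i (n - 1 - j) t * y ^ (m - 1) * z ^ (n - 1))"
        by (simp add: k h_def T_eq mult_ac)
    qed simp
    note abs = abs_summable_on_times[OF T_sum T_sum]
    show "S1 summable_on UNIV"
      using summable_on_regroup[OF abs h J] unfolding eq by simp
    have "(phi \<tau> \<alpha> P Y t y z)\<^sup>2 = infsum T UNIV * infsum T UNIV"
      by (simp add: phi_def T_def[abs_def] power2_eq_square)
    also have "\<dots> = infsum S1 UNIV"
      unfolding infsum_mult_infsum[OF T_sum T_sum] infsum_regroup_eq[OF abs h J] eq by simp
    finally show "(phi \<tau> \<alpha> P Y t y z)\<^sup>2 = infsum S1 UNIV" .
  qed

  have 2: "S2 summable_on UNIV"
    "of_real \<alpha> * eta \<tau> Y (\<alpha> * t) y * infsum (\<lambda>i. of_nat (fst i) * T i) UNIV = infsum S2 UNIV"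
  proof -
    define h where "h x = (case x of ((m, n), c) \<Rightarrow> (c, (m - 1 - c, n)))" for x :: "(nat \<times> nat) \<times> nat"
    have h: "bij_betw h (Sigma UNIV (\<lambda>k. {..<fst k})) (UNIV \<times> UNIV)"
      by (rule bij_betw_byWitness[where f' = "\<lambda>(c, (m, n)). ((m + c + 1, n), c)"]) (auto simp: h_def)
    have eq: "(\<Sum>j<fst k. (case h (k, j) of (c, i) \<Rightarrow> of_real \<alpha> * Q (Suc c) (\<alpha> * t) * y ^ Suc c * (of_nat (fst i) * T i))) = S2 k" for k
      unfolding S2_def
    proof (rule sum.cong)
      fix c assume c: "c \<in> {..<fst k}"
      obtain m n where k: "k = (m, n)" by (cases k)
      have "Suc c + (m - 1 - c) = m" using c by (simp add: k)
      then have "y ^ m = y ^ Suc c * y ^ (m - 1 - c)" by (metis power_add)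
      then show "(case h (k, c) of (c, i) \<Rightarrow> of_real \<alpha> * Q (Suc c) (\<alpha> * t) * y ^ Suc c * (of_nat (fst i) * T i))
          = of_nat (fst k - 1 - c) * (R (Suc c) 0 t * R (fst k - 1 - c) (snd k) t) * y ^ fst k * z ^ snd k"
        using R_left_eq[of "Suc c" t] t by (simp only: k h_def T_eq fst_conv snd_conv prod.case) (simp add: mult_ac)
    qed simp
    note abs = abs_summable_on_times[OF eta_abs_summable[OF y] Tm_sum(1)]
    show "S2 summable_on UNIV"
      using summable_on_regroup[OF abs h] unfolding eq by simp
    have "of_real \<alpha> * eta \<tau> Y (\<alpha> * t) y * infsum (\<lambda>i. of_nat (fst i) * T i) UNIV
       = infsum (\<lambda>(c, i). of_real \<alpha> * Q (Suc c) (\<alpha> * t) * y ^ Suc c * (of_nat (fst i) * T i)) (UNIV \<times> UNIV)"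
      unfolding eta_eq by (rule infsum_mult_infsum[OF eta_abs_summable[OF y] Tm_sum(1)])
    also have "\<dots> = infsum S2 UNIV"
      using infsum_regroup_eq[OF abs h] unfolding eq by simp
    finally show "of_real \<alpha> * eta \<tau> Y (\<alpha> * t) y * infsum (\<lambda>i. of_nat (fst i) * T i) UNIV = infsum S2 UNIV" .
  qed

  have 3: "S3 summable_on UNIV"
    "of_real \<alpha> * eta \<tau> Y (\<alpha> * t) z * infsum (\<lambda>i. of_nat (snd i) * T i) UNIV = infsum S3 UNIV"
  proof -
    define h where "h x = (case x of ((m, n), c) \<Rightarrow> (c, (m, n - 1 - c)))" for x :: "(nat \<times> nat) \<times> nat"
    have h: "bij_betw h (Sigma UNIV (\<lambda>k. {..<snd k})) (UNIV \<times> UNIV)"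
      by (rule bij_betw_byWitness[where f' = "\<lambda>(c, (m, n)). ((m, n + c + 1), c)"]) (auto simp: h_def)
    have eq: "(\<Sum>j<snd k. (case h (k, j) of (c, i) \<Rightarrow> of_real \<alpha> * Q (Suc c) (\<alpha> * t) * z ^ Suc c * (of_nat (snd i) * T i))) = S3 k" for k
      unfolding S3_def
    proof (rule sum.cong)
      fix c assume c: "c \<in> {..<snd k}"
      obtain m n where k: "k = (m, n)" by (cases k)
      have "Suc c + (n - 1 - c) = n" using c by (simp add: k)
      then have "z ^ n = z ^ Suc c * z ^ (n - 1 - c)" by (metis power_add)
      then show "(case h (k, c) of (c, i) \<Rightarrow> of_real \<alpha> * Q (Suc c) (\<alpha> * t) * z ^ Suc c * (of_nat (snd i) * T i))
          = of_nat (snd k - 1 - c) * (R 0 (Suc c) t * R (fst k) (snd k - 1 - c) t) * y ^ fst k * z ^ snd k"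
        using R_right_eq[of "Suc c" t] t by (simp only: k h_def T_eq fst_conv snd_conv prod.case) (simp add: mult_ac)
    qed simp
    note abs = abs_summable_on_times[OF eta_abs_summable[OF z] Tm_sum(2)]
    show "S3 summable_on UNIV"
      using summable_on_regroup[OF abs h] unfolding eq by simp
    have "of_real \<alpha> * eta \<tau> Y (\<alpha> * t) z * infsum (\<lambda>i. of_nat (snd i) * T i) UNIV
       = infsum (\<lambda>(c, i). of_real \<alpha> * Q (Suc c) (\<alpha> * t) * z ^ Suc c * (of_nat (snd i) * T i)) (UNIV \<times> UNIV)"
      unfolding eta_eq by (rule infsum_mult_infsum[OF eta_abs_summable[OF z] Tm_sum(2)])
    also have "\<dots> = infsum S3 UNIV"
      using infsum_regroup_eq[OF abs h] unfolding eq by simp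
    finally show "of_real \<alpha> * eta \<tau> Y (\<alpha> * t) z * infsum (\<lambda>i. of_nat (snd i) * T i) UNIV = infsum S3 UNIV" .
  qed

  have coeff: "(case k of (m, n) \<Rightarrow> R_deriv m n t * y ^ m * z ^ n) = of_real (exp t) * y * z * S1 k - S2 k - S3 k" for k
  proof -
    obtain m n where k: "k = (m, n)" by (cases k)
    have "y * z * S1 k = (\<Sum>i<m. \<Sum>j<n. R (m - 1 - i) j t * R i (n - 1 - j) t) * y ^ m * z ^ n"
    proof -
      have "y * z * S1 k = (\<Sum>i<m. \<Sum>j<n. y * z * (R (m - 1 - i) j t * R i (n - 1 - j) t * y ^ (m - 1) * z ^ (n - 1)))"
        by (simp add: S1_def k sum.cartesian_product sum_distrib_left case_prod_unfold)
      also have "\<dots> = (\<Sum>i<m. \<Sum>j<n. R (m - 1 - i) j t * R i (n - 1 - j) t * y ^ m * z ^ n)"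
        by (intro sum.cong refl) (auto simp: power_eq_if[of y m] power_eq_if[of z n] mult_ac)
      finally show ?thesis by (simp only: sum_distrib_right)
    qed
    moreover have "S2 k = (\<Sum>c<m. of_nat (m - 1 - c) * (R (Suc c) 0 t * R (m - 1 - c) n t)) * y ^ m * z ^ n"
      "S3 k = (\<Sum>c<n. of_nat (n - 1 - c) * (R 0 (Suc c) t * R m (n - 1 - c) t)) * y ^ m * z ^ n"
      by (simp_all only: S2_def S3_def k fst_conv snd_conv sum_distrib_right)
    ultimately show ?thesis
      by (simp only: k prod.case R_deriv_def mult.assoc[of "of_real (exp t)"]) (simp only: left_diff_distrib mult.assoc)
  qed
  have "(\<Sum>\<^sub>\<infinity>(m, n). R_deriv m n t * y ^ m * z ^ n) = of_real (exp t) * y * z * infsum S1 UNIV - infsum S2 UNIV - infsum S3 UNIV"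
    unfolding coeff
    by (rule infsum_linear_combination[OF 1(1) 2(1) 3(1)])
  moreover have "of_real \<alpha> * y * eta \<tau> Y (\<alpha> * t) y * (\<Sum>\<^sub>\<infinity>(m, n). R m n t * (of_nat m * y ^ (m - 1)) * z ^ n) = infsum S2 UNIV"
  proof -
    \<comment> \<open>The factor \<open>y\<close> completes \<open>y ^ (m - 1)\<close> to
      \<open>y ^ m\<close>; for \<open>m = 0\<close> the coefficient is zero.\<close>
    have "y * (\<Sum>\<^sub>\<infinity>(m, n). R m n t * (of_nat m * y ^ (m - 1)) * z ^ n) = infsum (\<lambda>i. of_nat (fst i) * T i) UNIV"
      unfolding infsum_cmult_right'[symmetric]
      by (rule infsum_cong) (auto simp: T_eq power_eq_if mult_ac)
    then show ?thesis unfolding 2(2)[symmetric] by (rule mult_swap_eq)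
  qed
  moreover have "of_real \<alpha> * z * eta \<tau> Y (\<alpha> * t) z * (\<Sum>\<^sub>\<infinity>(m, n). R m n t * y ^ m * (of_nat n * z ^ (n - 1))) = infsum S3 UNIV"
  proof -
    have "z * (\<Sum>\<^sub>\<infinity>(m, n). R m n t * y ^ m * (of_nat n * z ^ (n - 1))) = infsum (\<lambda>i. of_nat (snd i) * T i) UNIV"
      unfolding infsum_cmult_right'[symmetric]
      by (rule infsum_cong) (auto simp: T_eq power_eq_if mult_ac)
    then show ?thesis unfolding 3(2)[symmetric] by (rule mult_swap_eq)
  qed
  ultimately show ?thesis
    unfolding 1(2) by simp
qed

lemma phi_pde_holds:
  "(\<lambda>(m, n). norm (R m n t * y ^ m * z ^ n)) summable_on UNIV \<and>
    (\<lambda>n. norm (Q n (\<alpha> * t) * y ^ n)) summable_on {1..} \<and>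
    (\<lambda>n. norm (Q n (\<alpha> * t) * z ^ n)) summable_on {1..} \<and>
    (\<exists>\<phi>\<^sub>t \<phi>\<^sub>y \<phi>\<^sub>z.
       ((\<lambda>s. phi \<tau> \<alpha> P Y s y z) has_vector_derivative \<phi>\<^sub>t) (at t within {0..}) \<and>
       ((\<lambda>w. phi \<tau> \<alpha> P Y t w z) has_field_derivative \<phi>\<^sub>y) (at y) \<and>
       ((\<lambda>w. phi \<tau> \<alpha> P Y t y w) has_field_derivative \<phi>\<^sub>z) (at z) \<and>
       \<phi>\<^sub>t + complex_of_real \<alpha> * y * eta \<tau> Y (\<alpha> * t) y * \<phi>\<^sub>y
         + complex_of_real \<alpha> * z * eta \<tau> Y (\<alpha> * t) z * \<phi>\<^sub>z
         = complex_of_real (exp t) * y * z * (phi \<tau> \<alpha> P Y t y z)\<^sup>2)"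
proof (intro conjI exI)
  show "(\<lambda>(m, n). norm (R m n t * y ^ m * z ^ n)) summable_on UNIV"
    using R_series_abs_summable[OF t] by (simp add: case_prod_unfold)
qed (rule Q_abs_summable y z phi_time_derivative phi_y_derivative phi_z_derivative phi_pde)+

end

end

theorem corollary3p2:
  fixes M :: "'h::complex_hilbert_space cop set" and \<tau> :: "'h cop \<Rightarrow> complex"
    and \<alpha> :: real and P :: "'h cop" and Y :: "real \<Rightarrow> 'h cop"
  assumes "nc_probability_space M \<tau>"
    and "0 < \<alpha>" and "\<alpha> \<le> 1"
    and "P \<in> M" and "star P = P" and "P * P = P" and "\<tau> P = complex_of_real \<alpha>"
    and "free_unitary_brownian_motion M \<tau> Y"
    and "star_free \<tau> {P} (Y ` {0..})"
  shows "\<forall>t\<ge>0. \<exists>\<epsilon>>0. \<forall>(y::complex) (z::complex). cmod y < \<epsilon> \<and> cmod z < \<epsilon> \<longrightarrow>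
    (\<lambda>(m, n). norm (R_mom \<tau> \<alpha> P Y m n t * y ^ m * z ^ n)) summable_on UNIV \<and>
    (\<lambda>n. norm (Q_mom \<tau> Y n (\<alpha> * t) * y ^ n)) summable_on {1..} \<and>
    (\<lambda>n. norm (Q_mom \<tau> Y n (\<alpha> * t) * z ^ n)) summable_on {1..} \<and>
    (\<exists>\<phi>\<^sub>t \<phi>\<^sub>y \<phi>\<^sub>z.
       ((\<lambda>s. phi \<tau> \<alpha> P Y s y z) has_vector_derivative \<phi>\<^sub>t) (at t within {0..}) \<and>
       ((\<lambda>w. phi \<tau> \<alpha> P Y t w z) has_field_derivative \<phi>\<^sub>y) (at y) \<and>
       ((\<lambda>w. phi \<tau> \<alpha> P Y t y w) has_field_derivative \<phi>\<^sub>z) (at z) \<and>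
       \<phi>\<^sub>t + complex_of_real \<alpha> * y * eta \<tau> Y (\<alpha> * t) y * \<phi>\<^sub>y
         + complex_of_real \<alpha> * z * eta \<tau> Y (\<alpha> * t) z * \<phi>\<^sub>z
         = complex_of_real (exp t) * y * z * (phi \<tau> \<alpha> P Y t y z)\<^sup>2)"
proof (intro allI impI)
  fix t :: real assume t: "0 \<le> t"
  from assms(8) obtain X where X: "free_additive_brownian_motion M \<tau> X"
    and Y: "\<forall>t\<ge>0. Y t \<in> natural_filtration X t \<and> star (Y t) * Y t = 1 \<and> Y t * star (Y t) = 1" "Y 0 = 1"
      "\<forall>t\<ge>0. \<exists>J D. has_free_ito_integral \<tau> X t Y J \<and> (Y has_integral D) {0..t} \<and>
           Y t = 1 + \<i> *\<^sub>C J - (1/2) *\<^sub>C D"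
    unfolding free_unitary_brownian_motion_def by blast
  interpret free_compression_real M \<tau> X Y P \<alpha>
    by unfold_locales (use assms X Y in auto)
  define K where "K = exp ((t + 1) / 2)"
  have "1 / (8 * K) > 0" by (simp add: K_def)
  then show "\<exists>\<epsilon>>0. \<forall>(y::complex) (z::complex). cmod y < \<epsilon> \<and> cmod z < \<epsilon> \<longrightarrow>
    (\<lambda>(m, n). norm (R_mom \<tau> \<alpha> P Y m n t * y ^ m * z ^ n)) summable_on UNIV \<and>
    (\<lambda>n. norm (Q_mom \<tau> Y n (\<alpha> * t) * y ^ n)) summable_on {1..} \<and>
    (\<lambda>n. norm (Q_mom \<tau> Y n (\<alpha> * t) * z ^ n)) summable_on {1..} \<and>
    (\<exists>\<phi>\<^sub>t \<phi>\<^sub>y \<phi>\<^sub>z.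
       ((\<lambda>s. phi \<tau> \<alpha> P Y s y z) has_vector_derivative \<phi>\<^sub>t) (at t within {0..}) \<and>
       ((\<lambda>w. phi \<tau> \<alpha> P Y t w z) has_field_derivative \<phi>\<^sub>y) (at y) \<and>
       ((\<lambda>w. phi \<tau> \<alpha> P Y t y w) has_field_derivative \<phi>\<^sub>z) (at z) \<and>
       \<phi>\<^sub>t + complex_of_real \<alpha> * y * eta \<tau> Y (\<alpha> * t) y * \<phi>\<^sub>y
         + complex_of_real \<alpha> * z * eta \<tau> Y (\<alpha> * t) z * \<phi>\<^sub>z
         = complex_of_real (exp t) * y * z * (phi \<tau> \<alpha> P Y t y z)\<^sup>2)"
    using phi_pde_holds[OF t assms(3) K_def] by blast
qed

end
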